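(* Let $r\geq 2$, $1\leq \ell\leq r$, and for $n\geq\binom{r}{\ell}$ let $(V_1^{(n)},\ldots,V_r^{(n)})$ be uniformly distributed on $H_{\ell,r}(n)$. Then, as $n\to\infty$, \[ \frac{{\rm LCM}(V_1^{(n)},\ldots,V_r^{(n)})}{V_1^{(n)}\cdots V_r^{(n)}}\overset{{\rm d}}{\longrightarrow}\prod_{p\in\mathcal{P}}p^{\max_{k=1,\ldots,r}\mathcal{G}_k(p)-\sum_{k=1}^r\mathcal{G}_k(p)}, \] \[ \frac{{\rm LCM}(V_1^{(n)},\ldots,V_r^{(n)})}{n^{r/\ell}}\overset{{\rm d}}{\longrightarrow}U_{\ell,r}\prod_{p\in\mathcal{P}}p^{\max_{k=1,\ldots,r}\mathcal{G}_k(p)-\sum_{k=1}^r\mathcal{G}_k(p)}, \] where $U_{\ell,r}$ is independent of all $\mathcal{G}_k(p)$. Moreover, in both convergences, all power moments of positive order converge to the corresponding moments of the limit random variables.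
   Context: $P_\ell(x_1,\ldots,x_r)=\sum_{1\leq i_1<\cdots<i_\ell\leq r}x_{i_1}\cdots x_{i_\ell}$; $H_{\ell,r}(n)=\{(i_1,\ldots,i_r)\in\mathbb{N}^r: P_\ell(i_1,\ldots,i_r)\leq n\}$, $\mathbb{N}=\{1,2,\ldots\}$. $\mathcal{P}$ is the set of primes; $(\mathcal{G}_k(p))_{k\in\mathbb{N},p\in\mathcal{P}}$ are mutually independent with $\mathbb{P}\{\mathcal{G}_k(p)=j\}=(1-1/p)p^{-j}$, $j\geq 0$. If $\ell=r$, $U_{r,r}$ is uniform on $[0,1]$. If $\ell<r$, $\mathcal{V}_{\ell,r}$ denotes the (finite) Lebesgue measure of $\{y\in[0,\infty)^r:P_\ell(y)\leq 1\}$ and $U_{\ell,r}$ has distribution function $\mathbb{P}\{U_{\ell,r}\leq x\}=\mathcal{V}_{\ell,r}^{-1}\int_{[0,\infty)^r}\mathbbm{1}_{\{P_\ell(y)\leq 1,\,y_1\cdots y_r\leq x\}}{\rm d}y$ for $x\in[0,\binom{r}{\ell}^{-r/\ell}]$. *)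

theory Defs
  imports "HOL-Probability.Probability" "HOL-Computational_Algebra.Primes"
begin

definition esym :: "nat \<Rightarrow> nat \<Rightarrow> (nat \<Rightarrow> 'a::comm_semiring_1) \<Rightarrow> 'a" where
  "esym l r x = (\<Sum>S | S \<subseteq> {1..r} \<and> card S = l. \<Prod>i\<in>S. x i)"

definition hyp_set :: "nat \<Rightarrow> nat \<Rightarrow> nat \<Rightarrow> (nat \<Rightarrow> nat) set" where
  "hyp_set l r n = {v \<in> {1..r} \<rightarrow>\<^sub>E {1..}. esym l r v \<le> n}"

definition uniform_on_hyp ::
    "nat \<Rightarrow> nat \<Rightarrow> nat \<Rightarrow> 'a measure \<Rightarrow> (nat \<Rightarrow> 'a \<Rightarrow> nat) \<Rightarrow> bool" where
  "uniform_on_hyp l r n M V \<longleftrightarrow>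
     (\<forall>k\<in>{1..r}. V k \<in> M \<rightarrow>\<^sub>M count_space UNIV) \<and>
     distr M (count_space UNIV) (\<lambda>\<omega>. \<lambda>k\<in>{1..r}. V k \<omega>) = measure_pmf (pmf_of_set (hyp_set l r n))"

definition geometric_family :: "'b measure \<Rightarrow> (nat \<Rightarrow> nat \<Rightarrow> 'b \<Rightarrow> nat) \<Rightarrow> bool" where
  "geometric_family N G \<longleftrightarrow>
     prob_space.indep_vars N (\<lambda>_. count_space UNIV) (\<lambda>(k, p). G k p) ({1..} \<times> {p. prime p}) \<and>
     (\<forall>k\<ge>1. \<forall>p j. prime p \<longrightarrow>
        measure N {\<omega> \<in> space N. G k p \<omega> = j} = (1 - 1 / real p) * (1 / real p) ^ j)"

definition vol_below :: "nat \<Rightarrow> nat \<Rightarrow> real \<Rightarrow> real" where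
  "vol_below l r x = (\<integral>y. indicator
     {y. (\<forall>i\<in>{1..r}. 0 \<le> y i) \<and> esym l r y \<le> 1 \<and> (\<Prod>i=1..r. y i) \<le> x} y
     \<partial>(\<Pi>\<^sub>M i\<in>{1..r}. (lborel :: real measure)))"

definition vol_total :: "nat \<Rightarrow> nat \<Rightarrow> real" where
  "vol_total l r = measure (\<Pi>\<^sub>M i\<in>{1..r}. (lborel :: real measure))
     {y \<in> {1..r} \<rightarrow>\<^sub>E {0..}. esym l r y \<le> 1}"

text \<open>For \<open>l < r\<close> the product of the coordinates is at most
  \<open>(r choose l) powr (- r / l)\<close> on the region measured by \<open>vol_total\<close> (Maclaurin), so the
  distribution function reaches 1 at the right end point and the law is determined by its
  values on this interval.\<close>

definition has_U_law :: "nat \<Rightarrow> nat \<Rightarrow> 'b measure \<Rightarrow> ('b \<Rightarrow> real) \<Rightarrow> bool" where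
  "has_U_law l r N U \<longleftrightarrow> U \<in> borel_measurable N \<and>
     (if l = r then distr N borel U = uniform_measure lborel {0..1}
      else (\<forall>x\<in>{0..real (r choose l) powr (- (real r / real l))}.
              measure N {\<omega> \<in> space N. U \<omega> \<le> x} = vol_below l r x / vol_total l r))"

text \<open>The library's \<open>indep_var\<close> needs both variables to have the same type, so independence of the
  real variable \<open>U\<close> and the whole integer-valued family is stated through the generated
  sigma-algebras.\<close>

definition indep_of_family :: "'b measure \<Rightarrow> ('b \<Rightarrow> real) \<Rightarrow> (nat \<Rightarrow> nat \<Rightarrow> 'b \<Rightarrow> nat) \<Rightarrow> bool" where
  "indep_of_family N U G \<longleftrightarrow>
     (let I = {1..} \<times> {p. prime p} in
      prob_space.indep_set N
        (sets (vimage_algebra (space N) U borel))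
        (sets (vimage_algebra (space N) (\<lambda>\<omega>. \<lambda>(k, p)\<in>I. G k p \<omega>)
           (\<Pi>\<^sub>M i\<in>I. count_space UNIV))))"

text \<open>The exponents are nonpositive and, for \<open>r \<ge> 2\<close>, almost surely only finitely many
  of them are nonzero; on the exceptional null set \<open>prodinf\<close> has a fixed unspecified value.\<close>

definition prime_prod :: "nat \<Rightarrow> (nat \<Rightarrow> nat \<Rightarrow> 'b \<Rightarrow> nat) \<Rightarrow> 'b \<Rightarrow> real" where
  "prime_prod r G \<omega> = prodinf (\<lambda>p. if prime p
     then real p powi (int (MAX k\<in>{1..r}. G k p \<omega>) - int (\<Sum>k=1..r. G k p \<omega>)) else 1)"

text \<open>The variables \<open>X n\<close> may live on different probability spaces \<open>M n\<close>, and only large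
  \<open>n\<close> matter.\<close>

definition conv_in_distr ::
    "(nat \<Rightarrow> 'a measure) \<Rightarrow> (nat \<Rightarrow> 'a \<Rightarrow> real) \<Rightarrow> 'b measure \<Rightarrow> ('b \<Rightarrow> real) \<Rightarrow> bool" where
  "conv_in_distr M X N Y \<longleftrightarrow>
     (\<forall>\<^sub>F n in sequentially. X n \<in> borel_measurable (M n)) \<and> Y \<in> borel_measurable N \<and>
     weak_conv_m (\<lambda>n. distr (M n) borel (X n)) (distr N borel Y)"

text \<open>Integrability is included because the Bochner integral of a non-integrable function is 0.\<close>

definition moments_converge ::
    "(nat \<Rightarrow> 'a measure) \<Rightarrow> (nat \<Rightarrow> 'a \<Rightarrow> real) \<Rightarrow> 'b measure \<Rightarrow> ('b \<Rightarrow> real) \<Rightarrow> bool" where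
  "moments_converge M X N Y \<longleftrightarrow> (\<forall>s>0.
     (\<forall>\<^sub>F n in sequentially. integrable (M n) (\<lambda>\<omega>. X n \<omega> powr s)) \<and>
     integrable N (\<lambda>\<omega>. Y \<omega> powr s) \<and>
     (\<lambda>n. \<integral>\<omega>. X n \<omega> powr s \<partial>M n) \<longlonglongrightarrow> (\<integral>\<omega>. Y \<omega> powr s \<partial>N))"

end

theory Submission
  imports Defs
begin

text \<open>
  The sets \<open>H\<^sub>l\<^sub>,\<^sub>r(n)\<close>, also when intersected with \<open>{v. v\<^sub>1 \<cdots> v\<^sub>r \<le> x n\<^bsup>r/l\<^esup>}\<close>, are closed under
  decreasing a coordinate. In such a set, imposing \<open>d dvd v\<^sub>k\<close> divides the cardinality by \<open>d\<close> up
  to an error bounded by the number of points with \<open>v\<^sub>k = 1\<close>, and never leaves more than the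
  \<open>d\<close>-th part. These facets have vanishing relative frequency, because moving a factor \<open>t\<close> from
  another coordinate to the \<open>k\<close>-th one stays inside \<open>H\<^sub>l\<^sub>,\<^sub>r(n)\<close> and the harmonic series
  diverges. Hence the \<open>p\<close>-adic valuations of the coordinates at finitely many primes are
  asymptotically independent geometric variables, also independent of the rescaled product, whose
  law is found for \<open>l < r\<close> by counting lattice points in a region of finite volume and for
  \<open>l = r\<close> by comparing \<open>\<lfloor>x a\<rfloor>\<close> with \<open>x \<lfloor>a\<rfloor>\<close> in every fibre.

  The quotient of lcm and product is a function of the valuations to which a prime contributes
  only if it divides two coordinates. This has probability at most \<open>1 / p\<^sup>2\<close> for each pair of
  coordinates, uniformly in \<open>n\<close>, so the primes above \<open>m\<close> matter with probability at most
  \<open>r\<^sup>2 / m\<close> and the limits \<open>n \<rightarrow> \<infinity>\<close> and \<open>m \<rightarrow> \<infinity>\<close> may be exchanged. All variables lie in \<open>[0, 1]\<close>,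
  so moments follow.
\<close>

section \<open>Sets of lattice points closed under decreasing a coordinate\<close>

definition lower_at :: "'i \<Rightarrow> ('i \<Rightarrow> nat) set \<Rightarrow> bool" where
  "lower_at i A \<longleftrightarrow> (\<forall>v\<in>A. 1 \<le> v i \<and> (\<forall>t. 1 \<le> t \<longrightarrow> t \<le> v i \<longrightarrow> v(i := t) \<in> A))"

definition face :: "'i set \<Rightarrow> ('i \<Rightarrow> nat) set \<Rightarrow> ('i \<Rightarrow> nat) set" where
  "face I A = {v\<in>A. \<forall>i\<in>I. v i = 1}"

lemma lower_atD: "lower_at i A \<Longrightarrow> v \<in> A \<Longrightarrow> 1 \<le> t \<Longrightarrow> t \<le> v i \<Longrightarrow> v(i := t) \<in> A"
  by (auto simp: lower_at_def)

lemma lower_at_ge_1: "lower_at i A \<Longrightarrow> v \<in> A \<Longrightarrow> 1 \<le> v i"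
  by (auto simp: lower_at_def)

lemma lower_at_dvd_filter:
  "lower_at i A \<Longrightarrow> i \<notin> J \<Longrightarrow> lower_at i {v\<in>A. \<forall>k\<in>J. d k dvd v k}"
  unfolding lower_at_def by auto

lemma lower_at_face: "lower_at i A \<Longrightarrow> i \<notin> J \<Longrightarrow> lower_at i (face J A)"
  unfolding lower_at_def face_def by auto

lemma face_subset: "face I A \<subseteq> A"
  by (auto simp: face_def)

lemma faceD: "v \<in> face I A \<Longrightarrow> v \<in> A"
  by (simp add: face_def)

lemma face_mono: "A \<subseteq> B \<Longrightarrow> face I A \<subseteq> face I B"
  by (auto simp: face_def)

lemma face_Un: "face (I \<union> J) A = face I (face J A)"
  by (auto simp: face_def)

lemma finite_face: "finite A \<Longrightarrow> finite (face I A)"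
  by (rule finite_subset[OF face_subset])

lemma finite_fibre:
  assumes "finite A" shows "finite {t. u(i := t) \<in> A}"
proof (rule finite_imageD)
  show "finite ((\<lambda>t. u(i := t)) ` {t. u(i := t) \<in> A})"
    by (rule finite_subset[OF _ assms]) auto
  show "inj_on (\<lambda>t. u(i := t)) {t. u(i := t) \<in> A}"
    by (rule inj_onI) (metis fun_upd_same)
qed

lemma card_eq_sum_fibres:
  assumes A: "finite A" "lower_at i A"
  shows "card {v\<in>A. P v} = (\<Sum>u\<in>face {i} A. card {t. u(i := t) \<in> A \<and> P (u(i := t))})"
proof -
  let ?S = "SIGMA u:face {i} A. {t. u(i := t) \<in> A \<and> P (u(i := t))}"
  have fin: "finite {t. u(i := t) \<in> A \<and> P (u(i := t))}" for u
    by (rule finite_subset[OF _ finite_fibre[OF A(1), of u i]]) auto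
  have "bij_betw (\<lambda>(u, t). u(i := t)) ?S {v\<in>A. P v}"
  proof (rule bij_betw_byWitness[where f' = "\<lambda>v. (v(i := 1), v i)"])
    show "(\<lambda>v. (v(i := 1), v i)) ` {v\<in>A. P v} \<subseteq> ?S"
      using lower_atD[OF A(2), of _ 1] lower_at_ge_1[OF A(2)] by (auto simp: face_def)
  qed (auto simp: face_def fun_upd_idem)
  then have "card {v\<in>A. P v} = card ?S"
    by (rule bij_betw_same_card[symmetric])
  also have "\<dots> = (\<Sum>u\<in>face {i} A. card {t. u(i := t) \<in> A \<and> P (u(i := t))})"
    using finite_face[OF A(1)] fin by (subst card_SigmaI) auto
  finally show ?thesis .
qed

lemma fibre_eq_interval:
  assumes A: "finite A" "lower_at i A" and u: "u \<in> A"
  obtains m where "{t. u(i := t) \<in> A} = {1..m}"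
proof -
  let ?S = "{t. u(i := t) \<in> A}"
  have fin: "finite ?S" by (rule finite_fibre[OF A(1)])
  have "u i \<in> ?S" using u by simp
  then have "Max ?S \<in> ?S" by (intro Max_in[OF fin]) blast
  then have max: "u(i := Max ?S) \<in> A" by simp
  have "?S = {1..Max ?S}"
  proof (intro subset_antisym subsetI)
    fix t assume t: "t \<in> ?S"
    then show "t \<in> {1..Max ?S}"
      using lower_at_ge_1[OF A(2), of "u(i := t)"] fin by simp
  next
    fix t assume "t \<in> {1..Max ?S}"
    then show "t \<in> ?S" using lower_atD[OF A(2) max, of t] by simp
  qed
  then show thesis by (rule that)
qed

lemma card_multiples:
  assumes "1 \<le> (d::nat)" shows "card {t\<in>{1..m}. d dvd t} = m div d"
proof -
  have "bij_betw (\<lambda>j. d * j) {1..m div d} {t\<in>{1..m}. d dvd t}"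
    by (rule bij_betw_byWitness[where f' = "\<lambda>t. t div d"])
      (use assms in \<open>auto simp: less_eq_div_iff_mult_less_eq mult.commute div_le_mono Suc_le_eq
        dvd_div_eq_0_iff\<close>)
  then show ?thesis by (metis bij_betw_same_card card_atLeastAtMost diff_Suc_1)
qed

lemma card_fibre_dvd:
  assumes A: "finite A" "lower_at i A" and u: "u \<in> A" and d_pos: "1 \<le> d"
  shows "d * card {t. u(i := t) \<in> A \<and> d dvd t} \<le> card {t. u(i := t) \<in> A}"
    and "card {t. u(i := t) \<in> A} \<le> d * card {t. u(i := t) \<in> A \<and> d dvd t} + d"
proof -
  obtain m where m: "{t. u(i := t) \<in> A} = {1..m}" using fibre_eq_interval[OF A u] .
  have "{t. u(i := t) \<in> A \<and> d dvd t} = {t\<in>{1..m}. d dvd t}" unfolding m[symmetric] by simp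
  then have card_dvd: "card {t. u(i := t) \<in> A \<and> d dvd t} = m div d"
    using card_multiples[OF d_pos] by simp
  have "m = d * (m div d) + m mod d" "m mod d < d" using d_pos by simp_all
  then show "d * card {t. u(i := t) \<in> A \<and> d dvd t} \<le> card {t. u(i := t) \<in> A}"
    and "card {t. u(i := t) \<in> A} \<le> d * card {t. u(i := t) \<in> A \<and> d dvd t} + d"
    unfolding m card_dvd card_atLeastAtMost by linarith+
qed

lemma card_coord_dvd_upper:
  assumes A: "finite A" "lower_at i A" and d_pos: "1 \<le> d"
  shows "d * card {v\<in>A. d dvd v i} \<le> card A"
proof -
  have "d * card {v\<in>A. d dvd v i} = (\<Sum>u\<in>face {i} A. d * card {t. u(i := t) \<in> A \<and> d dvd t})"
    using card_eq_sum_fibres[OF A, of "\<lambda>v. d dvd v i"] by (simp add: sum_distrib_left)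
  also have "\<dots> \<le> (\<Sum>u\<in>face {i} A. card {t. u(i := t) \<in> A})"
    by (rule sum_mono) (rule card_fibre_dvd[OF A faceD d_pos])
  also have "\<dots> = card A"
    using card_eq_sum_fibres[OF A, of "\<lambda>_. True"] by simp
  finally show ?thesis .
qed

lemma card_coord_dvd_lower:
  assumes A: "finite A" "lower_at i A" and d_pos: "1 \<le> d"
  shows "card A \<le> d * (card {v\<in>A. d dvd v i} + card (face {i} A))"
proof -
  have "card A = (\<Sum>u\<in>face {i} A. card {t. u(i := t) \<in> A})"
    using card_eq_sum_fibres[OF A, of "\<lambda>_. True"] by simp
  also have "\<dots> \<le> (\<Sum>u\<in>face {i} A. d * card {t. u(i := t) \<in> A \<and> d dvd t} + d)"
    by (rule sum_mono) (rule card_fibre_dvd[OF A faceD d_pos])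
  also have "\<dots> = d * (card {v\<in>A. d dvd v i} + card (face {i} A))"
    using card_eq_sum_fibres[OF A, of "\<lambda>v. d dvd v i"]
    by (simp add: sum.distrib sum_distrib_left algebra_simps)
  finally show ?thesis .
qed

lemma card_coord_dvd_real:
  assumes A: "finite A" "lower_at i A" and d_pos: "1 \<le> d"
  shows "real (card {v\<in>A. d dvd v i}) \<le> real (card A) / real d"
    and "real (card A) / real d \<le> real (card {v\<in>A. d dvd v i}) + real (card (face {i} A))"
proof -
  have "real (d * card {v\<in>A. d dvd v i}) \<le> real (card A)"
    using card_coord_dvd_upper[OF A d_pos] by (rule of_nat_mono)
  then show "real (card {v\<in>A. d dvd v i}) \<le> real (card A) / real d"
    using d_pos by (simp add: field_simps)
  have "real (card A) \<le> real (d * (card {v\<in>A. d dvd v i} + card (face {i} A)))"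
    using card_coord_dvd_lower[OF A d_pos] by (rule of_nat_mono)
  then show "real (card A) / real d \<le> real (card {v\<in>A. d dvd v i}) + real (card (face {i} A))"
    using d_pos by (simp add: field_simps)
qed

lemma card_coords_dvd:
  assumes A: "finite A" and J: "finite J" and low: "\<And>i. i \<in> J \<Longrightarrow> lower_at i A"
    and d_pos: "\<And>i. i \<in> J \<Longrightarrow> 1 \<le> d i"
  shows "\<bar>real (card {v\<in>A. \<forall>k\<in>J. d k dvd v k}) - real (card A) / (\<Prod>k\<in>J. real (d k))\<bar>
           \<le> (\<Sum>k\<in>J. real (card (face {k} A)))"
  using J low d_pos
proof (induction J rule: finite_induct)
  case empty
  then show ?case by simp
next
  case (insert i J)
  let ?B = "{v\<in>A. \<forall>k\<in>J. d k dvd v k}"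
  let ?C = "{v\<in>A. \<forall>k\<in>insert i J. d k dvd v k}"
  define P where "P = (\<Prod>k\<in>J. real (d k))"
  have di: "1 \<le> d i" using insert.prems by simp
  have C: "?C = {v\<in>?B. d i dvd v i}" by auto
  have "card (face {i} ?B) \<le> card (face {i} A)"
    using A by (intro card_mono finite_face face_mono) auto
  moreover have "finite ?B" "lower_at i ?B"
    using A insert by (simp_all add: lower_at_dvd_filter)
  note card_coord_dvd_real[OF this di]
  ultimately have B_C: "\<bar>real (card ?C) - real (card ?B) / real (d i)\<bar> \<le> real (card (face {i} A))"
    unfolding C by linarith
  have "real (card ?B) / real (d i) - real (card A) / (real (d i) * P)
      = (real (card ?B) - real (card A) / P) / real (d i)"
    by (simp add: diff_divide_distrib mult.commute)
  then have "\<bar>real (card ?B) / real (d i) - real (card A) / (real (d i) * P)\<bar>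
      = \<bar>real (card ?B) - real (card A) / P\<bar> / real (d i)"
    by (simp only: abs_divide abs_of_nat)
  also have "\<dots> \<le> \<bar>real (card ?B) - real (card A) / P\<bar>"
    using di by (simp add: divide_le_eq mult_le_cancel_left1)
  also have "\<dots> \<le> (\<Sum>k\<in>J. real (card (face {k} A)))"
    unfolding P_def using insert by auto
  finally have "\<bar>real (card ?C) - real (card A) / (real (d i) * P)\<bar>
      \<le> real (card (face {i} A)) + (\<Sum>k\<in>J. real (card (face {k} A)))"
    using B_C by linarith
  then show ?case using insert.hyps by (simp add: P_def)
qed

lemma card_two_coords_dvd:
  assumes A: "finite A" "lower_at i A" "lower_at j A" and ij: "i \<noteq> j" and d_pos: "1 \<le> d"
  shows "d\<^sup>2 * card {v\<in>A. d dvd v i \<and> d dvd v j} \<le> card A"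
proof -
  let ?B = "{v\<in>A. d dvd v i}"
  have "lower_at j ?B" using lower_at_dvd_filter[OF A(3), of "{i}" "\<lambda>_. d"] ij by simp
  then have "d * card {v\<in>?B. d dvd v j} \<le> card ?B"
    using A(1) d_pos by (intro card_coord_dvd_upper) auto
  then have "d * (d * card {v\<in>?B. d dvd v j}) \<le> d * card ?B" by simp
  also have "\<dots> \<le> card A" by (rule card_coord_dvd_upper[OF A(1,2) d_pos])
  also have "{v\<in>?B. d dvd v j} = {v\<in>A. d dvd v i \<and> d dvd v j}" by auto
  finally show ?thesis by (simp add: power2_eq_square mult.assoc)
qed

lemma card_face_dvd_le_card_slice:
  assumes A: "finite A" "lower_at j A" and ij: "i \<noteq> j" and t: "1 \<le> t"
    and shift: "\<And>v s. v(i := 1, j := t * s) \<in> A \<Longrightarrow> 1 \<le> s \<Longrightarrow> v(i := t, j := s) \<in> A"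
  shows "card {v\<in>face {i} A. t dvd v j} \<le> card {v\<in>A. v i = t}"
proof (rule card_inj_on_le)
  let ?f = "\<lambda>v. v(i := t, j := v j div t)" and ?F = "{v\<in>face {i} A. t dvd v j}"
  show "?f ` ?F \<subseteq> {v\<in>A. v i = t}"
  proof clarify
    fix v assume v: "v \<in> face {i} A" "t dvd v j"
    then have "v(i := 1, j := t * (v j div t)) = v" by (auto simp: face_def)
    moreover have "1 \<le> v j div t"
      using v(2) lower_at_ge_1[OF A(2) faceD[OF v(1)]] t by (auto simp: Suc_le_eq intro!: Nat.gr0I)
    ultimately show "?f v \<in> A \<and> ?f v i = t"
      using shift[of v "v j div t"] v ij by (auto simp: face_def)
  qed
  show "inj_on ?f ?F"
  proof (rule inj_onI, rule ext)
    fix v w k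
    assume v: "v \<in> ?F" and w: "w \<in> ?F" and images_eq: "?f v = ?f w"
    have "v j div t = w j div t" using fun_cong[OF images_eq, of j] by simp
    then have "v j = w j" using v w dvd_div_eq_iff by blast
    then show "v k = w k"
      using v w fun_cong[OF images_eq, of k] by (cases "k = i \<or> k = j") (auto simp: face_def)
  qed
qed (use A in simp)

text \<open>Shifting a factor \<open>t\<close> from \<open>v\<^sub>j\<close> to \<open>v\<^sub>i\<close> moves the points of the facet \<open>v\<^sub>i = 1\<close> with
  \<open>t dvd v\<^sub>j\<close> injectively off the facet, and these are about a \<open>t\<close>-th part of the facet.\<close>

lemma harm_mult_card_face_le:
  assumes A: "finite A" "lower_at j A" and ij: "i \<noteq> j"
    and shift: "\<And>v t s. v(i := 1, j := t * s) \<in> A \<Longrightarrow> 1 \<le> t \<Longrightarrow> 1 \<le> s \<Longrightarrow> v(i := t, j := s) \<in> A"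
  shows "harm m * real (card (face {i} A)) \<le> real (card A) + real m * real (card (face {i, j} A))"
proof -
  let ?F = "face {i} A"
  have F: "finite ?F" "lower_at j ?F"
    using A ij by (auto intro: finite_face lower_at_face)
  have "(\<Sum>t=1..m. card {v\<in>?F. t dvd v j}) \<le> (\<Sum>t=1..m. card {v\<in>A. v i = t})"
    using shift by (intro sum_mono card_face_dvd_le_card_slice[OF A ij]) auto
  also have "\<dots> = card (\<Union>t\<in>{1..m}. {v\<in>A. v i = t})"
    using A by (intro card_UN_disjoint[symmetric]) auto
  also have "\<dots> \<le> card A" using A by (intro card_mono) auto
  finally have "real (\<Sum>t=1..m. card {v\<in>?F. t dvd v j}) \<le> real (card A)"
    by (rule of_nat_mono)
  then have upper: "(\<Sum>t=1..m. real (card {v\<in>?F. t dvd v j})) \<le> real (card A)" by simp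
  have "harm m * real (card ?F) = (\<Sum>t=1..m. real (card ?F) / real t)"
    by (simp add: harm_def divide_inverse sum_distrib_left mult.commute)
  also have "\<dots> \<le> (\<Sum>t=1..m. real (card {v\<in>?F. t dvd v j}) + real (card (face {j} ?F)))"
    by (intro sum_mono card_coord_dvd_real(2)[OF F]) simp
  also have "\<dots> = (\<Sum>t=1..m. real (card {v\<in>?F. t dvd v j})) + real m * real (card (face {i, j} A))"
    using face_Un[of "{j}" "{i}" A] by (simp add: sum.distrib insert_commute)
  finally show ?thesis using upper by linarith
qed

section \<open>Elementary symmetric polynomials\<close>

definition esym_on :: "'i set \<Rightarrow> nat \<Rightarrow> ('i \<Rightarrow> 'a::comm_semiring_1) \<Rightarrow> 'a" where
  "esym_on I l x = (\<Sum>S | S \<subseteq> I \<and> card S = l. \<Prod>i\<in>S. x i)"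

lemma esym_eq_esym_on: "esym l r x = esym_on {1..r} l x"
  by (simp add: esym_def esym_on_def)

lemma esym_on_0: "finite I \<Longrightarrow> esym_on I 0 x = 1"
proof -
  assume "finite I"
  then have "{S. S \<subseteq> I \<and> card S = 0} = {{}}" by (auto dest: finite_subset)
  then show ?thesis by (simp add: esym_on_def)
qed

lemma esym_on_card: "finite I \<Longrightarrow> esym_on I (card I) x = (\<Prod>i\<in>I. x i)"
proof -
  assume "finite I"
  then have "{S. S \<subseteq> I \<and> card S = card I} = {I}" by (auto dest: card_subset_eq)
  then show ?thesis by (simp add: esym_on_def)
qed

lemma subsets_containing_card_Suc:
  assumes "finite J" "i \<notin> J"
  shows "{S. S \<subseteq> insert i J \<and> card S = Suc l \<and> i \<in> S} = insert i ` {S. S \<subseteq> J \<and> card S = l}"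
    (is "?L = ?R")
proof (intro subset_antisym subsetI)
  fix S assume S: "S \<in> ?L"
  then have "S = insert i (S - {i})" "S - {i} \<in> {S. S \<subseteq> J \<and> card S = l}"
    using assms by (auto dest: finite_subset)
  then show "S \<in> ?R" by blast
next
  fix S assume "S \<in> ?R"
  then obtain T where "S = insert i T" "T \<subseteq> J" "card T = l" by auto
  moreover from this have "finite T" "i \<notin> T" using assms by (auto dest: finite_subset)
  ultimately show "S \<in> ?L" by auto
qed

lemma card_subsets_containing:
  assumes "finite I" "i \<in> I"
  shows "card {S. S \<subseteq> I \<and> card S = Suc l \<and> i \<in> S} = (card I - 1) choose l"
proof -
  have "{S. S \<subseteq> I \<and> card S = Suc l \<and> i \<in> S} = insert i ` {S. S \<subseteq> I - {i} \<and> card S = l}"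
    using subsets_containing_card_Suc[of "I - {i}" i l] assms by (simp add: insert_absorb)
  moreover have "inj_on (insert i) {S. S \<subseteq> I - {i} \<and> card S = l}" by (auto intro!: inj_onI)
  ultimately show ?thesis using assms n_subsets[of "I - {i}" l] by (simp add: card_image)
qed

lemma esym_on_insert:
  assumes J: "finite J" "i \<notin> J"
  shows "esym_on (insert i J) (Suc l) x = esym_on J (Suc l) x + x i * esym_on J l x"
proof -
  let ?Y = "{S. S \<subseteq> J \<and> card S = l}"
  have split: "{S. S \<subseteq> insert i J \<and> card S = Suc l} = {S. S \<subseteq> J \<and> card S = Suc l} \<union> insert i ` ?Y"
    using J by (auto simp: subset_insert simp flip: subsets_containing_card_Suc)
  have inj: "inj_on (insert i) ?Y" using J by (auto intro!: inj_onI)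
  have "(\<Sum>S\<in>insert i ` ?Y. \<Prod>k\<in>S. x k) = (\<Sum>S\<in>?Y. x i * (\<Prod>k\<in>S. x k))"
    unfolding sum.reindex[OF inj] o_def
    using J by (intro sum.cong refl prod.insert) (auto dest: finite_subset)
  then show ?thesis
    unfolding esym_on_def split using J by (subst sum.union_disjoint) (auto simp: sum_distrib_left)
qed

lemma esym_on_remove:
  assumes "finite I" "i \<in> I"
  shows "esym_on I (Suc l) x = esym_on (I - {i}) (Suc l) x + x i * esym_on (I - {i}) l x"
  using esym_on_insert[of "I - {i}" i l x] assms by (simp add: insert_absorb)

lemma esym_on_cong: "(\<And>i. i \<in> I \<Longrightarrow> x i = y i) \<Longrightarrow> esym_on I l x = esym_on I l y"
  unfolding esym_on_def by (intro sum.cong prod.cong) auto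

lemma esym_on_fun_upd: "i \<notin> I \<Longrightarrow> esym_on I l (x(i := t)) = esym_on I l x"
  by (intro esym_on_cong) auto

lemma esym_on_scale: "esym_on I l (\<lambda>i. c * x i) = c ^ l * esym_on I l x"
  unfolding esym_on_def sum_distrib_left by (intro sum.cong) (auto simp: prod.distrib)

lemma esym_on_const:
  assumes "finite I" shows "esym_on I l (\<lambda>_. c) = of_nat (card I choose l) * c ^ l"
proof -
  have "esym_on I l (\<lambda>_. c) = (\<Sum>S | S \<subseteq> I \<and> card S = l. c ^ l)"
    unfolding esym_on_def by (intro sum.cong) auto
  then show ?thesis using n_subsets[OF assms] by simp
qed

lemma esym_on_of_nat: "esym_on I l (\<lambda>i. of_nat (x i)) = of_nat (esym_on I l x)"
  by (simp add: esym_on_def)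

lemma esym_on_mono:
  fixes x y :: "'i \<Rightarrow> 'a::linordered_semidom"
  assumes "\<And>i. i \<in> I \<Longrightarrow> 0 \<le> x i" "\<And>i. i \<in> I \<Longrightarrow> x i \<le> y i"
  shows "esym_on I l x \<le> esym_on I l y"
  unfolding esym_on_def by (intro sum_mono prod_mono conjI) (auto intro: assms)

lemma esym_on_subset_mono:
  fixes x :: "'i \<Rightarrow> 'a::linordered_semidom"
  assumes "finite I" "J \<subseteq> I" "\<And>i. i \<in> I \<Longrightarrow> 0 \<le> x i"
  shows "esym_on J l x \<le> esym_on I l x"
  unfolding esym_on_def using assms by (intro sum_mono2 prod_nonneg) auto

lemma esym_on_pos:
  fixes x :: "'i \<Rightarrow> 'a::linordered_semidom"
  assumes "finite I" "l \<le> card I" "\<And>i. i \<in> I \<Longrightarrow> 0 < x i"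
  shows "0 < esym_on I l x"
proof -
  obtain S where S: "S \<subseteq> I" "card S = l" "finite S"
    using assms obtain_subset_with_card_n by metis
  have "0 < (\<Prod>i\<in>S. x i)" using S assms by (intro prod_pos) auto
  also have "\<dots> \<le> esym_on I l x"
    using esym_on_subset_mono[OF assms(1) S(1), of x l] assms(3) esym_on_card[OF S(3), of x] S(2)
    by (simp add: less_imp_le)
  finally show ?thesis .
qed

lemma esym_on_factor_shift_le:
  fixes x :: "'i \<Rightarrow> nat"
  assumes I: "finite I" and ij: "i \<in> I" "j \<in> I" "i \<noteq> j" and ts: "1 \<le> t" "1 \<le> s"
  shows "esym_on I l (x(i := t, j := s)) \<le> esym_on I l (x(i := 1, j := t * s))"
proof (cases l)
  case 0
  then show ?thesis using I by (simp add: esym_on_0)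
next
  case (Suc m)
  let ?J = "I - {i}" let ?K = "?J - {j}"
  have K: "finite ?K" using I by simp
  obtain a b c where quad: "\<And>p q. esym_on I l (x(i := p, j := q)) = a + b * (p + q) + c * (p * q)"
  proof (cases m)
    case 0
    have "esym_on I l (x(i := p, j := q)) = esym_on ?K 1 x + 1 * (p + q) + 0 * (p * q)" for p q
      using esym_on_remove[OF I ij(1), of 0 "x(i := p, j := q)"]
        esym_on_remove[of ?J j 0 "x(i := p, j := q)"] I ij Suc 0
      by (simp add: esym_on_0 esym_on_fun_upd)
    then show thesis by (rule that)
  next
    case (Suc m')
    have "esym_on I l (x(i := p, j := q))
        = esym_on ?K l x + esym_on ?K m x * (p + q) + esym_on ?K m' x * (p * q)" for p q
      using esym_on_remove[OF I ij(1), of m "x(i := p, j := q)"]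
        esym_on_remove[of ?J j m "x(i := p, j := q)"]
        esym_on_remove[of ?J j m' "x(i := p, j := q)"] I ij
        \<open>l = Suc m\<close> Suc
      by (simp add: esym_on_fun_upd algebra_simps)
    then show thesis by (rule that)
  qed
  obtain t' s' where "t = Suc t'" "s = Suc s'" using ts by (metis Suc_le_D One_nat_def)
  then have "t + s \<le> 1 + t * s" by simp
  then show ?thesis unfolding quad by (simp add: mult_le_mono2 del: One_nat_def)
qed

lemma prod_monomials_eq:
  fixes x :: "'i \<Rightarrow> 'a::comm_semiring_1"
  assumes "finite I"
  shows "(\<Prod>S | S \<subseteq> I \<and> card S = Suc l. \<Prod>i\<in>S. x i) = (\<Prod>i\<in>I. x i) ^ ((card I - 1) choose l)"
proof -
  let ?\<S> = "{S. S \<subseteq> I \<and> card S = Suc l}"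
  have "(\<Prod>S\<in>?\<S>. \<Prod>i\<in>S. x i) = (\<Prod>S\<in>?\<S>. \<Prod>i | i \<in> I \<and> i \<in> S. x i)"
    by (intro prod.cong) auto
  also have "\<dots> = (\<Prod>i\<in>I. \<Prod>S | S \<in> ?\<S> \<and> i \<in> S. x i)"
    using assms by (intro prod.swap_restrict) auto
  also have "\<dots> = (\<Prod>i\<in>I. x i ^ ((card I - 1) choose l))"
    using card_subsets_containing[OF assms] by (intro prod.cong) (simp_all add: conj_assoc)
  finally show ?thesis by (simp add: prod_power_distrib)
qed

text \<open>Maclaurin's inequality for the degrees \<open>l\<close> and \<open>card I\<close> is AM-GM for the monomials of
  degree \<open>l\<close>.\<close>

lemma prod_le_of_esym_on_le:
  fixes x :: "'i \<Rightarrow> real"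
  assumes I: "finite I" and deg: "1 \<le> l" "l \<le> card I" and x: "\<And>i. i \<in> I \<Longrightarrow> 0 \<le> x i"
    and s: "esym_on I l x \<le> s"
  shows "(\<Prod>i\<in>I. x i) \<le> (s / real (card I choose l)) powr (real (card I) / real l)"
proof -
  let ?\<S> = "{S. S \<subseteq> I \<and> card S = l}"
  define P where "P = (\<Prod>i\<in>I. x i)"
  define b where "b = (card I - 1) choose (l - 1)"
  define N where "N = card I choose l"
  have N: "card ?\<S> = N" "0 < N" using n_subsets[OF I] deg by (simp_all add: N_def)
  have P: "0 \<le> P" unfolding P_def using x by (rule prod_nonneg)
  have "(\<Prod>S\<in>?\<S>. \<Prod>i\<in>S. x i) = P ^ b"
    using prod_monomials_eq[OF I, where l = "l - 1" and x = x] deg by (simp add: P_def b_def)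
  moreover have "(\<Prod>S\<in>?\<S>. \<Prod>i\<in>S. x i) powr (1 / N) \<le> (\<Sum>S\<in>?\<S>. (\<Prod>i\<in>S. x i) / N)"
    unfolding N(1)[symmetric]
  proof (rule arith_geom_mean)
    show "?\<S> \<noteq> {}" using N by (metis card.empty less_irrefl)
  qed (use I x in \<open>auto intro!: prod_nonneg\<close>)
  ultimately have "(P ^ b) powr (1 / N) \<le> esym_on I l x / N"
    by (simp add: esym_on_def sum_divide_distrib)
  moreover have "P ^ b = P powr b"
    using P deg by (simp add: powr_realpow' b_def)
  ultimately have "P powr (real b / N) \<le> s / N"
    using divide_right_mono[OF s, of "real N"] by (simp add: powr_powr)
  moreover have "real l * real N = real (card I) * real b"
    using times_binomial_minus1_eq[of l "card I"] deg by (simp add: N_def b_def flip: of_nat_mult)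
  then have exponent: "real b / N = real l / card I"
    using N deg by (simp add: field_simps)
  ultimately have
    "(P powr (real l / card I)) powr (real (card I) / l) \<le> (s / N) powr (real (card I) / l)"
    by (intro powr_mono2) auto
  moreover have "(P powr (real l / card I)) powr (real (card I) / l) = P"
    using P deg by (simp add: powr_powr)
  ultimately show ?thesis by (simp add: P_def N_def)
qed

section \<open>The sets \<open>H\<^sub>l\<^sub>,\<^sub>r(n)\<close>\<close>

lemma hyp_set_iff:
  "v \<in> hyp_set l r n \<longleftrightarrow> v \<in> {1..r} \<rightarrow>\<^sub>E {1..} \<and> esym_on {1..r} l v \<le> n"
  by (simp add: hyp_set_def esym_eq_esym_on)

lemma hyp_set_ge_1: "v \<in> hyp_set l r n \<Longrightarrow> k \<in> {1..r} \<Longrightarrow> 1 \<le> v k"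
  by (auto simp: hyp_set_iff PiE_iff)

lemma hyp_set_prod_pos: "v \<in> hyp_set l r n \<Longrightarrow> 0 < (\<Prod>k=1..r. v k)"
  using hyp_set_ge_1[of v l r n] by (intro prod_pos) (auto simp: Suc_le_eq)

lemma hyp_set_le:
  assumes deg: "1 \<le> l" "l \<le> r" and v: "v \<in> hyp_set l r n" and i: "i \<in> {1..r}"
  shows "v i \<le> n"
proof -
  obtain S where S: "i \<in> S" "S \<subseteq> {1..r}" "card S = l" "finite S"
    using exists_subset_between[of "{i}" l "{1..r}"] deg i by (auto intro: finite_subset)
  have "0 < (\<Prod>k\<in>S. v k)" using S hyp_set_ge_1[OF v] by (intro prod_pos) (auto simp: Suc_le_eq)
  then have "v i \<le> (\<Prod>k\<in>S. v k)" using S by (intro dvd_imp_le dvd_prodI)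
  also have "\<dots> \<le> esym_on {1..r} l v"
    using esym_on_subset_mono[of "{1..r}" S v l] esym_on_card[OF S(4), of v] S by simp
  finally show ?thesis using v by (simp add: hyp_set_iff)
qed

lemma hyp_set_level_pos: "1 \<le> l \<Longrightarrow> l \<le> r \<Longrightarrow> v \<in> hyp_set l r n \<Longrightarrow> 0 < n"
  using hyp_set_le[of l r v n 1] hyp_set_ge_1[of v l r n 1] by simp

lemma finite_hyp_set:
  assumes deg: "1 \<le> l" "l \<le> r" shows "finite (hyp_set l r n)"
proof (rule finite_subset)
  show "hyp_set l r n \<subseteq> {1..r} \<rightarrow>\<^sub>E {1..n}"
  proof
    fix v assume v: "v \<in> hyp_set l r n"
    then have "v \<in> extensional {1..r}" by (simp add: hyp_set_iff PiE_iff)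
    then show "v \<in> {1..r} \<rightarrow>\<^sub>E {1..n}"
      using hyp_set_le[OF deg v] hyp_set_ge_1[OF v] by (simp add: PiE_iff)
  qed
qed (auto intro: finite_PiE)

lemma hyp_set_nonempty: "r choose l \<le> n \<Longrightarrow> hyp_set l r n \<noteq> {}"
proof -
  assume "r choose l \<le> n"
  then have "esym_on {1..r} l (\<lambda>_. 1::nat) \<le> n" using esym_on_const[of "{1..r}" l "1::nat"] by simp
  also have "esym_on {1..r} l (\<lambda>_. 1::nat) = esym_on {1..r} l (\<lambda>k\<in>{1..r}. 1)"
    by (intro esym_on_cong) auto
  finally have "(\<lambda>k\<in>{1..r}. 1) \<in> hyp_set l r n" by (auto simp: hyp_set_iff)
  then show ?thesis by blast
qed

lemma lower_at_filter_le:
  fixes f :: "('i \<Rightarrow> nat) \<Rightarrow> 'b::order"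
  assumes "lower_at i A" "\<And>v t. v \<in> A \<Longrightarrow> 1 \<le> t \<Longrightarrow> t \<le> v i \<Longrightarrow> f (v(i := t)) \<le> f v"
  shows "lower_at i {v\<in>A. f v \<le> x}"
  using assms order_trans unfolding lower_at_def by fast

lemma lower_at_hyp_set:
  assumes i: "i \<in> {1..r}" shows "lower_at i (hyp_set l r n)"
proof -
  have "lower_at i ({1..r} \<rightarrow>\<^sub>E {1..})"
    using i by (auto simp: lower_at_def PiE_iff extensional_def)
  then have "lower_at i {v\<in>{1..r} \<rightarrow>\<^sub>E {1..}. esym_on {1..r} l v \<le> n}"
    by (rule lower_at_filter_le) (auto intro!: esym_on_mono)
  then show ?thesis by (simp add: hyp_set_def esym_eq_esym_on)
qed

definition scaled_prod :: "nat \<Rightarrow> nat \<Rightarrow> nat \<Rightarrow> (nat \<Rightarrow> nat) \<Rightarrow> real" where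
  "scaled_prod l r n v = real (\<Prod>k=1..r. v k) / real n powr (real r / real l)"

lemma scaled_prod_le_iff:
  "0 < n \<Longrightarrow> scaled_prod l r n v \<le> x \<longleftrightarrow> real (\<Prod>k=1..r. v k) \<le> x * real n powr (real r / real l)"
  by (simp add: scaled_prod_def divide_le_eq del: of_nat_prod)

lemma scaled_prod_pos:
  assumes "1 \<le> l" "l \<le> r" "v \<in> hyp_set l r n" shows "0 < scaled_prod l r n v"
  using hyp_set_level_pos[OF assms] hyp_set_prod_pos[OF assms(3)]
  by (simp add: scaled_prod_def del: of_nat_prod)

lemma one_le_binomial_real: "l \<le> r \<Longrightarrow> 1 \<le> real (r choose l)"
  by (metis One_nat_def Suc_leI of_nat_1 of_nat_le_iff zero_less_binomial)

lemma scaled_prod_le_1: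
  assumes deg: "1 \<le> l" "l \<le> r" and v: "v \<in> hyp_set l r n"
  shows "scaled_prod l r n v \<le> 1"
proof -
  have "esym_on {1..r} l (\<lambda>k. real (v k)) \<le> real n"
    using v by (simp add: hyp_set_iff esym_on_of_nat)
  then have "real (\<Prod>k=1..r. v k) \<le> (real n / real (r choose l)) powr (real r / real l)"
    using prod_le_of_esym_on_le[of "{1..r}" l "\<lambda>k. real (v k)" "real n"] deg by simp
  also have "\<dots> \<le> real n powr (real r / real l)"
  proof (rule powr_mono2)
    show "real n / real (r choose l) \<le> real n"
      using one_le_binomial_real[OF deg(2)] by (simp add: divide_le_eq mult_le_cancel_left1)
  qed auto
  finally show ?thesis
    using scaled_prod_le_iff[OF hyp_set_level_pos[OF deg v], of l r v 1] by (simp only: mult_1)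
qed

lemma lower_at_scaled_prod_le:
  assumes "i \<in> {1..r}"
  shows "lower_at i {v\<in>hyp_set l r n. scaled_prod l r n v \<le> x}"
proof (rule lower_at_filter_le[OF lower_at_hyp_set[OF assms]])
  fix v :: "nat \<Rightarrow> nat" and t assume "t \<le> v i"
  then have "(\<Prod>k=1..r. (v(i := t)) k) \<le> (\<Prod>k=1..r. v k)" by (intro prod_mono) auto
  then show "scaled_prod l r n (v(i := t)) \<le> scaled_prod l r n v"
    unfolding scaled_prod_def by (intro divide_right_mono of_nat_mono) auto
qed

section \<open>Faces of \<open>H\<^sub>l\<^sub>,\<^sub>r(n)\<close> are negligible\<close>

lemma hyp_set_factor_shift:
  assumes ij: "i \<in> {1..r}" "j \<in> {1..r}" "i \<noteq> j" and ts: "1 \<le> t" "1 \<le> s"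
    and v: "v(i := 1, j := t * s) \<in> hyp_set l r n"
  shows "v(i := t, j := s) \<in> hyp_set l r n"
  using v esym_on_factor_shift_le[of "{1..r}" i j t s l v] ij ts
  by (auto simp: hyp_set_iff PiE_iff extensional_def fun_upd_def split: if_splits)

lemma eventually_le_card_edge:
  assumes deg: "1 \<le> l" "l \<le> r" and i: "i \<in> {1..r}"
  shows "\<forall>\<^sub>F n in sequentially. m \<le> card (face ({1..r} - {i}) (hyp_set l r n))"
  using eventually_ge_at_top[of "(r choose l) * m ^ l"]
proof eventually_elim
  case (elim n)
  let ?f = "\<lambda>t. (\<lambda>k\<in>{1..r}. 1)(i := t)"
  have "?f ` {1..m} \<subseteq> face ({1..r} - {i}) (hyp_set l r n)"
  proof clarify
    fix t assume t: "t \<in> {1..m}"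
    then have "esym_on {1..r} l (?f t) \<le> esym_on {1..r} l (\<lambda>_. m)" by (intro esym_on_mono) auto
    also have "\<dots> \<le> n" using elim by (simp add: esym_on_const)
    finally show "?f t \<in> face ({1..r} - {i}) (hyp_set l r n)"
      using t i by (auto simp: face_def hyp_set_iff PiE_iff extensional_def)
  qed
  moreover have "inj_on ?f {1..m}" by (rule inj_onI) (metis fun_upd_same)
  moreover have "finite (face ({1..r} - {i}) (hyp_set l r n))"
    by (rule finite_face[OF finite_hyp_set[OF deg]])
  ultimately show ?case using card_inj_on_le[of ?f "{1..m}"] by simp
qed

lemma card_face_all_le_1: "card (face {1..r} (hyp_set l r n)) \<le> 1"
proof -
  have "face {1..r} (hyp_set l r n) \<subseteq> {\<lambda>k\<in>{1..r}. 1}"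
    by (auto simp: face_def hyp_set_iff PiE_iff extensional_def fun_eq_iff)
  then have "card (face {1..r} (hyp_set l r n)) \<le> card {\<lambda>k\<in>{1..r}. 1::nat}"
    by (intro card_mono) auto
  then show ?thesis by simp
qed

lemma harm_mult_card_face_insert_le:
  assumes deg: "1 \<le> l" "l \<le> r" and ij: "i \<in> {1..r}" "j \<in> {1..r}" "i \<noteq> j" "i \<notin> I" "j \<notin> I"
  shows "harm m * real (card (face (insert i I) (hyp_set l r n)))
           \<le> real (card (face I (hyp_set l r n)))
             + real m * real (card (face (insert j (insert i I)) (hyp_set l r n)))"
proof -
  let ?A = "face I (hyp_set l r n)"
  have "harm m * real (card (face {i} ?A)) \<le> real (card ?A) + real m * real (card (face {i, j} ?A))"
  proof (rule harm_mult_card_face_le)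
    show "finite ?A" by (rule finite_face[OF finite_hyp_set[OF deg]])
    show "lower_at j ?A" using ij by (intro lower_at_face lower_at_hyp_set)
    show "v(i := t, j := s) \<in> ?A" if "v(i := 1, j := t * s) \<in> ?A" "1 \<le> t" "1 \<le> s" for v t s
      using that hyp_set_factor_shift[of i r j t s v l n] ij by (auto simp: face_def)
  qed (use ij in simp)
  then show ?thesis by (simp add: insert_commute flip: face_Un)
qed

text \<open>Downward induction on the codimension, starting from the edges of \<open>H\<^sub>l\<^sub>,\<^sub>r(n)\<close>.\<close>

lemma eventually_mult_card_face_insert_le:
  assumes deg: "1 \<le> l" "l \<le> r" and I: "insert i I \<subseteq> {1..r}" "i \<notin> I"
  shows "\<forall>\<^sub>F n in sequentially.
    c * real (card (face (insert i I) (hyp_set l r n))) \<le> real (card (face I (hyp_set l r n)))"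
  using I
proof (induction "card ({1..r} - insert i I)" arbitrary: i I c)
  case 0
  then have I: "I = {1..r} - {i}" "i \<in> {1..r}" by auto
  then have "insert i I = {1..r}" by auto
  then have "card (face (insert i I) (hyp_set l r n)) \<le> 1" for n
    using card_face_all_le_1 by simp
  then have small: "c * real (card (face (insert i I) (hyp_set l r n))) \<le> \<bar>c\<bar>" for n
    by (smt (verit) mult_left_le mult_nonneg_nonpos2 of_nat_0_le_iff of_nat_1 of_nat_le_iff)
  have "\<forall>\<^sub>F n in sequentially. nat \<lceil>\<bar>c\<bar>\<rceil> \<le> card (face I (hyp_set l r n))"
    unfolding I(1) by (rule eventually_le_card_edge[OF deg I(2)])
  then show ?case
  proof eventually_elim
    case (elim n)
    then show ?case using small[of n] by linarith
  qed
next
  case (Suc d)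
  then obtain j where j: "j \<in> {1..r}" "j \<notin> insert i I" by (metis Diff_iff card_eq_SucD insertI1)
  obtain m where m: "c + 1 \<le> harm m"
    using harm_at_top by (auto simp: filterlim_at_top eventually_sequentially)
  have "{1..r} - insert j (insert i I) = ({1..r} - insert i I) - {j}" by auto
  then have "card ({1..r} - insert j (insert i I)) = d"
    using Suc.hyps(2) j by (simp only: card_Diff_singleton Diff_iff) simp
  then have "\<forall>\<^sub>F n in sequentially.
      real m * real (card (face (insert j (insert i I)) (hyp_set l r n)))
      \<le> real (card (face (insert i I) (hyp_set l r n)))"
    using Suc.hyps(1)[of j "insert i I"] j Suc.prems by simp
  then show ?case
  proof eventually_elim
    case (elim n)
    have "(c + 1) * real (card (face (insert i I) (hyp_set l r n)))
        \<le> harm m * real (card (face (insert i I) (hyp_set l r n)))"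
      using m by (rule mult_right_mono) simp
    then show ?case
      using elim harm_mult_card_face_insert_le[OF deg, of i j I m n] j Suc.prems
      by (simp add: distrib_right)
  qed
qed

section \<open>The uniform distribution on \<open>H\<^sub>l\<^sub>,\<^sub>r(n)\<close>\<close>

abbreviation hyp_pmf :: "nat \<Rightarrow> nat \<Rightarrow> nat \<Rightarrow> (nat \<Rightarrow> nat) pmf" where
  "hyp_pmf l r n \<equiv> pmf_of_set (hyp_set l r n)"

lemma prob_pmf_of_set:
  "finite A \<Longrightarrow> A \<noteq> {} \<Longrightarrow> \<P>(x in pmf_of_set A. P x) = real (card {x\<in>A. P x}) / real (card A)"
  by (simp add: measure_pmf_of_set Int_def)

lemma prob_hyp_pmf:
  "1 \<le> l \<Longrightarrow> l \<le> r \<Longrightarrow> r choose l \<le> n \<Longrightarrow>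
    \<P>(v in hyp_pmf l r n. P v) = real (card {v\<in>hyp_set l r n. P v}) / real (card (hyp_set l r n))"
  by (intro prob_pmf_of_set finite_hyp_set hyp_set_nonempty)

lemma card_hyp_set_pos: "1 \<le> l \<Longrightarrow> l \<le> r \<Longrightarrow> r choose l \<le> n \<Longrightarrow> 0 < card (hyp_set l r n)"
  using finite_hyp_set hyp_set_nonempty by (simp add: card_gt_0_iff)

lemma AE_hyp_pmf: "1 \<le> l \<Longrightarrow> l \<le> r \<Longrightarrow> r choose l \<le> n \<Longrightarrow> AE v in hyp_pmf l r n. v \<in> hyp_set l r n"
  using set_pmf_of_set[OF hyp_set_nonempty finite_hyp_set, of r l n]
  by (simp add: AE_measure_pmf_iff)

lemma prob_hyp_pmf_cong:
  assumes "1 \<le> l" "l \<le> r" "r choose l \<le> n" "\<And>v. v \<in> hyp_set l r n \<Longrightarrow> P v \<longleftrightarrow> Q v"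
  shows "\<P>(v in hyp_pmf l r n. P v) = \<P>(v in hyp_pmf l r n. Q v)"
  using AE_hyp_pmf[OF assms(1-3)] assms(4)
  by (intro measure_pmf.finite_measure_eq_AE) (auto elim!: eventually_mono)

lemma tendsto_prob_coord_eq_1:
  assumes deg: "1 \<le> l" "l \<le> r" and i: "i \<in> {1..r}"
  shows "(\<lambda>n. \<P>(v in hyp_pmf l r n. v i = 1)) \<longlonglongrightarrow> 0"
proof (rule tendstoI)
  fix e :: real assume e_pos: "0 < e"
  have "\<forall>\<^sub>F n in sequentially.
      2 / e * real (card (face {i} (hyp_set l r n))) \<le> real (card (face {} (hyp_set l r n)))"
    by (rule eventually_mult_card_face_insert_le[OF deg]) (use i in auto)
  then show "\<forall>\<^sub>F n in sequentially. dist (\<P>(v in hyp_pmf l r n. v i = 1)) 0 < e"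
    using eventually_ge_at_top[of "r choose l"]
  proof eventually_elim
    case (elim n)
    have card_pos: "0 < real (card (hyp_set l r n))" using card_hyp_set_pos[OF deg elim(2)] by simp
    then have "2 * real (card (face {i} (hyp_set l r n))) \<le> e * real (card (hyp_set l r n))"
      using elim(1) e_pos by (simp add: face_def field_simps)
    also have "\<dots> < e * (2 * real (card (hyp_set l r n)))" using card_pos e_pos by simp
    finally have "real (card (face {i} (hyp_set l r n))) / real (card (hyp_set l r n)) < e"
      using card_pos by (simp add: divide_less_eq)
    then show ?case unfolding prob_hyp_pmf[OF deg elim(2)] by (simp add: face_def)
  qed
qed

lemma tendsto_prob_dvd:
  assumes deg: "1 \<le> l" "l \<le> r" and d_pos: "\<And>k. k \<in> {1..r} \<Longrightarrow> 1 \<le> d k"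
    and lim: "(\<lambda>n. \<P>(v in hyp_pmf l r n. scaled_prod l r n v \<le> x)) \<longlonglongrightarrow> F"
  shows "(\<lambda>n. \<P>(v in hyp_pmf l r n. scaled_prod l r n v \<le> x \<and> (\<forall>k\<in>{1..r}. d k dvd v k)))
           \<longlonglongrightarrow> F / (\<Prod>k=1..r. real (d k))"
proof -
  let ?D = "\<Prod>k=1..r. real (d k)"
  let ?p = "\<lambda>n. \<P>(v in hyp_pmf l r n. scaled_prod l r n v \<le> x)"
  let ?q = "\<lambda>n. \<P>(v in hyp_pmf l r n. scaled_prod l r n v \<le> x \<and> (\<forall>k\<in>{1..r}. d k dvd v k))"
  have "(\<lambda>n. ?q n - ?p n / ?D) \<longlonglongrightarrow> 0"
  proof (rule Lim_null_comparison)
    show "(\<lambda>n. \<Sum>k=1..r. \<P>(v in hyp_pmf l r n. v k = 1)) \<longlonglongrightarrow> 0"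
      using tendsto_sum[of "{1..r}", OF tendsto_prob_coord_eq_1[OF deg]] by simp
    show "\<forall>\<^sub>F n in sequentially.
        norm (?q n - ?p n / ?D) \<le> (\<Sum>k=1..r. \<P>(v in hyp_pmf l r n. v k = 1))"
      using eventually_ge_at_top[of "r choose l"]
    proof eventually_elim
      case (elim n)
      let ?H = "hyp_set l r n" let ?h = "real (card ?H)"
      let ?A = "{v\<in>?H. scaled_prod l r n v \<le> x}"
      have H: "finite ?H" by (rule finite_hyp_set[OF deg])
      have "\<bar>real (card {v\<in>?A. \<forall>k\<in>{1..r}. d k dvd v k}) - real (card ?A) / ?D\<bar>
          \<le> (\<Sum>k=1..r. real (card (face {k} ?A)))"
        using H d_pos by (intro card_coords_dvd lower_at_scaled_prod_le) auto
      also have "\<dots> \<le> (\<Sum>k=1..r. real (card (face {k} ?H)))"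
        using H by (intro sum_mono of_nat_mono card_mono finite_face face_mono) auto
      finally have "\<bar>real (card {v\<in>?A. \<forall>k\<in>{1..r}. d k dvd v k}) / ?h - real (card ?A) / ?h / ?D\<bar>
          \<le> (\<Sum>k=1..r. real (card (face {k} ?H)) / ?h)"
        using card_hyp_set_pos[OF deg elim]
        by (simp add: field_simps flip: sum_divide_distrib)
      then show ?case
        unfolding prob_hyp_pmf[OF deg elim] by (simp add: face_def conj_assoc)
    qed
  qed
  moreover have "?D \<noteq> 0" using d_pos by fastforce
  then have "(\<lambda>n. ?p n / ?D) \<longlonglongrightarrow> F / ?D" by (intro tendsto_divide lim tendsto_const)
  ultimately show ?thesis using tendsto_add by fastforce
qed

lemma prob_two_coords_dvd_le:
  assumes deg: "1 \<le> l" "l \<le> r" "r choose l \<le> n" and ij: "i \<in> {1..r}" "j \<in> {1..r}" "i \<noteq> j"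
    and d_pos: "1 \<le> d"
  shows "\<P>(v in hyp_pmf l r n. d dvd v i \<and> d dvd v j) \<le> 1 / (real d)\<^sup>2"
proof -
  have "real (d\<^sup>2 * card {v\<in>hyp_set l r n. d dvd v i \<and> d dvd v j}) \<le> real (card (hyp_set l r n))"
    using ij d_pos by (intro of_nat_mono card_two_coords_dvd finite_hyp_set deg lower_at_hyp_set)
  then show ?thesis
    unfolding prob_hyp_pmf[OF deg] using d_pos card_hyp_set_pos[OF deg] by (simp add: field_simps)
qed

section \<open>The law of the rescaled product for \<open>l = r\<close>\<close>

lemma hyp_set_full_iff: "v \<in> hyp_set r r n \<longleftrightarrow> v \<in> {1..r} \<rightarrow>\<^sub>E {1..} \<and> (\<Prod>k=1..r. v k) \<le> n"
  using esym_on_card[of "{1..r}" v] by (simp add: hyp_set_iff)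

lemma hyp_set_full_prod_le_filter:
  assumes "m \<le> n" shows "{v\<in>hyp_set r r n. (\<Prod>k=1..r. v k) \<le> m} = hyp_set r r m"
  unfolding set_eq_iff mem_Collect_eq hyp_set_full_iff using le_trans[OF _ assms] by blast

lemma card_hyp_set_full:
  assumes i: "i \<in> {1..r}" and mn: "m \<le> n"
  shows "card (hyp_set r r m) = (\<Sum>u\<in>face {i} (hyp_set r r n). m div (\<Prod>k=1..r. u k))"
proof -
  let ?H = "hyp_set r r n"
  have H: "finite ?H" "lower_at i ?H"
    using i by (auto intro!: finite_hyp_set lower_at_hyp_set)
  have "card (hyp_set r r m)
      = (\<Sum>u\<in>face {i} ?H. card {t. u(i := t) \<in> ?H \<and> (\<Prod>k=1..r. (u(i := t)) k) \<le> m})"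
    unfolding hyp_set_full_prod_le_filter[OF mn, symmetric] by (rule card_eq_sum_fibres[OF H])
  also have "\<dots> = (\<Sum>u\<in>face {i} ?H. m div (\<Prod>k=1..r. u k))"
  proof (rule sum.cong)
    fix u assume u: "u \<in> face {i} ?H"
    then have uH: "u \<in> ?H" and ui: "u i = 1" by (auto simp: face_def)
    have prod_upd: "(\<Prod>k=1..r. (u(i := t)) k) = t * (\<Prod>k=1..r. u k)" for t
      using i ui by (simp add: prod.remove)
    have "u(i := t) \<in> {1..r} \<rightarrow>\<^sub>E {1..} \<longleftrightarrow> 1 \<le> t" for t
      using uH i by (auto simp: hyp_set_full_iff PiE_iff extensional_def)
    then have "{t. u(i := t) \<in> ?H \<and> (\<Prod>k=1..r. (u(i := t)) k) \<le> m} = {1..m div (\<Prod>k=1..r. u k)}"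
      unfolding hyp_set_full_iff prod_upd using mn hyp_set_prod_pos[OF uH]
      by (auto simp: less_eq_div_iff_mult_less_eq)
    then show "card {t. u(i := t) \<in> ?H \<and> (\<Prod>k=1..r. (u(i := t)) k) \<le> m} = m div (\<Prod>k=1..r. u k)"
      by simp
  qed simp
  finally show ?thesis .
qed

lemma abs_floor_div_minus_mult_div_le:
  assumes x: "0 \<le> x" "x \<le> 1"
  shows "\<bar>real (nat \<lfloor>x * real n\<rfloor> div q) - x * real (n div q)\<bar> \<le> 1"
proof (cases "q = 0")
  case False
  define a where "a = real n / real q"
  have "\<lfloor>x * a\<rfloor> = \<lfloor>x * real n\<rfloor> div int q"
    using floor_divide_real_eq_div[of "int q" "x * real n"] by (simp add: a_def)
  then have "int (nat \<lfloor>x * real n\<rfloor> div q) = \<lfloor>x * a\<rfloor>"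
    using x by (simp add: zdiv_int)
  then have floor_xa: "real (nat \<lfloor>x * real n\<rfloor> div q) = of_int \<lfloor>x * a\<rfloor>"
    by (metis of_int_of_nat_eq)
  have floor_a: "real (n div q) = of_int \<lfloor>a\<rfloor>" by (simp add: a_def floor_divide_of_nat_eq)
  have "x * of_int \<lfloor>a\<rfloor> \<le> x * a" "x * (a - 1) \<le> x * of_int \<lfloor>a\<rfloor>"
    using x by (intro mult_left_mono; linarith)+
  then show ?thesis unfolding floor_xa floor_a using x by (simp add: algebra_simps) linarith
qed simp

lemma abs_card_hyp_set_full_floor_le:
  assumes i: "i \<in> {1..r}" and x: "0 \<le> x" "x \<le> 1"
  shows "\<bar>real (card (hyp_set r r (nat \<lfloor>x * real n\<rfloor>))) - x * real (card (hyp_set r r n))\<bar>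
           \<le> real (card (face {i} (hyp_set r r n)))"
proof -
  let ?F = "face {i} (hyp_set r r n)" and ?m = "nat \<lfloor>x * real n\<rfloor>"
  have "x * real n \<le> 1 * real n" using x by (intro mult_right_mono) auto
  then have "?m \<le> n" by linarith
  then have "real (card (hyp_set r r ?m)) - x * real (card (hyp_set r r n))
      = (\<Sum>u\<in>?F. real (?m div (\<Prod>k=1..r. u k)) - x * real (n div (\<Prod>k=1..r. u k)))"
    using card_hyp_set_full[OF i, of _ n]
    by (simp add: sum_subtractf sum_distrib_left del: of_nat_prod)
  also have "\<bar>\<dots>\<bar> \<le> (\<Sum>u\<in>?F. 1)"
    by (rule order_trans[OF sum_abs sum_mono]) (rule abs_floor_div_minus_mult_div_le[OF x])
  finally show ?thesis by simp
qed

lemma hyp_set_full_scaled_prod_le_filter: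
  assumes r: "1 \<le> r" and n: "1 \<le> n" and y: "0 \<le> y" "y \<le> 1"
  shows "{v\<in>hyp_set r r n. scaled_prod r r n v \<le> y} = hyp_set r r (nat \<lfloor>y * real n\<rfloor>)"
proof -
  have "scaled_prod r r n v \<le> y \<longleftrightarrow> (\<Prod>k=1..r. v k) \<le> nat \<lfloor>y * real n\<rfloor>" for v
    using scaled_prod_le_iff[of n r r v y] n r y
    by (simp add: le_nat_iff le_floor_iff del: of_nat_prod)
  then have "{v\<in>hyp_set r r n. scaled_prod r r n v \<le> y}
      = {v\<in>hyp_set r r n. (\<Prod>k=1..r. v k) \<le> nat \<lfloor>y * real n\<rfloor>}"
    by (simp only:)
  moreover have "y * real n \<le> 1 * real n" using y by (intro mult_right_mono) auto
  then have "nat \<lfloor>y * real n\<rfloor> \<le> n" by linarith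
  ultimately show ?thesis by (simp only: hyp_set_full_prod_le_filter)
qed

lemma tendsto_prob_scaled_prod_le_full:
  assumes r: "1 \<le> r"
  shows "(\<lambda>n. \<P>(v in hyp_pmf r r n. scaled_prod r r n v \<le> x)) \<longlonglongrightarrow> max 0 (min 1 x)"
proof -
  define y where "y = max 0 (min 1 x)"
  have y: "0 \<le> y" "y \<le> 1" by (simp_all add: y_def)
  have "(\<lambda>n. \<P>(v in hyp_pmf r r n. scaled_prod r r n v \<le> x) - y) \<longlonglongrightarrow> 0"
  proof (rule Lim_null_comparison)
    show "(\<lambda>n. \<P>(v in hyp_pmf r r n. v 1 = 1)) \<longlonglongrightarrow> 0"
      using r by (intro tendsto_prob_coord_eq_1) auto
    show "\<forall>\<^sub>F n in sequentially.
        norm (\<P>(v in hyp_pmf r r n. scaled_prod r r n v \<le> x) - y) \<le> \<P>(v in hyp_pmf r r n. v 1 = 1)"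
      using eventually_ge_at_top[of 1]
    proof eventually_elim
      case (elim n)
      let ?H = "hyp_set r r n"
      have n: "r choose r \<le> n" using elim by simp
      note prob = prob_hyp_pmf[OF r order_refl n]
      have "{v\<in>?H. scaled_prod r r n v \<le> x} = {v\<in>?H. scaled_prod r r n v \<le> y}"
        using scaled_prod_pos[OF r order_refl, of _ n] scaled_prod_le_1[OF r order_refl, of _ n]
        by (fastforce simp: y_def)
      also have "\<dots> = hyp_set r r (nat \<lfloor>y * real n\<rfloor>)"
        by (rule hyp_set_full_scaled_prod_le_filter[OF r elim y])
      finally have count: "{v\<in>?H. scaled_prod r r n v \<le> x} = hyp_set r r (nat \<lfloor>y * real n\<rfloor>)" .
      have "0 < real (card ?H)" using card_hyp_set_pos[OF r order_refl n] by simp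
      moreover have "\<bar>real (card (hyp_set r r (nat \<lfloor>y * real n\<rfloor>))) - y * real (card ?H)\<bar>
          \<le> real (card (face {1} ?H))"
        using r y by (intro abs_card_hyp_set_full_floor_le) auto
      ultimately show ?case
        unfolding prob count by (simp add: face_def field_simps)
    qed
  qed
  then show ?thesis unfolding y_def by (rule LIM_zero_cancel)
qed

section \<open>Counting lattice points by volume\<close>

interpretation lborel_prod: product_sigma_finite "\<lambda>_. lborel :: real measure"
  by standard

abbreviation lborel_on :: "'i set \<Rightarrow> ('i \<Rightarrow> real) measure" where
  "lborel_on I \<equiv> Pi\<^sub>M I (\<lambda>_. lborel)"

definition grid_cell :: "'i set \<Rightarrow> real \<Rightarrow> ('i \<Rightarrow> nat) \<Rightarrow> ('i \<Rightarrow> real) set" where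
  "grid_cell I c v = (\<Pi>\<^sub>E i\<in>I. {(real (v i) - 1) / c <.. real (v i) / c})"

lemma sets_grid_cell: "finite I \<Longrightarrow> grid_cell I c v \<in> sets (lborel_on I)"
  unfolding grid_cell_def by (intro sets_PiM_I_finite) auto

lemma mem_grid_cell_iff:
  assumes "0 < c"
  shows "y \<in> grid_cell I c v \<longleftrightarrow> y \<in> extensional I \<and> (\<forall>i\<in>I. \<lceil>c * y i\<rceil> = int (v i))"
proof -
  have "(real (v i) - 1) / c < y i \<and> y i \<le> real (v i) / c \<longleftrightarrow> \<lceil>c * y i\<rceil> = int (v i)" for i
    using assms by (simp add: ceiling_eq_iff pos_divide_less_eq pos_le_divide_eq mult.commute)
  then show ?thesis by (auto simp: grid_cell_def PiE_iff)
qed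

lemma emeasure_grid_cell:
  assumes "finite I" "0 < c"
  shows "emeasure (lborel_on I) (grid_cell I c v) = ennreal (1 / c ^ card I)"
proof -
  have "emeasure lborel {(real (v i) - 1) / c <.. real (v i) / c} = ennreal (1 / c)" for i
    using assms by (simp add: divide_right_mono flip: diff_divide_distrib)
  then have "emeasure (lborel_on I) (grid_cell I c v) = (\<Prod>i\<in>I. ennreal (1 / c))"
    unfolding grid_cell_def using assms by (subst lborel_prod.emeasure_PiM) auto
  then show ?thesis using assms by (simp add: ennreal_power power_one_over)
qed

lemma disjoint_family_grid_cell:
  assumes "0 < c" "S \<subseteq> extensional I"
  shows "disjoint_family_on (grid_cell I c) S"
  unfolding disjoint_family_on_def
proof (intro ballI impI)
  fix v w assume "v \<in> S" "w \<in> S" "v \<noteq> w"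
  then obtain i where "i \<in> I" "v i \<noteq> w i" using assms(2) extensionalityI by (metis subsetD)
  then show "grid_cell I c v \<inter> grid_cell I c w = {}"
    using assms(1) by (auto simp: mem_grid_cell_iff)
qed

lemma measure_grid_cells:
  assumes I: "finite I" and c_pos: "0 < c" and S: "finite S" "S \<subseteq> extensional I"
  shows "measure (lborel_on I) (\<Union>v\<in>S. grid_cell I c v) = real (card S) / c ^ card I"
proof -
  have "emeasure (lborel_on I) (\<Union>v\<in>S. grid_cell I c v)
      = (\<Sum>v\<in>S. emeasure (lborel_on I) (grid_cell I c v))"
    using S sets_grid_cell[OF I] disjoint_family_grid_cell[OF c_pos S(2)]
    by (intro sum_emeasure[symmetric]) auto
  also have "\<dots> = ennreal (real (card S) / c ^ card I)"
    using c_pos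
    by (simp add: emeasure_grid_cell[OF I c_pos] ennreal_of_nat_eq_real_of_nat flip: ennreal_mult)
  finally show ?thesis using c_pos by (simp add: measure_def)
qed

locale lower_region =
  fixes I :: "'i set" and A :: "('i \<Rightarrow> real) set"
  assumes finite_index: "finite I"
    and sets_region: "A \<in> sets (lborel_on I)"
    and finite_volume: "emeasure (lborel_on I) A < \<infinity>"
    and region_pos: "A \<subseteq> I \<rightarrow>\<^sub>E {0<..}"
    and lower: "\<And>y z. z \<in> A \<Longrightarrow> y \<in> I \<rightarrow>\<^sub>E {0<..} \<Longrightarrow> (\<And>i. i \<in> I \<Longrightarrow> y i \<le> z i) \<Longrightarrow> y \<in> A"
    and AE_strictly_dominated: "AE y in lborel_on I. y \<in> A \<longrightarrow> (\<exists>z\<in>A. \<forall>i\<in>I. y i < z i)"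
begin

definition scaled_points :: "real \<Rightarrow> ('i \<Rightarrow> nat) set" where
  "scaled_points c = {v \<in> I \<rightarrow>\<^sub>E {1..}. (\<lambda>i\<in>I. real (v i) / c) \<in> A}"

lemma scaled_points_extensional: "scaled_points c \<subseteq> extensional I"
  by (auto simp: scaled_points_def PiE_iff)

lemma grid_cell_subset:
  assumes "0 < c" "v \<in> scaled_points c" shows "grid_cell I c v \<subseteq> A"
proof
  fix y assume y: "y \<in> grid_cell I c v"
  have "y i \<in> {(real (v i) - 1) / c <.. real (v i) / c}" if "i \<in> I" for i
    using y that unfolding grid_cell_def by (rule PiE_mem)
  moreover have "0 \<le> (real (v i) - 1) / c" if "i \<in> I" for i
    using assms that by (auto simp: scaled_points_def PiE_iff)
  ultimately have "0 < y i" "y i \<le> real (v i) / c" if "i \<in> I" for i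
    using that by (meson greaterThanAtMost_iff le_less_trans)+
  then show "y \<in> A"
    using assms(2) y lower[of "\<lambda>i\<in>I. real (v i) / c" y]
    by (auto simp: scaled_points_def grid_cell_def PiE_iff)
qed

lemma finite_scaled_points:
  assumes c_pos: "0 < c" shows "finite (scaled_points c)"
proof -
  have "card F \<le> nat \<lfloor>c ^ card I * measure (lborel_on I) A\<rfloor>"
    if F: "F \<subseteq> scaled_points c" "finite F" for F
  proof -
    have "measure (lborel_on I) (\<Union>v\<in>F. grid_cell I c v) \<le> measure (lborel_on I) A"
      using F grid_cell_subset[OF c_pos] sets_region finite_volume sets_grid_cell[OF finite_index]
      by (intro measure_mono_fmeasurable) (auto simp: fmeasurable_def)
    then have "real (card F) \<le> c ^ card I * measure (lborel_on I) A"
      using F c_pos scaled_points_extensional[of c]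
      by (simp add: measure_grid_cells[OF finite_index c_pos] divide_le_eq mult.commute)
    then show ?thesis by (rule le_nat_floor)
  qed
  then show ?thesis using finite_if_finite_subsets_card_bdd[of "scaled_points c"] by blast
qed

lemma eventually_mem_grid_cells:
  assumes scale: "filterlim c at_top F" and y: "y \<in> A" and z: "z \<in> A" "\<And>i. i \<in> I \<Longrightarrow> y i < z i"
  shows "\<forall>\<^sub>F n in F. y \<in> (\<Union>v\<in>scaled_points (c n). grid_cell I (c n) v)"
proof -
  have y_pos: "0 < y i" if "i \<in> I" for i using y region_pos that by (auto simp: PiE_iff)
  have "\<forall>\<^sub>F n in F. \<forall>i\<in>I. 1 / (z i - y i) \<le> c n"
    using scale finite_index unfolding filterlim_at_top
    by (intro eventually_ball_finite ballI) blast+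
  moreover have "\<forall>\<^sub>F n in F. 0 < c n" using scale by (simp add: filterlim_at_top_dense)
  ultimately show ?thesis
  proof eventually_elim
    case (elim n)
    define v where "v = (\<lambda>i\<in>I. nat \<lceil>c n * y i\<rceil>)"
    have v: "int (v i) = \<lceil>c n * y i\<rceil>" "1 \<le> v i" "real (v i) / c n \<le> z i" if i: "i \<in> I" for i
    proof -
      have pos: "0 < c n * y i" using elim(2) y_pos[OF i] by simp
      then show int_v: "int (v i) = \<lceil>c n * y i\<rceil>" and "1 \<le> v i"
        using i by (simp_all add: v_def Suc_le_eq)
      have "real (v i) < c n * y i + 1" using int_v by linarith
      also have "\<dots> \<le> c n * z i"
        using elim(1) z(2)[OF i] i by (auto simp: pos_divide_le_eq algebra_simps)
      finally show "real (v i) / c n \<le> z i" using elim(2) by (simp add: field_simps)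
    qed
    have "(\<lambda>i\<in>I. real (v i) / c n) \<in> A"
      by (rule lower[OF z(1)]) (use v elim(2) in \<open>force simp: PiE_iff\<close>)+
    then have "v \<in> scaled_points (c n)"
      using v by (auto simp: scaled_points_def v_def PiE_iff)
    moreover have "y \<in> grid_cell I (c n) v"
      using v y region_pos elim(2) by (auto simp: mem_grid_cell_iff PiE_iff)
    ultimately show ?case by blast
  qed
qed

lemma tendsto_card_scaled_points:
  assumes scale: "filterlim c at_top sequentially" "\<And>n. 0 < c n"
  shows "(\<lambda>n. real (card (scaled_points (c n))) / c n ^ card I) \<longlonglongrightarrow> measure (lborel_on I) A"
proof -
  let ?M = "lborel_on I"
  define B where "B n = (\<Union>v\<in>scaled_points (c n). grid_cell I (c n) v)" for n
  have B: "B n \<in> sets ?M" for n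
    unfolding B_def using finite_scaled_points[OF scale(2)] sets_grid_cell[OF finite_index]
    by (intro sets.finite_UN) auto
  have B_A: "B n \<subseteq> A" for n unfolding B_def using grid_cell_subset[OF scale(2)] by blast
  have "(\<lambda>n. \<integral>y. indicator (B n) y \<partial>?M :: real) \<longlonglongrightarrow> (\<integral>y. indicator A y \<partial>?M)"
  proof (rule integral_dominated_convergence[where w = "indicator A"])
    show "integrable ?M (indicator A :: _ \<Rightarrow> real)"
      using finite_volume sets_region by (intro integrable_real_indicator) auto
    show "AE y in ?M. norm (indicator (B n) y :: real) \<le> indicator A y" for n
      using B_A by (auto simp: indicator_def)
    show "AE y in ?M. (\<lambda>n. indicator (B n) y :: real) \<longlonglongrightarrow> indicator A y"
      using AE_strictly_dominated
    proof eventually_elim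
      case (elim y)
      have "\<forall>\<^sub>F n in sequentially. y \<in> B n" if "y \<in> A"
        using elim that eventually_mem_grid_cells[OF scale(1)] unfolding B_def by blast
      moreover have "y \<notin> B n" if "y \<notin> A" for n using B_A that by blast
      ultimately have "\<forall>\<^sub>F n in sequentially. indicator (B n) y = (indicator A y :: real)"
        by (cases "y \<in> A") (auto elim: eventually_mono)
      then show ?case by (rule tendsto_eventually)
    qed
  qed (use B sets_region in auto)
  moreover have
    "(\<integral>y. indicator (B n) y \<partial>?M) = real (card (scaled_points (c n))) / c n ^ card I" for n
    unfolding B_def
    using sets.sets_into_space[OF B, of n] finite_scaled_points[OF scale(2), of n] scale(2)
    by (simp add: B_def Int_absorb2
        measure_grid_cells[OF finite_index _ _ scaled_points_extensional])
  moreover have "(\<integral>y. indicator A y \<partial>?M) = measure ?M A"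
    using sets.sets_into_space[OF sets_region] by (simp add: Int_absorb2)
  ultimately show ?thesis by simp
qed

end

section \<open>Null sets and finite volume in the positive orthant\<close>

lemma borel_measurable_coord: "i \<in> K \<Longrightarrow> (\<lambda>y. y i) \<in> borel_measurable (lborel_on K)"
  using measurable_component_singleton[of i K "\<lambda>_. lborel"] by simp

lemma borel_measurable_esym_on: "(\<lambda>y. esym_on I l y :: real) \<in> borel_measurable (lborel_on I)"
  unfolding esym_on_def
  by (intro borel_measurable_sum borel_measurable_prod borel_measurable_coord) auto

lemma null_set_if_countable_sections:
  assumes J: "finite J" "i \<notin> J" and A: "A \<in> sets (lborel_on (insert i J))"
    and sec: "\<And>y. y \<in> space (lborel_on J) \<Longrightarrow> countable {t. y(i := t) \<in> A}"
  shows "A \<in> null_sets (lborel_on (insert i J))"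
proof -
  have "emeasure (lborel_on (insert i J)) A = (\<integral>\<^sup>+ z. indicator A z \<partial>lborel_on (insert i J))"
    using A by simp
  also have "\<dots> = (\<integral>\<^sup>+ y. (\<integral>\<^sup>+ t. indicator A (y(i := t)) \<partial>lborel) \<partial>lborel_on J)"
    using A J by (intro lborel_prod.product_nn_integral_insert) auto
  also have "\<dots> = (\<integral>\<^sup>+ y. 0 \<partial>lborel_on J)"
  proof (rule nn_integral_cong)
    fix y assume "y \<in> space (lborel_on J)"
    then have countable: "countable {t. y(i := t) \<in> A}" by (rule sec)
    have "(\<integral>\<^sup>+ t. indicator A (y(i := t)) \<partial>lborel)
        = (\<integral>\<^sup>+ t. indicator {t. y(i := t) \<in> A} t \<partial>lborel)"
      by (intro nn_integral_cong) (auto simp: indicator_def)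
    also have "\<dots> = emeasure lborel {t. y(i := t) \<in> A}"
      using sets.countable[OF _ countable, of lborel] by simp
    also have "\<dots> = 0" by (rule emeasure_lborel_countable[OF countable])
    finally show "(\<integral>\<^sup>+ t. indicator A (y(i := t)) \<partial>lborel) = 0" .
  qed
  finally show ?thesis using A by (simp add: null_sets_def)
qed

lemma AE_coord_neq:
  assumes "finite I" "i \<in> I"
  shows "AE y in lborel_on I. y i \<noteq> c"
proof (rule AE_I')
  have insert: "insert i (I - {i}) = I" using assms by auto
  have "{y\<in>space (lborel_on I). y i = c} \<in> null_sets (lborel_on (insert i (I - {i})))"
  proof (rule null_set_if_countable_sections)
    have [measurable]: "(\<lambda>y. y i) \<in> borel_measurable (lborel_on I)"
      using assms by (intro borel_measurable_coord)
    show "{y\<in>space (lborel_on I). y i = c} \<in> sets (lborel_on (insert i (I - {i})))"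
      unfolding insert by measurable
    show "countable {t. y(i := t) \<in> {y\<in>space (lborel_on I). y i = c}}" for y
      by (rule countable_subset[of _ "{c}"]) auto
  qed (use assms in auto)
  then show "{y\<in>space (lborel_on I). y i = c} \<in> null_sets (lborel_on I)" unfolding insert .
qed auto

lemma AE_esym_on_neq:
  assumes I: "finite I" and deg: "1 \<le> l" "l \<le> card I"
  shows "AE y in lborel_on I. y \<in> I \<rightarrow>\<^sub>E {0<..} \<longrightarrow> esym_on I l y \<noteq> c"
proof (rule AE_I')
  obtain i where i: "i \<in> I" using deg I by fastforce
  obtain l' where l': "l = Suc l'" using deg by (cases l) auto
  let ?J = "I - {i}"
  have insert: "insert i ?J = I" using i by auto
  let ?A = "{y\<in>space (lborel_on I). y \<in> I \<rightarrow>\<^sub>E {0<..} \<and> esym_on I l y = c}"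
  have "?A \<in> null_sets (lborel_on (insert i ?J))"
  proof (rule null_set_if_countable_sections)
    note [measurable] = borel_measurable_esym_on[of I l]
    have "(I \<rightarrow>\<^sub>E {0<..}) \<inter> {y\<in>space (lborel_on I). esym_on I l y = c} \<in> sets (lborel_on I)"
      using I by (intro sets.Int sets_PiM_I_finite) auto
    moreover have "?A = (I \<rightarrow>\<^sub>E {0<..}) \<inter> {y\<in>space (lborel_on I). esym_on I l y = c}" by auto
    ultimately show "?A \<in> sets (lborel_on (insert i ?J))" unfolding insert by (simp only:)
    fix y :: "'a \<Rightarrow> real"
    show "countable {t. y(i := t) \<in> ?A}"
    proof (cases "\<forall>k\<in>?J. 0 < y k")
      case True
      then have slope: "0 < esym_on ?J l' y" using I deg l' i by (intro esym_on_pos) auto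
      have affine: "esym_on I l (y(i := t)) = esym_on ?J l y + t * esym_on ?J l' y" for t
        using esym_on_remove[OF I i, of l' "y(i := t)"] by (simp add: l' esym_on_fun_upd)
      have "{t. y(i := t) \<in> ?A} \<subseteq> {(c - esym_on ?J l y) / esym_on ?J l' y}"
        using slope by (auto simp: affine field_simps)
      then show ?thesis by (rule countable_subset) simp
    next
      case False
      then have "{t. y(i := t) \<in> ?A} = {}" by (auto simp: PiE_iff split: if_splits)
      then show ?thesis by (simp only: countable_empty)
    qed
  qed (use I in auto)
  then show "?A \<in> null_sets (lborel_on I)" unfolding insert .
qed auto

definition two_sided_power :: "real \<Rightarrow> real \<Rightarrow> real" where
  "two_sided_power a t = min t (1 / t) powr a / t"

lemma nn_integral_two_sided_power_finite:
  assumes a: "0 < a"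
  shows "(\<integral>\<^sup>+ t. indicator {0<..} t * ennreal (two_sided_power a t) \<partial>lborel) < \<infinity>"
proof -
  let ?f = "\<lambda>t. ennreal (indicator {0..1} t * t powr (a - 1))"
  let ?g = "\<lambda>t. ennreal (indicator {1..} t * t powr (- a - 1))"
  have "(\<integral>\<^sup>+ t. indicator {0<..} t * ennreal (two_sided_power a t) \<partial>lborel)
      \<le> (\<integral>\<^sup>+ t. ?f t + ?g t \<partial>lborel)"
  proof (rule nn_integral_mono)
    fix t :: real
    have "two_sided_power a t = t powr (a - 1)" if "0 < t" "t \<le> 1"
      using that mult_mono[of t 1 t 1]
      by (simp add: two_sided_power_def min_absorb1 pos_le_divide_eq powr_diff)
    moreover have "two_sided_power a t = t powr (- a - 1)" if "1 \<le> t"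
      using that mult_mono[of 1 t 1 t]
      by (simp add: two_sided_power_def min_absorb2 pos_divide_le_eq powr_diff powr_divide
          powr_minus_divide)
    ultimately show "indicator {0<..} t * ennreal (two_sided_power a t) \<le> ?f t + ?g t"
      by (auto simp: indicator_def)
  qed
  also have "\<dots> = (\<integral>\<^sup>+ t. ?f t \<partial>lborel) + (\<integral>\<^sup>+ t. ?g t \<partial>lborel)"
    by (intro nn_integral_add) measurable
  also have "(\<integral>\<^sup>+ t. ?f t \<partial>lborel) = ennreal (1 / a)"
    using has_integral_powr_from_0[of "a - 1" 1] a
    by (intro nn_integral_has_integral_lebesgue) auto
  also have "(\<integral>\<^sup>+ t. ?g t \<partial>lborel) = ennreal (1 / a)"
    using has_integral_powr_to_inf[of "- a - 1" 1] a
    by (intro nn_integral_has_integral_lebesgue) auto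
  also have "ennreal (1 / a) + ennreal (1 / a) < \<infinity>" by simp
  finally show ?thesis .
qed

text \<open>With \<open>P\<close> the product of all \<open>y\<^sub>i\<close>, the hypothesis says \<open>P \<le> y\<^sub>i\<close> for all \<open>i\<close>, so
  \<open>P \<le> min 1 y\<^sub>i\<close>, while \<open>min y\<^sub>i (1 / y\<^sub>i) = (min 1 y\<^sub>i)\<^sup>2 / y\<^sub>i\<close>.\<close>

lemma prod_power_le_prod_min_inverse:
  fixes y :: "'i \<Rightarrow> real"
  assumes I: "finite I" "2 \<le> card I" and y: "\<And>i. i \<in> I \<Longrightarrow> 0 < y i"
    and subproducts: "\<And>i. i \<in> I \<Longrightarrow> (\<Prod>k\<in>I - {i}. y k) \<le> 1"
  shows "((\<Prod>i\<in>I. y i) ^ card I)\<^sup>2 \<le> (\<Prod>i\<in>I. min (y i) (1 / y i))"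
proof -
  define P where "P = (\<Prod>i\<in>I. y i)"
  define L where "L = (\<Prod>i\<in>I. min 1 (y i))"
  have P: "0 < P" unfolding P_def using y by (rule prod_pos)
  have P_le: "P \<le> y i" if "i \<in> I" for i
    using mult_left_mono[OF subproducts[OF that], of "y i"] y[OF that]
      prod.remove[OF I(1) that, of y]
    by (simp add: P_def)
  have "P ^ card I \<le> P"
    using prod_mono[of I "\<lambda>_. P" y] P_le P unfolding P_def by simp
  moreover have "P ^ card I = P * P ^ (card I - 1)" using I by (simp flip: power_Suc)
  ultimately have "P ^ (card I - 1) \<le> 1" using P by simp
  moreover have "1 < P ^ (card I - 1)" if "1 < P"
    using that I by (intro one_less_power) simp_all
  ultimately have P_le_1: "P \<le> 1" by linarith
  have "P ^ card I \<le> L"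
    using prod_mono[of I "\<lambda>_. P" "\<lambda>i. min 1 (y i)"] P_le P P_le_1 unfolding L_def by simp
  then have "(P ^ card I)\<^sup>2 \<le> L\<^sup>2" using P by (intro power_mono) auto
  also have "\<dots> \<le> L\<^sup>2 / P" using P P_le_1 by (simp add: pos_le_divide_eq mult_left_le)
  also have "L\<^sup>2 / P = (\<Prod>i\<in>I. (min 1 (y i))\<^sup>2 / y i)"
    by (simp add: L_def P_def prod_dividef prod_power_distrib)
  also have "\<dots> = (\<Prod>i\<in>I. min (y i) (1 / y i))"
  proof (rule prod.cong)
    fix i assume "i \<in> I"
    then have "0 < y i" by (rule y)
    then show "(min 1 (y i))\<^sup>2 / y i = min (y i) (1 / y i)"
      using mult_mono[of "y i" 1 "y i" 1] mult_mono[of 1 "y i" 1 "y i"]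
      by (cases "y i \<le> 1") (auto simp: min_def power2_eq_square field_simps)
  qed simp
  finally show ?thesis by (simp add: P_def)
qed

lemma one_le_prod_two_sided_power:
  fixes y :: "'i \<Rightarrow> real"
  assumes I: "finite I" "2 \<le> card I" and y: "\<And>i. i \<in> I \<Longrightarrow> 0 < y i"
    and subproducts: "\<And>i. i \<in> I \<Longrightarrow> (\<Prod>k\<in>I - {i}. y k) \<le> 1"
  shows "1 \<le> (\<Prod>i\<in>I. two_sided_power (1 / (2 * card I)) (y i))"
proof -
  define a where "a = 1 / real (2 * card I)"
  define P where "P = (\<Prod>i\<in>I. y i)"
  have P: "0 < P" unfolding P_def using y by (rule prod_pos)
  have "(P ^ card I)\<^sup>2 = P powr real (2 * card I)"
    using P powr_realpow[OF P, of "2 * card I"] by (simp add: power_mult mult.commute)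
  then have "P = ((P ^ card I)\<^sup>2) powr a"
    using P I by (auto simp: a_def powr_powr)
  also have "\<dots> \<le> (\<Prod>i\<in>I. min (y i) (1 / y i)) powr a"
    using prod_power_le_prod_min_inverse[OF I y subproducts]
    by (intro powr_mono2) (auto simp: a_def P_def)
  finally have "P \<le> (\<Prod>i\<in>I. min (y i) (1 / y i)) powr a" .
  moreover have "(\<Prod>i\<in>I. two_sided_power a (y i)) = (\<Prod>i\<in>I. min (y i) (1 / y i)) powr a / P"
    using y by (subst prod_powr_distrib)
      (auto simp: two_sided_power_def P_def prod_dividef less_imp_le)
  ultimately show ?thesis using P by (simp add: a_def)
qed

lemma emeasure_finite_if_subproducts_le_1:
  assumes I: "finite I" "2 \<le> card I" and A: "A \<in> sets (lborel_on I)" "A \<subseteq> I \<rightarrow>\<^sub>E {0<..}"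
    and subproducts: "\<And>y i. y \<in> A \<Longrightarrow> i \<in> I \<Longrightarrow> (\<Prod>k\<in>I - {i}. y k) \<le> 1"
  shows "emeasure (lborel_on I) A < \<infinity>"
proof -
  let ?g = "\<lambda>t. indicator {0<..} t * ennreal (two_sided_power (1 / (2 * card I)) t)"
  have "emeasure (lborel_on I) A = (\<integral>\<^sup>+ y. indicator A y \<partial>lborel_on I)"
    using A by simp
  also have "\<dots> \<le> (\<integral>\<^sup>+ y. (\<Prod>i\<in>I. ?g (y i)) \<partial>lborel_on I)"
  proof (rule nn_integral_mono)
    fix y show "indicator A y \<le> (\<Prod>i\<in>I. ?g (y i))"
    proof (cases "y \<in> A")
      case True
      then have y: "\<And>i. i \<in> I \<Longrightarrow> 0 < y i" using A by (auto simp: PiE_iff)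
      then have "(\<Prod>i\<in>I. ?g (y i)) = ennreal (\<Prod>i\<in>I. two_sided_power (1 / (2 * card I)) (y i))"
        by (subst prod_ennreal[symmetric])
          (auto simp: two_sided_power_def less_imp_le intro!: prod.cong)
      then show ?thesis
        using True one_le_prod_two_sided_power[OF I y subproducts[OF True]]
        by (simp add: ennreal_ge_1)
    qed simp
  qed
  also have "\<dots> = (\<Prod>i\<in>I. \<integral>\<^sup>+ t. ?g t \<partial>lborel)"
    using I by (intro lborel_prod.product_nn_integral_prod) (auto simp: two_sided_power_def)
  also have "\<dots> < \<infinity>"
    using I nn_integral_two_sided_power_finite[of "1 / (2 * card I)"]
    by (simp add: power_less_top_ennreal)
  finally show ?thesis .
qed

section \<open>The law of the rescaled product for \<open>l < r\<close>\<close>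

definition esym_region :: "'i set \<Rightarrow> nat \<Rightarrow> real \<Rightarrow> ('i \<Rightarrow> real) set" where
  "esym_region I l x = {y \<in> I \<rightarrow>\<^sub>E {0<..}. esym_on I l y \<le> 1 \<and> (\<Prod>i\<in>I. y i) \<le> x}"

lemma sets_esym_prod_le:
  assumes I: "finite I" and B: "B \<in> sets borel"
  shows "{y \<in> I \<rightarrow>\<^sub>E B. esym_on I l y \<le> 1 \<and> (\<Prod>i\<in>I. y i) \<le> (x::real)} \<in> sets (lborel_on I)"
proof -
  note [measurable] = borel_measurable_esym_on[of I]
  have "{y \<in> I \<rightarrow>\<^sub>E B. esym_on I l y \<le> 1 \<and> (\<Prod>i\<in>I. y i) \<le> x}
      = (I \<rightarrow>\<^sub>E B) \<inter> {y\<in>space (lborel_on I). esym_on I l y \<le> 1 \<and> esym_on I (card I) y \<le> x}"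
    by (auto simp: space_PiM PiE_iff extensional_def esym_on_card[OF I])
  also have "\<dots> \<in> sets (lborel_on I)"
    using I B by (intro sets.Int sets_PiM_I_finite) (simp_all, measurable)
  finally show ?thesis .
qed

lemma emeasure_esym_region_finite:
  assumes I: "finite I" and deg: "1 \<le> l" "l < card I"
  shows "emeasure (lborel_on I) (esym_region I l x) < \<infinity>"
proof (rule emeasure_finite_if_subproducts_le_1[OF I])
  fix y i assume y: "y \<in> esym_region I l x" and i: "i \<in> I"
  have nonneg: "\<And>k. k \<in> I \<Longrightarrow> 0 \<le> y k" using y by (auto simp: esym_region_def PiE_iff less_imp_le)
  have l_le: "l \<le> card (I - {i})" using deg i I by simp
  have "esym_on (I - {i}) l y \<le> esym_on I l y" using I nonneg by (intro esym_on_subset_mono) auto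
  also have "\<dots> \<le> 1" using y by (simp add: esym_region_def)
  finally have "(\<Prod>k\<in>I - {i}. y k)
      \<le> (1 / real (card (I - {i}) choose l)) powr (real (card (I - {i})) / real l)"
    using I deg l_le nonneg by (intro prod_le_of_esym_on_le) auto
  also have "\<dots> \<le> 1 powr (real (card (I - {i})) / real l)"
  proof (rule powr_mono2)
    show "1 / real (card (I - {i}) choose l) \<le> 1"
      using one_le_binomial_real[OF l_le] l_le by (simp add: divide_le_eq_1)
  qed auto
  finally show "(\<Prod>k\<in>I - {i}. y k) \<le> 1" by simp
qed (use I deg sets_esym_prod_le[OF I, of "{0<..}" l x] in \<open>auto simp: esym_region_def\<close>)

lemma esym_region_strictly_dominated:
  assumes I: "finite I" and y: "y \<in> esym_region I l x"
    and strict: "esym_on I l y < 1" "(\<Prod>i\<in>I. y i) < x"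
  shows "\<exists>z\<in>esym_region I l x. \<forall>i\<in>I. y i < z i"
proof -
  have "((\<lambda>s. s ^ l * esym_on I l y) \<longlongrightarrow> 1 ^ l * esym_on I l y) (at_right 1)"
    "((\<lambda>s. s ^ card I * (\<Prod>i\<in>I. y i)) \<longlongrightarrow> 1 ^ card I * (\<Prod>i\<in>I. y i)) (at_right 1)"
    by (intro tendsto_intros)+
  then have "\<forall>\<^sub>F s in at_right 1. s ^ l * esym_on I l y < 1"
    "\<forall>\<^sub>F s in at_right 1. s ^ card I * (\<Prod>i\<in>I. y i) < x"
    using strict by (auto intro: order_tendstoD)
  then have "\<forall>\<^sub>F s in at_right (1::real).
      1 < s \<and> s ^ l * esym_on I l y < 1 \<and> s ^ card I * (\<Prod>i\<in>I. y i) < x"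
    using eventually_at_right_less[of 1] by eventually_elim simp
  then obtain s where s: "1 < s" "s ^ l * esym_on I l y < 1" "s ^ card I * (\<Prod>i\<in>I. y i) < x"
    using eventually_happens[of _ "at_right (1::real)"] by auto
  let ?z = "\<lambda>i\<in>I. s * y i"
  have "esym_on I l ?z = s ^ l * esym_on I l y"
    unfolding esym_on_scale[symmetric] by (intro esym_on_cong) simp
  moreover have "(\<Prod>i\<in>I. ?z i) = s ^ card I * (\<Prod>i\<in>I. y i)" by (simp add: prod.distrib)
  ultimately have "?z \<in> esym_region I l x"
    using s y by (auto simp: esym_region_def PiE_iff)
  moreover have "\<forall>i\<in>I. y i < ?z i" using s y by (auto simp: esym_region_def PiE_iff)
  ultimately show ?thesis by blast
qed

lemma AE_esym_region_strictly_dominated: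
  assumes I: "finite I" and deg: "1 \<le> l" "l \<le> card I"
  shows "AE y in lborel_on I. y \<in> esym_region I l x \<longrightarrow> (\<exists>z\<in>esym_region I l x. \<forall>i\<in>I. y i < z i)"
proof -
  have "1 \<le> card I" using deg by simp
  from AE_esym_on_neq[OF I deg, of 1] AE_esym_on_neq[OF I this order_refl, of x]
  show ?thesis
  proof eventually_elim
    case (elim y)
    then show ?case
      using esym_on_card[OF I, of y] esym_region_strictly_dominated[OF I, of y l x]
      by (auto simp: esym_region_def order_less_le)
  qed
qed

lemma lower_region_esym_region:
  assumes I: "finite I" and deg: "1 \<le> l" "l < card I"
  shows "lower_region I (esym_region I l x)"
proof
  fix y z
  assume z: "z \<in> esym_region I l x" and y: "y \<in> I \<rightarrow>\<^sub>E {0<..}" and y_le_z: "\<And>i. i \<in> I \<Longrightarrow> y i \<le> z i"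
  have nonneg: "\<And>i. i \<in> I \<Longrightarrow> 0 \<le> y i" using y by (auto simp: PiE_iff less_imp_le)
  have "esym_on I l y \<le> esym_on I l z" by (intro esym_on_mono nonneg y_le_z)
  moreover have "(\<Prod>i\<in>I. y i) \<le> (\<Prod>i\<in>I. z i)" by (intro prod_mono conjI nonneg y_le_z)
  ultimately show "y \<in> esym_region I l x" using y z by (auto simp: esym_region_def)
next
  show "AE y in lborel_on I. y \<in> esym_region I l x \<longrightarrow> (\<exists>z\<in>esym_region I l x. \<forall>i\<in>I. y i < z i)"
    using deg by (intro AE_esym_region_strictly_dominated I) auto
next
  show "esym_region I l x \<in> sets (lborel_on I)"
    unfolding esym_region_def using I by (intro sets_esym_prod_le) auto
qed (use assms emeasure_esym_region_finite in \<open>auto simp: esym_region_def\<close>)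

lemma scaled_points_esym_region:
  assumes deg: "1 \<le> l" "l < r" and n: "0 < n"
  shows "lower_region.scaled_points {1..r} (esym_region {1..r} l x) (real n powr (1 / real l))
           = {v\<in>hyp_set l r n. scaled_prod l r n v \<le> x}"
proof -
  interpret lower_region "{1..r}" "esym_region {1..r} l x"
    using deg by (intro lower_region_esym_region) auto
  define c where "c = real n powr (1 / real l)"
  have c_eqs: "0 < c" "c ^ l = real n" "c ^ r = real n powr (real r / real l)"
    using n deg by (simp_all add: c_def powr_powr flip: powr_realpow)
  have "(\<lambda>i\<in>{1..r}. real (v i) / c) \<in> esym_region {1..r} l x
      \<longleftrightarrow> esym_on {1..r} l v \<le> n \<and> scaled_prod l r n v \<le> x" if v: "v \<in> {1..r} \<rightarrow>\<^sub>E {1..}" for v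
  proof -
    let ?y = "\<lambda>i\<in>{1..r}. real (v i) / c"
    have "esym_on {1..r} l ?y = esym_on {1..r} l (\<lambda>i. 1 / c * real (v i))"
      by (intro esym_on_cong) simp
    also have "\<dots> = real (esym_on {1..r} l v) / real n"
      unfolding esym_on_scale esym_on_of_nat using c_eqs by (simp add: power_one_over)
    finally have "esym_on {1..r} l ?y \<le> 1 \<longleftrightarrow> esym_on {1..r} l v \<le> n" using n by simp
    moreover have "(\<Prod>i=1..r. ?y i) = scaled_prod l r n v"
      using c_eqs by (simp add: scaled_prod_def prod_dividef)
    moreover have "?y \<in> {1..r} \<rightarrow>\<^sub>E {0<..}"
      using v c_eqs by (auto simp: PiE_iff less_le_trans[OF zero_less_one])
    ultimately show ?thesis by (simp add: esym_region_def)
  qed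
  then show ?thesis
    unfolding scaled_points_def c_def[symmetric] by (auto simp: hyp_set_iff)
qed

lemma tendsto_card_scaled_prod_le:
  assumes deg: "1 \<le> l" "l < r"
  shows "(\<lambda>n. real (card {v\<in>hyp_set l r n. scaled_prod l r n v \<le> x})
             / real n powr (real r / real l))
           \<longlonglongrightarrow> measure (lborel_on {1..r}) (esym_region {1..r} l x)"
proof -
  interpret lower_region "{1..r}" "esym_region {1..r} l x"
    using deg by (intro lower_region_esym_region) auto
  let ?c = "\<lambda>n. real (Suc n) powr (1 / real l)"
  have "filterlim ?c at_top sequentially"
    using deg by (intro filterlim_compose[OF real_powr_at_top]
      filterlim_compose[OF filterlim_real_sequentially filterlim_Suc]) auto
  then have "(\<lambda>n. real (card (scaled_points (?c n))) / ?c n ^ card {1..r})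
      \<longlonglongrightarrow> measure (lborel_on {1..r}) (esym_region {1..r} l x)"
    by (rule tendsto_card_scaled_points) simp
  moreover have "?c n ^ r = real (Suc n) powr (real r / real l)" for n
    by (simp add: powr_powr flip: powr_realpow)
  ultimately have "(\<lambda>n. real (card {v\<in>hyp_set l r (Suc n). scaled_prod l r (Suc n) v \<le> x})
      / real (Suc n) powr (real r / real l)) \<longlonglongrightarrow> measure (lborel_on {1..r}) (esym_region {1..r} l x)"
    using scaled_points_esym_region[OF deg] by (simp del: of_nat_Suc)
  then show ?thesis by (rule LIMSEQ_imp_Suc)
qed

lemma measure_esym_region_pos:
  assumes deg: "1 \<le> l" "l < r"
  shows "0 < measure (lborel_on {1..r}) (esym_region {1..r} l 1)"
proof -
  define e where "e = 1 / real (r choose l)"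
  have "1 \<le> real (r choose l)" using deg by (intro one_le_binomial_real) simp
  then have e_bounds: "0 < e" "e \<le> 1" "real (r choose l) * e = 1"
    using deg by (simp_all add: e_def divide_le_eq_1)
  have "({1..r} \<rightarrow>\<^sub>E {0<..e}) \<subseteq> esym_region {1..r} l 1"
  proof
    fix y assume y: "y \<in> {1..r} \<rightarrow>\<^sub>E {0<..e}"
    have "esym_on {1..r} l y \<le> esym_on {1..r} l (\<lambda>_. e)"
      using y by (intro esym_on_mono) (auto simp: PiE_iff less_imp_le)
    also have "\<dots> = real (r choose l) * e ^ l" by (simp add: esym_on_const)
    also have "\<dots> \<le> real (r choose l) * e"
      using e_bounds deg power_decreasing[of 1 l e] by (intro mult_left_mono) auto
    finally have "esym_on {1..r} l y \<le> 1" using e_bounds by simp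
    moreover have "0 \<le> y k \<and> y k \<le> 1" if "k \<in> {1..r}" for k
      using PiE_mem[OF y that] e_bounds by simp
    then have "(\<Prod>k=1..r. y k) \<le> 1" by (rule prod_le_1)
    ultimately show "y \<in> esym_region {1..r} l 1" using y by (auto simp: esym_region_def PiE_iff)
  qed
  moreover have "esym_region {1..r} l 1 \<in> fmeasurable (lborel_on {1..r})"
    using lower_region_esym_region[of "{1..r}" l 1] deg
    by (simp add: fmeasurable_def lower_region_def)
  ultimately have "measure (lborel_on {1..r}) ({1..r} \<rightarrow>\<^sub>E {0<..e})
      \<le> measure (lborel_on {1..r}) (esym_region {1..r} l 1)"
    by (intro measure_mono_fmeasurable) (auto intro!: sets_PiM_I_finite)
  moreover have "measure (lborel_on {1..r}) ({1..r} \<rightarrow>\<^sub>E {0<..e}) = e ^ r"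
    using e_bounds lborel_prod.emeasure_PiM[of "{1..r}" "\<lambda>_. {0<..e}"]
    by (simp add: measure_def ennreal_power)
  ultimately show ?thesis using e_bounds by (smt (verit) zero_less_power)
qed

lemma measure_nonneg_esym_region:
  assumes "finite I"
  shows "measure (lborel_on I) {y \<in> I \<rightarrow>\<^sub>E {0..}. esym_on I l y \<le> 1 \<and> (\<Prod>i\<in>I. y i) \<le> x}
           = measure (lborel_on I) (esym_region I l x)"
proof (rule measure_eq_AE)
  have "AE y in lborel_on I. \<forall>i\<in>I. y i \<noteq> 0"
    using assms by (intro AE_finite_allI AE_coord_neq)
  then show "AE y in lborel_on I. y \<in> {y \<in> I \<rightarrow>\<^sub>E {0..}. esym_on I l y \<le> 1 \<and> (\<Prod>i\<in>I. y i) \<le> x}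
      \<longleftrightarrow> y \<in> esym_region I l x"
    by eventually_elim (force simp: esym_region_def PiE_iff order_less_le)
qed (use assms in \<open>auto simp: esym_region_def intro!: sets_esym_prod_le\<close>)

lemma vol_below_eq: "vol_below l r x = measure (lborel_on {1..r}) (esym_region {1..r} l x)"
proof -
  have "{y. (\<forall>i\<in>{1..r}. 0 \<le> y i) \<and> esym l r y \<le> 1 \<and> (\<Prod>i=1..r. y i) \<le> x} \<inter> space (lborel_on {1..r})
      = {y \<in> {1..r} \<rightarrow>\<^sub>E {0..}. esym_on {1..r} l y \<le> 1 \<and> (\<Prod>i=1..r. y i) \<le> x}"
    by (auto simp: space_PiM PiE_iff extensional_def esym_eq_esym_on)
  then show ?thesis
    using measure_nonneg_esym_region[of "{1..r}" l x] by (simp add: vol_below_def)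
qed

lemma vol_below_nonpos:
  assumes "x \<le> 0" shows "vol_below l r x = 0"
proof -
  have "y \<notin> esym_region {1..r} l x" for y
  proof
    assume y: "y \<in> esym_region {1..r} l x"
    then have "0 < (\<Prod>i=1..r. y i)" by (intro prod_pos) (auto simp: esym_region_def PiE_iff)
    moreover have "(\<Prod>i=1..r. y i) \<le> x" using y by (simp add: esym_region_def)
    ultimately show False using assms by linarith
  qed
  then have "esym_region {1..r} l x = {}" by blast
  then show ?thesis by (simp add: vol_below_eq)
qed

lemma vol_total_eq:
  assumes deg: "1 \<le> l" "l \<le> r" and x: "real (r choose l) powr (- (real r / real l)) \<le> x"
  shows "vol_total l r = measure (lborel_on {1..r}) (esym_region {1..r} l x)"
proof -
  have "(\<Prod>k=1..r. y k) \<le> x" if "y \<in> {1..r} \<rightarrow>\<^sub>E {0..}" "esym_on {1..r} l y \<le> 1" for y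
  proof -
    have "(\<Prod>k=1..r. y k) \<le> (1 / real (r choose l)) powr (real r / real l)"
      using prod_le_of_esym_on_le[of "{1..r}" l y 1] that deg by (simp add: PiE_iff)
    also have "\<dots> = real (r choose l) powr (- (real r / real l))"
      by (simp add: powr_minus powr_divide field_simps)
    finally show ?thesis using x by linarith
  qed
  then have "{y \<in> {1..r} \<rightarrow>\<^sub>E {0..}. esym l r y \<le> 1}
      = {y \<in> {1..r} \<rightarrow>\<^sub>E {0..}. esym_on {1..r} l y \<le> 1 \<and> (\<Prod>k=1..r. y k) \<le> x}"
    by (auto simp: esym_eq_esym_on)
  then show ?thesis using measure_nonneg_esym_region[of "{1..r}" l x] by (simp add: vol_total_def)
qed

lemma tendsto_prob_scaled_prod_le_volume:
  assumes deg: "1 \<le> l" "l < r"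
  shows "(\<lambda>n. \<P>(v in hyp_pmf l r n. scaled_prod l r n v \<le> x))
           \<longlonglongrightarrow> vol_below l r x / vol_below l r 1"
proof -
  let ?s = "\<lambda>n. real n powr (real r / real l)"
  let ?a = "\<lambda>n x. real (card {v\<in>hyp_set l r n. scaled_prod l r n v \<le> x})"
  have "(\<lambda>n. (?a n x / ?s n) / (?a n 1 / ?s n)) \<longlonglongrightarrow> vol_below l r x / vol_below l r 1"
    unfolding vol_below_eq using measure_esym_region_pos[OF deg]
    by (intro tendsto_divide tendsto_card_scaled_prod_le deg) auto
  moreover have "\<forall>\<^sub>F n in sequentially.
      (?a n x / ?s n) / (?a n 1 / ?s n) = \<P>(v in hyp_pmf l r n. scaled_prod l r n v \<le> x)"
    using eventually_ge_at_top[of "r choose l"] eventually_gt_at_top[of 0]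
  proof eventually_elim
    case (elim n)
    have "{v\<in>hyp_set l r n. scaled_prod l r n v \<le> 1} = hyp_set l r n"
      using scaled_prod_le_1[of l r] deg by auto
    then show ?case using elim deg prob_hyp_pmf[of l r n] by simp
  qed
  ultimately show ?thesis by (rule Lim_transform_eventually)
qed

lemma prob_U_le_volume:
  assumes deg: "1 \<le> l" "l < r" and N: "prob_space N" and U: "has_U_law l r N U"
  shows "\<P>(\<omega> in N. U \<omega> \<le> x) = vol_below l r x / vol_below l r 1"
proof -
  interpret prob_space N by (rule N)
  have [measurable]: "U \<in> borel_measurable N" using U by (simp add: has_U_law_def)
  define b where "b = real (r choose l) powr (- (real r / real l))"
  have binomial: "1 \<le> real (r choose l)" using deg by (intro one_le_binomial_real) simp
  then have "b \<le> real (r choose l) powr 0" unfolding b_def by (intro powr_mono) auto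
  then have b: "0 \<le> b" "b \<le> 1" using deg by (auto simp: b_def)
  have above: "vol_below l r z = vol_total l r" if "b \<le> z" for z
    using vol_total_eq[of l r z] that deg by (simp add: b_def vol_below_eq)
  have law: "\<P>(\<omega> in N. U \<omega> \<le> z) = vol_below l r z / vol_below l r 1" if "0 \<le> z" "z \<le> b" for z
    using U deg that above[OF b(2)] by (simp add: has_U_law_def b_def)
  have mono: "\<P>(\<omega> in N. U \<omega> \<le> y) \<le> \<P>(\<omega> in N. U \<omega> \<le> z)" if "y \<le> z" for y z
    using that by (intro finite_measure_mono) auto
  consider (negative) "x < 0" | (middle) "0 \<le> x" "x \<le> b" | (large) "b < x" by linarith
  then show ?thesis
  proof cases
    case negative
    then have "\<P>(\<omega> in N. U \<omega> \<le> x) \<le> 0"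
      using mono[of x 0] law[of 0] b by (simp add: vol_below_nonpos)
    then have "\<P>(\<omega> in N. U \<omega> \<le> x) = 0" using measure_nonneg by (rule antisym)
    then show ?thesis using negative by (simp add: vol_below_nonpos)
  next
    case large
    then have "vol_below l r b / vol_below l r 1 = 1" "vol_below l r x / vol_below l r 1 = 1"
      using above[of b] above[of x] above[OF b(2)] measure_esym_region_pos[OF deg]
      by (simp_all add: vol_below_eq)
    moreover from this(1) have "1 \<le> \<P>(\<omega> in N. U \<omega> \<le> x)"
      using law[of b] b(1) mono[of b x] large by simp
    ultimately show ?thesis using prob_le_1 by (simp add: antisym)
  qed (rule law)
qed

lemma prob_U_le_full:
  assumes N: "prob_space N" and U: "has_U_law r r N U"
  shows "\<P>(\<omega> in N. U \<omega> \<le> x) = max 0 (min 1 x)"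
proof -
  interpret prob_space N by (rule N)
  have [measurable]: "U \<in> borel_measurable N"
    and law: "distr N borel U = uniform_measure lborel {0..1}"
    using U by (simp_all add: has_U_law_def)
  have "\<P>(\<omega> in N. U \<omega> \<le> x) = measure (distr N borel U) {..x}"
    by (subst measure_distr) (auto intro!: arg_cong[where f = "measure N"])
  also have "\<dots> = measure lborel ({0..1} \<inter> {..x}) / measure lborel {0..1::real}"
    unfolding law by (rule measure_uniform_measure) auto
  also have "{0..1} \<inter> {..x} = {0..min 1 x}" by auto
  finally show ?thesis by simp
qed

lemma tendsto_prob_scaled_prod_le:
  assumes deg: "1 \<le> l" "l \<le> r" and N: "prob_space N" and U: "has_U_law l r N U"
  shows "(\<lambda>n. \<P>(v in hyp_pmf l r n. scaled_prod l r n v \<le> x)) \<longlonglongrightarrow> \<P>(\<omega> in N. U \<omega> \<le> x)"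
proof (cases "l = r")
  case True
  then show ?thesis
    using tendsto_prob_scaled_prod_le_full[of r x] prob_U_le_full[OF N, of r U x] deg U by simp
next
  case False
  then have "l < r" using deg by simp
  then show ?thesis
    using tendsto_prob_scaled_prod_le_volume[of l r x] prob_U_le_volume[of l r N U x] deg N U
    by simp
qed

lemma AE_has_U_law_bounds:
  assumes deg: "1 \<le> l" "l \<le> r" and N: "prob_space N" and U: "has_U_law l r N U"
  shows "AE \<omega> in N. 0 < U \<omega> \<and> U \<omega> \<le> 1"
proof -
  interpret prob_space N by (rule N)
  have [measurable]: "U \<in> borel_measurable N" using U by (simp add: has_U_law_def)
  have "\<P>(\<omega> in N. U \<omega> \<le> 0) = 0 \<and> \<P>(\<omega> in N. U \<omega> \<le> 1) = 1"
  proof (cases "l = r")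
    case True
    then show ?thesis using prob_U_le_full[OF N] U by simp
  next
    case False
    then have lr: "l < r" using deg by simp
    then show ?thesis
      unfolding prob_U_le_volume[OF deg(1) lr N U]
      using measure_esym_region_pos[OF deg(1) lr] vol_below_nonpos[of 0 l r]
      by (simp add: vol_below_eq)
  qed
  then have "AE \<omega> in N. \<not> U \<omega> \<le> 0" "AE \<omega> in N. U \<omega> \<le> 1"
    by (simp_all add: prob_eq_0 prob_Collect_eq_1)
  then show ?thesis by eventually_elim auto
qed

section \<open>From divisibility to the joint law of valuations\<close>

definition valuations :: "('i \<Rightarrow> nat) \<Rightarrow> 'i \<times> nat \<Rightarrow> nat" where
  "valuations v = (\<lambda>(i, p). multiplicity p (v i))"

lemma multiplicity_eq_iff_dvd:
  assumes "prime (p::nat)" "x \<noteq> 0"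
  shows "multiplicity p x = a \<longleftrightarrow> p ^ a dvd x \<and> \<not> p ^ Suc a dvd x"
proof -
  have dvd_iff: "p ^ b dvd x \<longleftrightarrow> b \<le> multiplicity p x" for b
    using assms by (intro power_dvd_iff_le_multiplicity) auto
  show ?thesis unfolding dvd_iff by auto
qed

lemma dvd_fun_upd_mult_iff:
  fixes d v :: "'i \<Rightarrow> nat"
  assumes "k \<in> I" "coprime (d k) q"
  shows "(\<forall>i\<in>I. (d(k := d k * q)) i dvd v i) \<longleftrightarrow> (\<forall>i\<in>I. d i dvd v i) \<and> q dvd v k"
proof -
  have "d k * q dvd v k \<longleftrightarrow> d k dvd v k \<and> q dvd v k"
    using assms(2) by (meson divides_mult dvd_mult_left dvd_mult_right)
  then show ?thesis using assms(1) by auto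
qed

lemma prod_fun_upd_mult:
  fixes d :: "'i \<Rightarrow> nat"
  assumes "finite I" "k \<in> I"
  shows "(\<Prod>i\<in>I. real ((d(k := d k * q)) i)) = (\<Prod>i\<in>I. real (d i)) * real q"
proof -
  have "(\<Prod>i\<in>I - {k}. real ((d(k := d k * q)) i)) = (\<Prod>i\<in>I - {k}. real (d i))"
    by (intro prod.cong) auto
  then show ?thesis using assms by (simp add: prod.remove[of I k])
qed

lemma prob_multiplicity_eq:
  fixes Q :: "('i \<Rightarrow> nat) pmf"
  assumes p: "prime p" and nonzero: "AE v in Q. v k \<noteq> 0"
  shows "\<P>(v in Q. R v \<and> multiplicity p (v k) = b)
           = \<P>(v in Q. R v \<and> p ^ b dvd v k) - \<P>(v in Q. R v \<and> p ^ Suc b dvd v k)"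
proof -
  let ?A = "\<lambda>c. {v\<in>space Q. R v \<and> p ^ c dvd v k}"
  have "\<P>(v in Q. R v \<and> multiplicity p (v k) = b) = measure Q (?A b - ?A (Suc b))"
  proof (rule measure_pmf.finite_measure_eq_AE)
    show "AE v in Q. v \<in> {v\<in>space Q. R v \<and> multiplicity p (v k) = b} \<longleftrightarrow> v \<in> ?A b - ?A (Suc b)"
      using nonzero
    proof eventually_elim
      case (elim v)
      show ?case using multiplicity_eq_iff_dvd[OF p elim] by auto
    qed
  qed auto
  also have "\<dots> = measure Q (?A b) - measure Q (?A (Suc b))"
    by (intro measure_pmf.finite_measure_Diff) (auto intro: dvd_trans[of "p ^ b" "p ^ Suc b"])
  finally show ?thesis .
qed

lemma geometric_weight_eq_diff:
  fixes x :: real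
  assumes "x \<noteq> 0"
  shows "F / D * ((1 - 1 / x) * (1 / x) ^ b * R) = F / (D * x ^ b) * R - F / (D * x ^ Suc b) * R"
  using assms by (cases "D = 0") (simp_all add: power_one_over field_simps)

lemma tendsto_prob_multiplicity:
  fixes Q :: "nat \<Rightarrow> ('i \<Rightarrow> nat) pmf"
  assumes p: "prime p" and nonzero: "\<forall>\<^sub>F n in sequentially. AE v in Q n. v k \<noteq> 0"
    and lim: "\<And>c. (\<lambda>n. \<P>(v in Q n. R n v \<and> p ^ c dvd v k)) \<longlonglongrightarrow> F / (D * real p ^ c) * W"
  shows "(\<lambda>n. \<P>(v in Q n. R n v \<and> multiplicity p (v k) = b))
           \<longlonglongrightarrow> F / D * ((1 - 1 / real p) * (1 / real p) ^ b * W)"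
proof -
  have p_nonzero: "real p \<noteq> 0" using p by auto
  have "(\<lambda>n. \<P>(v in Q n. R n v \<and> p ^ b dvd v k) - \<P>(v in Q n. R n v \<and> p ^ Suc b dvd v k))
      \<longlonglongrightarrow> F / D * ((1 - 1 / real p) * (1 / real p) ^ b * W)"
    unfolding geometric_weight_eq_diff[OF p_nonzero] by (intro tendsto_diff lim)
  moreover have "\<forall>\<^sub>F n in sequentially.
      \<P>(v in Q n. R n v \<and> p ^ b dvd v k) - \<P>(v in Q n. R n v \<and> p ^ Suc b dvd v k)
      = \<P>(v in Q n. R n v \<and> multiplicity p (v k) = b)"
    using nonzero by eventually_elim (rule prob_multiplicity_eq[OF p, symmetric])
  ultimately show ?thesis by (rule Lim_transform_eventually)
qed

text \<open>The induction over the prescribed valuations absorbs the divisors \<open>p ^ c\<close> into \<open>d\<close>.\<close>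

lemma tendsto_prob_valuations_dvd:
  fixes Q :: "nat \<Rightarrow> ('i \<Rightarrow> nat) pmf"
  assumes I: "finite I" and J: "finite J" "J \<subseteq> I \<times> {p. prime p}"
    and nonzero: "\<And>i. i \<in> I \<Longrightarrow> \<forall>\<^sub>F n in sequentially. AE v in Q n. v i \<noteq> 0"
    and lim: "\<And>d. (\<And>i. i \<in> I \<Longrightarrow> 1 \<le> d i) \<Longrightarrow>
      (\<lambda>n. \<P>(v in Q n. E n v \<and> (\<forall>i\<in>I. d i dvd v i))) \<longlonglongrightarrow> F / (\<Prod>i\<in>I. real (d i))"
    and d: "\<And>i. i \<in> I \<Longrightarrow> 1 \<le> d i" "\<And>i p. (i, p) \<in> J \<Longrightarrow> coprime (d i) p"
  shows "(\<lambda>n. \<P>(v in Q n. (E n v \<and> (\<forall>i\<in>I. d i dvd v i)) \<and> (\<forall>j\<in>J. valuations v j = a j)))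
           \<longlonglongrightarrow> F / (\<Prod>i\<in>I. real (d i)) * (\<Prod>(i, p)\<in>J. (1 - 1 / real p) * (1 / real p) ^ a (i, p))"
  using J d
proof (induction J arbitrary: d rule: finite_induct)
  case empty
  then show ?case using lim by simp
next
  case (insert j J)
  obtain k p where j: "j = (k, p)" by (cases j)
  have k: "k \<in> I" and p: "prime p" using insert.prems j by auto
  let ?W = "\<Prod>(i, p)\<in>J. (1 - 1 / real p) * (1 / real p) ^ a (i, p)"
  let ?R = "\<lambda>n v. (E n v \<and> (\<forall>i\<in>I. d i dvd v i)) \<and> (\<forall>j\<in>J. valuations v j = a j)"
  have "(\<lambda>n. \<P>(v in Q n. ?R n v \<and> p ^ c dvd v k))
      \<longlonglongrightarrow> F / ((\<Prod>i\<in>I. real (d i)) * real p ^ c) * ?W" for c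
  proof -
    let ?e = "d(k := d k * p ^ c)"
    have "1 \<le> ?e i" if "i \<in> I" for i
      using insert.prems(2)[OF that] insert.prems(2)[OF k] p
      by (auto simp: Suc_le_eq prime_gt_0_nat)
    moreover have "coprime (?e i) q" if iq: "(i, q) \<in> J" for i q
    proof -
      have "prime q" "i = k \<Longrightarrow> q \<noteq> p" using iq insert.prems insert.hyps j by auto
      then show ?thesis
        using insert.prems(3)[of i q] iq p by (auto simp: primes_coprime)
    qed
    ultimately have
      "(\<lambda>n. \<P>(v in Q n. (E n v \<and> (\<forall>i\<in>I. ?e i dvd v i)) \<and> (\<forall>j\<in>J. valuations v j = a j)))
        \<longlonglongrightarrow> F / (\<Prod>i\<in>I. real (?e i)) * ?W"
      using insert.IH[of ?e] insert.prems(1) by simp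
    moreover have "(E n v \<and> (\<forall>i\<in>I. ?e i dvd v i)) \<and> (\<forall>j\<in>J. valuations v j = a j)
        \<longleftrightarrow> ?R n v \<and> p ^ c dvd v k" for n v
      using dvd_fun_upd_mult_iff[where d = d and v = v and q = "p ^ c", OF k]
        insert.prems(3)[of k p] j
      by auto
    ultimately show ?thesis unfolding prod_fun_upd_mult[OF I k] by simp
  qed
  from tendsto_prob_multiplicity[OF p nonzero[OF k] this, of "a j"]
  show ?case using insert.hyps by (simp add: valuations_def j conj_ac)
qed

section \<open>Convergence of probabilities along a discrete partition\<close>

lemma (in prob_space) eventually_prob_gt_if_fibres:
  fixes Q :: "nat \<Rightarrow> 'v pmf" and f :: "'v \<Rightarrow> 'c" and T :: "'a \<Rightarrow> 'c"
  assumes C: "countable C" and T: "T \<in> M \<rightarrow>\<^sub>M count_space C" and F: "Measurable.pred M F"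
    and lim: "\<And>c. c \<in> C \<Longrightarrow> (\<lambda>n. \<P>(v in Q n. E n v \<and> f v = c)) \<longlonglongrightarrow> \<P>(\<omega> in M. F \<omega> \<and> T \<omega> = c)"
    and x: "x < \<P>(\<omega> in M. F \<omega>)"
  shows "\<forall>\<^sub>F n in sequentially. x < \<P>(v in Q n. E n v)"
proof -
  note [measurable] = T F
  define D where "D m = {c\<in>C. to_nat_on C c < m}" for m
  have finite_D: "finite (D m)" for m
    using finite_vimage_IntI[OF finite_lessThan inj_on_to_nat_on[OF C], of m]
    by (simp add: D_def vimage_def Int_def conj_commute)
  have D_C: "D m \<subseteq> C" for m by (auto simp: D_def)
  have T_C: "T \<omega> \<in> C" if "\<omega> \<in> space M" for \<omega> using measurable_space[OF T that] by simp
  have [measurable]: "Measurable.pred M (\<lambda>\<omega>. T \<omega> \<in> D m)" for m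
    by (rule measurable_compose[OF T]) simp
  have "(\<lambda>m. \<P>(\<omega> in M. F \<omega> \<and> T \<omega> \<in> D m)) \<longlonglongrightarrow> prob (\<Union>m. {\<omega>\<in>space M. F \<omega> \<and> T \<omega> \<in> D m})"
  proof (rule finite_Lim_measure_incseq)
    show "incseq (\<lambda>m. {\<omega>\<in>space M. F \<omega> \<and> T \<omega> \<in> D m})" by (auto simp: incseq_def D_def)
  qed auto
  also have "(\<Union>m. {\<omega>\<in>space M. F \<omega> \<and> T \<omega> \<in> D m}) = {\<omega>\<in>space M. F \<omega>}"
    using T_C by (auto simp: D_def)
  finally have "\<forall>\<^sub>F m in sequentially. x < \<P>(\<omega> in M. F \<omega> \<and> T \<omega> \<in> D m)"
    using x by (rule order_tendstoD)
  then obtain m where "x < \<P>(\<omega> in M. F \<omega> \<and> T \<omega> \<in> D m)"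
    by (auto simp: eventually_sequentially)
  also have "\<P>(\<omega> in M. F \<omega> \<and> T \<omega> \<in> D m) = (\<Sum>c\<in>D m. \<P>(\<omega> in M. F \<omega> \<and> T \<omega> = c))"
    using D_C[of m] finite_D by (intro prob_sum) auto
  finally have "\<forall>\<^sub>F n in sequentially. x < (\<Sum>c\<in>D m. \<P>(v in Q n. E n v \<and> f v = c))"
    using D_C[of m] by (intro order_tendstoD(1)[OF tendsto_sum[OF lim]]) auto
  then show ?thesis
  proof eventually_elim
    case (elim n)
    have "(\<Sum>c\<in>D m. \<P>(v in Q n. E n v \<and> f v = c)) = \<P>(v in Q n. E n v \<and> f v \<in> D m)"
      using finite_D by (intro measure_pmf.prob_sum[symmetric]) auto
    also have "\<dots> \<le> \<P>(v in Q n. E n v)" by (intro measure_pmf.finite_measure_mono) auto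
    finally show ?case using elim by simp
  qed
qed

lemma (in prob_space) tendsto_prob_if_fibres:
  fixes Q :: "nat \<Rightarrow> 'v pmf" and f :: "'v \<Rightarrow> 'c" and T :: "'a \<Rightarrow> 'c"
  assumes C: "countable C" and T: "T \<in> M \<rightarrow>\<^sub>M count_space C" and F: "Measurable.pred M F"
    and lim: "\<And>c. c \<in> C \<Longrightarrow> (\<lambda>n. \<P>(v in Q n. E n v \<and> f v = c)) \<longlonglongrightarrow> \<P>(\<omega> in M. F \<omega> \<and> T \<omega> = c)"
    and lim_T: "\<And>c. c \<in> C \<Longrightarrow> (\<lambda>n. \<P>(v in Q n. f v = c)) \<longlonglongrightarrow> \<P>(\<omega> in M. T \<omega> = c)"
  shows "(\<lambda>n. \<P>(v in Q n. E n v)) \<longlonglongrightarrow> \<P>(\<omega> in M. F \<omega>)"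
proof (rule order_tendstoI)
  fix x assume "x < \<P>(\<omega> in M. F \<omega>)"
  then show "\<forall>\<^sub>F n in sequentially. x < \<P>(v in Q n. E n v)"
    by (intro eventually_prob_gt_if_fibres[OF C T F, where f = f and E = E] lim)
next
  fix x assume x: "\<P>(\<omega> in M. F \<omega>) < x"
  note [measurable] = T F
  have "\<forall>\<^sub>F n in sequentially. 1 - x < \<P>(v in Q n. \<not> E n v)"
  proof (rule eventually_prob_gt_if_fibres[OF C T,
        where F = "\<lambda>\<omega>. \<not> F \<omega>" and f = f and E = "\<lambda>n v. \<not> E n v"])
    show "1 - x < \<P>(\<omega> in M. \<not> F \<omega>)" using x by (simp add: prob_neg)
    fix c assume c: "c \<in> C"
    have "(\<lambda>n. \<P>(v in Q n. f v = c) - \<P>(v in Q n. E n v \<and> f v = c))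
        \<longlonglongrightarrow> \<P>(\<omega> in M. T \<omega> = c) - \<P>(\<omega> in M. F \<omega> \<and> T \<omega> = c)"
      by (intro tendsto_diff lim lim_T c)
    also have "\<P>(\<omega> in M. T \<omega> = c) - \<P>(\<omega> in M. F \<omega> \<and> T \<omega> = c) = \<P>(\<omega> in M. \<not> F \<omega> \<and> T \<omega> = c)"
      by (subst finite_measure_Diff[symmetric]) (auto intro!: arg_cong[where f = prob])
    also have "(\<lambda>n. \<P>(v in Q n. f v = c) - \<P>(v in Q n. E n v \<and> f v = c))
        = (\<lambda>n. \<P>(v in Q n. \<not> E n v \<and> f v = c))"
      by (intro ext, subst measure_pmf.finite_measure_Diff[symmetric])
        (auto intro!: arg_cong2[where f = measure])
    finally show "(\<lambda>n. \<P>(v in Q n. \<not> E n v \<and> f v = c)) \<longlonglongrightarrow> \<P>(\<omega> in M. \<not> F \<omega> \<and> T \<omega> = c)" .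
  qed measurable
  then show "\<forall>\<^sub>F n in sequentially. \<P>(v in Q n. E n v) < x"
  proof eventually_elim
    case (elim n)
    then show ?case using measure_pmf.prob_neg[of "Q n" "E n"] by simp
  qed
qed

section \<open>The lcm and the product as functions of the valuations\<close>

definition lcm_factor :: "'i set \<Rightarrow> ('i \<times> nat \<Rightarrow> nat) \<Rightarrow> nat \<Rightarrow> real" where
  "lcm_factor I e p = (if prime p
     then real p powi (int (MAX i\<in>I. e (i, p)) - int (\<Sum>i\<in>I. e (i, p))) else 1)"

definition lcm_prod :: "'i set \<Rightarrow> ('i \<times> nat \<Rightarrow> nat) \<Rightarrow> real" where
  "lcm_prod I e = prodinf (lcm_factor I e)"

definition lcm_prod_upto :: "'i set \<Rightarrow> nat \<Rightarrow> ('i \<times> nat \<Rightarrow> nat) \<Rightarrow> real" where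
  "lcm_prod_upto I m e = (\<Prod>p\<le>m. lcm_factor I e p)"

definition collides :: "'i set \<Rightarrow> ('i \<times> nat \<Rightarrow> nat) \<Rightarrow> nat \<Rightarrow> bool" where
  "collides I e p \<longleftrightarrow> (\<exists>i\<in>I. \<exists>j\<in>I. i \<noteq> j \<and> e (i, p) \<noteq> 0 \<and> e (j, p) \<noteq> 0)"

definition collides_above :: "'i set \<Rightarrow> ('i \<times> nat \<Rightarrow> nat) \<Rightarrow> nat \<Rightarrow> bool" where
  "collides_above I e m \<longleftrightarrow> (\<exists>p>m. prime p \<and> collides I e p)"

lemma prime_prod_eq_lcm_prod: "prime_prod r G \<omega> = lcm_prod {1..r} (\<lambda>(k, p). G k p \<omega>)"
  unfolding prime_prod_def lcm_prod_def lcm_factor_def by (simp cong: if_cong)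

lemma Max_le_sum:
  fixes f :: "'i \<Rightarrow> nat"
  assumes "finite I" "I \<noteq> {}" shows "(MAX i\<in>I. f i) \<le> (\<Sum>i\<in>I. f i)"
  using assms by (subst Max_le_iff) (auto intro: member_le_sum)

lemma Max_less_sum_if_collides:
  assumes I: "finite I" and coll: "collides I e p"
  shows "(MAX i\<in>I. e (i, p)) < (\<Sum>i\<in>I. e (i, p))"
proof -
  obtain i j where ij: "i \<in> I" "j \<in> I" "i \<noteq> j" "e (i, p) \<noteq> 0" "e (j, p) \<noteq> 0"
    using coll by (auto simp: collides_def)
  have "e (k, p) < (\<Sum>i\<in>I. e (i, p))" if k: "k \<in> I" for k
  proof -
    obtain m where m: "m \<in> I" "m \<noteq> k" "e (m, p) \<noteq> 0" using ij by metis
    have "e (k, p) < (\<Sum>i\<in>{k, m}. e (i, p))" using m by auto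
    also have "\<dots> \<le> (\<Sum>i\<in>I. e (i, p))" using I k m by (intro sum_mono2) auto
    finally show ?thesis .
  qed
  then show ?thesis using I ij(1) by (subst Max_less_iff) auto
qed

lemma Max_eq_sum_if_not_collides:
  assumes I: "finite I" "I \<noteq> {}" and "\<not> collides I e p"
  shows "(MAX i\<in>I. e (i, p)) = (\<Sum>i\<in>I. e (i, p))"
proof (rule antisym[OF Max_le_sum[OF I]])
  obtain k where k: "k \<in> I" "\<forall>i\<in>I - {k}. e (i, p) = 0"
  proof (cases "\<exists>k\<in>I. e (k, p) \<noteq> 0")
    case True
    then show thesis using assms(3) that unfolding collides_def by blast
  next
    case False
    then show thesis using I(2) that by blast
  qed
  then have "(\<Sum>i\<in>I. e (i, p)) = e (k, p)" using I by (simp add: sum.remove[of I k])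
  also have "\<dots> \<le> (MAX i\<in>I. e (i, p))" using I k by simp
  finally show "(\<Sum>i\<in>I. e (i, p)) \<le> (MAX i\<in>I. e (i, p))" .
qed

lemma lcm_factor_eq_1:
  assumes "finite I" "I \<noteq> {}" "prime p \<Longrightarrow> \<not> collides I e p"
  shows "lcm_factor I e p = 1"
  using Max_eq_sum_if_not_collides[OF assms(1,2), of e p] assms(3) by (simp add: lcm_factor_def)

lemma lcm_factor_pos: "0 < lcm_factor I e p"
  by (auto simp: lcm_factor_def prime_gt_0_nat)

lemma lcm_factor_le_half:
  assumes I: "finite I" and p: "prime p" "collides I e p"
  shows "lcm_factor I e p \<le> 1 / 2"
proof -
  define m where "m = (\<Sum>i\<in>I. e (i, p)) - (MAX i\<in>I. e (i, p))"
  have m: "1 \<le> m" using Max_less_sum_if_collides[OF I p(2)] by (simp add: m_def)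
  have "lcm_factor I e p = real p powi (- int m)"
    using p m by (simp add: lcm_factor_def m_def of_nat_diff)
  also have "\<dots> = 1 / real p ^ m" by (simp add: power_int_minus divide_inverse)
  also have "\<dots> \<le> 1 / 2"
  proof (rule divide_left_mono)
    have "(2::real) ^ 1 \<le> 2 ^ m" using m by (intro power_increasing) auto
    also have "\<dots> \<le> real p ^ m" using prime_ge_2_nat[OF p(1)] by (intro power_mono) auto
    finally show "2 \<le> real p ^ m" by simp
  qed (use p prime_gt_0_nat in auto)
  finally show ?thesis .
qed

lemma lcm_factor_le_1: "finite I \<Longrightarrow> I \<noteq> {} \<Longrightarrow> lcm_factor I e p \<le> 1"
  using lcm_factor_le_half[of I p e] lcm_factor_eq_1[of I p e] by fastforce

lemma lcm_prod_eq_upto: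
  assumes "finite I" "I \<noteq> {}" "\<not> collides_above I e m"
  shows "lcm_prod I e = lcm_prod_upto I m e"
  unfolding lcm_prod_def lcm_prod_upto_def
  using assms by (intro prodinf_finite lcm_factor_eq_1) (auto simp: collides_above_def)

lemma lcm_prod_bounds:
  assumes I: "finite I" "I \<noteq> {}" and "\<not> collides_above I e m"
  shows "0 < lcm_prod I e" "lcm_prod I e \<le> 1"
  unfolding lcm_prod_eq_upto[OF assms] lcm_prod_upto_def
  by (auto intro!: prod_pos prod_le_1 lcm_factor_pos less_imp_le[OF lcm_factor_pos]
      lcm_factor_le_1 I)

text \<open>\<open>conv_in_distr\<close> requires measurability of \<open>prime_prod\<close> also on the null set where the product
  diverges.\<close>

lemma lcm_prod_junk:
  assumes I: "finite I" and inf: "\<And>m. collides_above I e m"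
  shows "lcm_prod I e = (THE x. False)"
proof -
  have "\<not> convergent_prod (lcm_factor I e)"
  proof
    assume "convergent_prod (lcm_factor I e)"
    then have "lcm_factor I e \<longlonglongrightarrow> 1" by (rule convergent_prod_imp_LIMSEQ)
    then have "\<forall>\<^sub>F p in sequentially. 1 / 2 < lcm_factor I e p"
      by (rule order_tendstoD) simp
    then obtain m where "\<And>p. m \<le> p \<Longrightarrow> 1 / 2 < lcm_factor I e p"
      by (auto simp: eventually_sequentially)
    moreover obtain p where "m < p" "prime p" "collides I e p"
      using inf by (auto simp: collides_above_def)
    ultimately show False using lcm_factor_le_half[OF I, of p e] by (meson less_imp_le not_le)
  qed
  then have "(has_prod) (lcm_factor I e) = (\<lambda>x. False)"
    using has_prod_def convergent_prod_def by (metis (no_types, opaque_lifting) ext)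
  then show ?thesis unfolding lcm_prod_def prodinf_def by simp
qed

lemma multiplicity_Lcm_image:
  fixes v :: "'i \<Rightarrow> nat"
  assumes "finite I" "I \<noteq> {}" "\<And>i. i \<in> I \<Longrightarrow> v i \<noteq> 0" "prime p"
  shows "multiplicity p (LCM i\<in>I. v i) = (MAX i\<in>I. multiplicity p (v i))"
  using assms(1,2,3)
proof (induction rule: finite_ne_induct)
  case (insert i I)
  then have "0 \<notin> v ` I" by (metis imageE insertCI)
  then have "(LCM i\<in>I. v i) \<noteq> 0" using insert.hyps by (simp add: Lcm_0_iff)
  then show ?case using insert assms(4) by (simp add: multiplicity_lcm)
qed simp

lemma eq_prod_prime_powers:
  fixes x :: nat
  assumes "x \<noteq> 0" "y \<noteq> 0" "x dvd y"
  shows "x = (\<Prod>p\<in>prime_factors y. p ^ multiplicity p x)"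
proof -
  have "x = (\<Prod>p\<in>prime_factors x. p ^ multiplicity p x)"
    using prod_prime_factors[of x] assms by simp
  also have "\<dots> = (\<Prod>p\<in>prime_factors y. p ^ multiplicity p x)"
  proof (rule prod.mono_neutral_left)
    show "\<forall>p\<in>prime_factors y - prime_factors x. p ^ multiplicity p x = 1"
      by (simp add: prime_factors_multiplicity)
  qed (use assms in \<open>simp_all add: dvd_prime_factors\<close>)
  finally show ?thesis .
qed

lemma Lcm_div_prod_eq_lcm_prod:
  fixes v :: "'i \<Rightarrow> nat"
  assumes I: "finite I" "I \<noteq> {}" and v: "\<And>i. i \<in> I \<Longrightarrow> v i \<noteq> 0"
  shows "real (LCM i\<in>I. v i) / real (\<Prod>i\<in>I. v i) = lcm_prod I (valuations v)"
proof -
  define L where "L = (LCM i\<in>I. v i)"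
  define D where "D = (\<Prod>i\<in>I. v i)"
  let ?P = "prime_factors D"
  have "0 \<notin> v ` I" using v by (metis imageE)
  then have nonzero: "D \<noteq> 0" "L \<noteq> 0" using I by (auto simp: D_def L_def Lcm_0_iff image_iff)
  have dvd: "L dvd D" unfolding L_def D_def using I by (intro Lcm_least) (auto intro: dvd_prodI)
  have mult_L: "multiplicity p L = (MAX i\<in>I. valuations v (i, p))" if "prime p" for p
    unfolding L_def valuations_def using multiplicity_Lcm_image[OF I v that] by simp
  have mult_D: "multiplicity p D = (\<Sum>i\<in>I. valuations v (i, p))" if "prime p" for p
    unfolding D_def valuations_def
    using I \<open>0 \<notin> v ` I\<close> that by (simp add: prime_elem_multiplicity_prod_distrib)
  have factor:
    "real p ^ multiplicity p L / real p ^ multiplicity p D = lcm_factor I (valuations v) p"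
    if p: "prime p" for p
    using p prime_gt_0_nat[OF p]
    by (simp add: lcm_factor_def mult_L mult_D power_int_diff del: of_nat_sum)
  have "real L = (\<Prod>p\<in>?P. real p ^ multiplicity p L)" "real D = (\<Prod>p\<in>?P. real p ^ multiplicity p D)"
    using arg_cong[OF eq_prod_prime_powers, of L D real]
      arg_cong[OF eq_prod_prime_powers, of D D real]
      nonzero dvd by simp_all
  then have "real L / real D = (\<Prod>p\<in>?P. lcm_factor I (valuations v) p)"
    using factor by (simp add: in_prime_factors_imp_prime flip: prod_dividef)
  also have "\<dots> = lcm_prod I (valuations v)"
    unfolding lcm_prod_def
  proof (rule prodinf_finite[symmetric])
    fix p assume "p \<notin> ?P"
    then have "multiplicity p D = 0" if "prime p"
      using that nonzero by (auto simp: prime_factors_multiplicity)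
    then show "lcm_factor I (valuations v) p = 1"
      using I mult_D[of p] by (intro lcm_factor_eq_1) (auto simp: collides_def)
  qed simp
  finally show ?thesis by (simp add: L_def D_def)
qed

lemma not_collides_above_valuations:
  assumes "\<And>i. i \<in> I \<Longrightarrow> 0 < v i \<and> v i \<le> m"
  shows "\<not> collides_above I (valuations v) m"
proof -
  have "multiplicity p (v i) = 0" if "m < p" "i \<in> I" for p i
    using that assms[of i] by (intro not_dvd_imp_multiplicity_0) (auto dest: dvd_imp_le)
  then show ?thesis by (auto simp: collides_above_def collides_def valuations_def)
qed

section \<open>Random exponent fields\<close>

lemma measurable_restrict_count_space:
  fixes X :: "'a \<Rightarrow> 'j \<Rightarrow> nat"
  assumes J: "finite J" and X: "\<And>j. j \<in> J \<Longrightarrow> (\<lambda>\<omega>. X \<omega> j) \<in> M \<rightarrow>\<^sub>M count_space UNIV"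
  shows "(\<lambda>\<omega>. restrict (X \<omega>) J) \<in> M \<rightarrow>\<^sub>M count_space (J \<rightarrow>\<^sub>E UNIV)"
  using measurable_restrict[of J "\<lambda>j \<omega>. X \<omega> j" M "\<lambda>_. count_space UNIV", OF X]
    count_space_PiM_finite[OF J, of "\<lambda>_. UNIV :: nat set"] by simp

lemma measurable_finite_coords:
  fixes X :: "'a \<Rightarrow> 'j \<Rightarrow> nat"
  assumes "finite J" "\<And>j. j \<in> J \<Longrightarrow> (\<lambda>\<omega>. X \<omega> j) \<in> M \<rightarrow>\<^sub>M count_space UNIV"
    and f: "\<And>e. f (restrict e J) = f e" "\<And>e. f e \<in> space N"
  shows "(\<lambda>\<omega>. f (X \<omega>)) \<in> M \<rightarrow>\<^sub>M N"
proof -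
  have "(\<lambda>\<omega>. f (restrict (X \<omega>) J)) \<in> M \<rightarrow>\<^sub>M N"
    using f(2) by (intro measurable_compose[OF measurable_restrict_count_space[OF assms(1,2)]]) auto
  then show ?thesis by (simp add: f(1))
qed

lemma lcm_prod_upto_restrict:
  "lcm_prod_upto I m (restrict e (I \<times> {p. prime p \<and> p \<le> m})) = lcm_prod_upto I m e"
  unfolding lcm_prod_upto_def lcm_factor_def
  by (intro prod.cong refl if_cong arg_cong2[where f = "(powi)"] arg_cong2[where f = "(-)"]
      arg_cong[where f = int] arg_cong[where f = Max] image_cong sum.cong) auto

lemma finite_index_primes_le: "finite I \<Longrightarrow> finite (I \<times> {p::nat. prime p \<and> p \<le> m})"
  by (rule finite_subset[of _ "I \<times> {..m}"]) auto

lemma inverse_square_le_telescope: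
  fixes x :: real
  assumes "0 < x" shows "1 / (x + 1)\<^sup>2 \<le> 1 / x - 1 / (x + 1)"
proof -
  have "1 / (x + 1)\<^sup>2 \<le> 1 / (x * (x + 1))"
    using assms by (intro divide_left_mono) (auto simp: power2_eq_square)
  also have "\<dots> = 1 / x - 1 / (x + 1)" using assms by (simp add: field_simps)
  finally show ?thesis .
qed

lemma sums_inverse_consecutive_products:
  "(\<lambda>k. 1 / real (Suc m + k) - 1 / real (Suc m + Suc k)) sums (1 / real (Suc m))"
proof -
  have "(\<lambda>k. 1 / real (Suc m + k)) \<longlonglongrightarrow> 0" by real_asymp
  from telescope_sums'[OF this] show ?thesis by simp
qed

locale exponent_field = prob_space M for M :: "'a measure" +
  fixes I :: "'i set" and X :: "'a \<Rightarrow> 'i \<times> nat \<Rightarrow> nat"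
  assumes finite_index: "finite I" and index_nonempty: "I \<noteq> {}"
    and exponent_measurable: "\<And>i p. i \<in> I \<Longrightarrow> prime p \<Longrightarrow> (\<lambda>\<omega>. X \<omega> (i, p)) \<in> M \<rightarrow>\<^sub>M count_space UNIV"
    and prob_two_exponents_le: "\<And>i j p. i \<in> I \<Longrightarrow> j \<in> I \<Longrightarrow> i \<noteq> j \<Longrightarrow> prime p \<Longrightarrow>
      \<P>(\<omega> in M. X \<omega> (i, p) \<noteq> 0 \<and> X \<omega> (j, p) \<noteq> 0) \<le> 1 / (real p)\<^sup>2"
begin

lemma collides_measurable:
  assumes "prime p" shows "Measurable.pred M (\<lambda>\<omega>. collides I (X \<omega>) p)"
  by (rule measurable_finite_coords[where J = "I \<times> {p}"])
    (use assms finite_index exponent_measurable in \<open>auto simp: collides_def\<close>)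

lemma collides_above_measurable [measurable]: "Measurable.pred M (\<lambda>\<omega>. collides_above I (X \<omega>) m)"
proof -
  have "Measurable.pred M (\<lambda>\<omega>. m < p \<and> prime p \<and> collides I (X \<omega>) p)" for p
    using collides_measurable[of p] by (cases "m < p \<and> prime p") simp_all
  then show ?thesis unfolding collides_above_def by (rule pred_intros_countable(2))
qed

lemma prob_collides_le:
  assumes p: "prime p"
  shows "\<P>(\<omega> in M. collides I (X \<omega>) p) \<le> (real (card I))\<^sup>2 / (real p)\<^sup>2"
proof -
  let ?S = "{(i, j). i \<in> I \<and> j \<in> I \<and> i \<noteq> j}"
  let ?E = "\<lambda>(i, j). {\<omega>\<in>space M. X \<omega> (i, p) \<noteq> 0 \<and> X \<omega> (j, p) \<noteq> 0}"
  have S: "?S \<subseteq> I \<times> I" by auto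
  then have finite_S: "finite ?S" using finite_index by (auto intro: finite_subset)
  have E: "?E ij \<in> events" if "ij \<in> ?S" for ij
  proof -
    obtain i j where ij: "ij = (i, j)" "i \<in> I" "j \<in> I" using \<open>ij \<in> ?S\<close> by auto
    note [measurable] = exponent_measurable[OF ij(2) p] exponent_measurable[OF ij(3) p]
    show ?thesis unfolding ij(1) by simp
  qed
  have "{\<omega>\<in>space M. collides I (X \<omega>) p} = (\<Union>ij\<in>?S. ?E ij)"
    by (force simp: collides_def)
  then have "\<P>(\<omega> in M. collides I (X \<omega>) p) \<le> (\<Sum>ij\<in>?S. prob (?E ij))"
    using E finite_S by (simp only:) (intro finite_measure_subadditive_finite, auto)
  also have "\<dots> \<le> (\<Sum>ij\<in>?S. 1 / (real p)\<^sup>2)"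
    using prob_two_exponents_le p by (intro sum_mono) auto
  also have "\<dots> \<le> (real (card I))\<^sup>2 / (real p)\<^sup>2"
    using card_mono[OF _ S] finite_index
    by (simp add: card_cartesian_product power2_eq_square divide_right_mono flip: of_nat_mult)
  finally show ?thesis .
qed

lemma prob_collides_above_le:
  "\<P>(\<omega> in M. collides_above I (X \<omega>) (Suc m)) \<le> (real (card I))\<^sup>2 / real (Suc m)"
proof -
  let ?r2 = "(real (card I))\<^sup>2"
  let ?A = "\<lambda>k. {\<omega>\<in>space M. prime (Suc (Suc m + k)) \<and> collides I (X \<omega>) (Suc (Suc m + k))}"
  let ?b = "\<lambda>k. ?r2 * (1 / real (Suc m + k) - 1 / real (Suc m + Suc k))"
  have A: "?A k \<in> events" for k
    using collides_measurable[of "Suc (Suc m + k)"] by (cases "prime (Suc (Suc m + k))") auto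
  have "prob (?A k) \<le> ?b k" for k
  proof -
    have "1 / (real (Suc (Suc m + k)))\<^sup>2 \<le> 1 / real (Suc m + k) - 1 / real (Suc m + Suc k)"
      using inverse_square_le_telescope[of "real (Suc m + k)"] by (simp add: add_ac)
    then have "?r2 / (real (Suc (Suc m + k)))\<^sup>2 \<le> ?b k"
      using mult_left_mono[of _ _ ?r2] by fastforce
    moreover have "prob (?A k) \<le> ?r2 / (real (Suc (Suc m + k)))\<^sup>2"
      using prob_collides_le[of "Suc (Suc m + k)"] by (cases "prime (Suc (Suc m + k))") simp_all
    ultimately show ?thesis by (rule order_trans[rotated])
  qed
  moreover have b_sums: "?b sums (?r2 * (1 / real (Suc m)))"
    by (intro sums_mult sums_inverse_consecutive_products)
  ultimately have summable: "summable (\<lambda>k. prob (?A k))"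
    by (intro summable_comparison_test'[OF sums_summable[OF b_sums]]) auto
  have "collides_above I e (Suc m)
      \<longleftrightarrow> (\<exists>k. prime (Suc (Suc m + k)) \<and> collides I e (Suc (Suc m + k)))" for e
    unfolding collides_above_def by (metis less_add_Suc1 less_imp_Suc_add add_Suc_right)
  then have "{\<omega>\<in>space M. collides_above I (X \<omega>) (Suc m)} = (\<Union>k. ?A k)" by blast
  then have "\<P>(\<omega> in M. collides_above I (X \<omega>) (Suc m)) \<le> (\<Sum>k. prob (?A k))"
    using A summable by (simp only:) (intro finite_measure_subadditive_countably, auto)
  also have "\<dots> \<le> (\<Sum>k. ?b k)"
    using \<open>\<And>k. prob (?A k) \<le> ?b k\<close> summable sums_summable[OF b_sums] by (intro suminf_le)
  also have "\<dots> = ?r2 / real (Suc m)" using sums_unique[OF b_sums] by simp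
  finally show ?thesis .
qed

lemma AE_not_collides_above: "AE \<omega> in M. \<exists>m. \<not> collides_above I (X \<omega>) m"
proof -
  have "\<P>(\<omega> in M. \<forall>m. collides_above I (X \<omega>) m) \<le> (real (card I))\<^sup>2 / real (Suc m)" for m
    using finite_measure_mono[of "{\<omega>\<in>space M. \<forall>m. collides_above I (X \<omega>) m}"
        "{\<omega>\<in>space M. collides_above I (X \<omega>) (Suc m)}"] prob_collides_above_le[of m] by fastforce
  moreover have "(\<lambda>m. (real (card I))\<^sup>2 / real (Suc m)) \<longlonglongrightarrow> 0" by real_asymp
  ultimately have "\<P>(\<omega> in M. \<forall>m. collides_above I (X \<omega>) m) \<le> 0"
    by (intro LIMSEQ_le_const) auto
  then have "\<P>(\<omega> in M. \<forall>m. collides_above I (X \<omega>) m) = 0" by (simp add: measure_le_0_iff)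
  then have "AE \<omega> in M. \<omega> \<notin> {\<omega>\<in>space M. \<forall>m. collides_above I (X \<omega>) m}"
    by (subst prob_eq_0[symmetric]) auto
  then show ?thesis using AE_space by eventually_elim simp
qed

lemma lcm_prod_upto_measurable [measurable]: "(\<lambda>\<omega>. lcm_prod_upto I m (X \<omega>)) \<in> borel_measurable M"
  by (rule measurable_finite_coords[
        where J = "I \<times> {p. prime p \<and> p \<le> m}" and f = "lcm_prod_upto I m"])
    (use finite_index finite_index_primes_le exponent_measurable lcm_prod_upto_restrict in auto)

lemma lcm_prod_measurable [measurable]: "(\<lambda>\<omega>. lcm_prod I (X \<omega>)) \<in> borel_measurable M"
proof -
  have "lcm_prod I (X \<omega>) = (if \<forall>m. collides_above I (X \<omega>) m then THE x. False
      else lim (\<lambda>m. lcm_prod_upto I m (X \<omega>)))" for \<omega>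
  proof (cases "\<forall>m. collides_above I (X \<omega>) m")
    case True
    then show ?thesis using lcm_prod_junk[OF finite_index, of "X \<omega>"] by simp
  next
    case False
    then obtain k where "\<not> collides_above I (X \<omega>) k" by blast
    then have "\<not> collides_above I (X \<omega>) m" if "k \<le> m" for m
      using that unfolding collides_above_def by (meson le_less_trans)
    then have "lcm_prod_upto I m (X \<omega>) = lcm_prod I (X \<omega>)" if "k \<le> m" for m
      using that lcm_prod_eq_upto[OF finite_index index_nonempty] by metis
    then have "(\<lambda>m. lcm_prod_upto I m (X \<omega>)) \<longlonglongrightarrow> lcm_prod I (X \<omega>)"
      by (intro tendsto_eventually) (auto simp: eventually_sequentially)
    then have "lim (\<lambda>m. lcm_prod_upto I m (X \<omega>)) = lcm_prod I (X \<omega>)" by (rule limI)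
    then show ?thesis using False by (simp only: if_False)
  qed
  moreover have "(\<lambda>\<omega>. if \<forall>m. collides_above I (X \<omega>) m then THE x. False
      else lim (\<lambda>m. lcm_prod_upto I m (X \<omega>))) \<in> borel_measurable M"
    by measurable
  ultimately show ?thesis by (simp only:)
qed

lemma AE_lcm_prod_bounds: "AE \<omega> in M. 0 < lcm_prod I (X \<omega>) \<and> lcm_prod I (X \<omega>) \<le> 1"
  using AE_not_collides_above
  by eventually_elim (use lcm_prod_bounds[OF finite_index index_nonempty] in blast)

lemma abs_prob_lcm_prod_upto_diff_le:
  fixes S :: "'a \<Rightarrow> real" and \<phi> :: "real \<Rightarrow> real"
  assumes [measurable]: "S \<in> borel_measurable M" "\<phi> \<in> borel_measurable borel"
  shows "\<bar>\<P>(\<omega> in M. S \<omega> \<le> \<phi> (lcm_prod_upto I (Suc m) (X \<omega>)))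
             - \<P>(\<omega> in M. S \<omega> \<le> \<phi> (lcm_prod I (X \<omega>)))\<bar>
           \<le> (real (card I))\<^sup>2 / real (Suc m)"
proof -
  let ?A = "{\<omega>\<in>space M. S \<omega> \<le> \<phi> (lcm_prod_upto I (Suc m) (X \<omega>))}"
  let ?B = "{\<omega>\<in>space M. S \<omega> \<le> \<phi> (lcm_prod I (X \<omega>))}"
  let ?C = "{\<omega>\<in>space M. collides_above I (X \<omega>) (Suc m)}"
  have "?A \<subseteq> ?B \<union> ?C" "?B \<subseteq> ?A \<union> ?C"
    using lcm_prod_eq_upto[OF finite_index index_nonempty, of _ "Suc m"] by auto
  then have "prob ?A \<le> prob (?B \<union> ?C)" "prob ?B \<le> prob (?A \<union> ?C)"
    by (auto intro!: finite_measure_mono)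
  moreover have "prob (?B \<union> ?C) \<le> prob ?B + prob ?C" "prob (?A \<union> ?C) \<le> prob ?A + prob ?C"
    by (auto intro!: measure_Un_le)
  ultimately show ?thesis using prob_collides_above_le[of m] by linarith
qed

end

lemma exponent_field_hyp_pmf:
  assumes deg: "1 \<le> l" "l \<le> r" "r choose l \<le> n"
  shows "exponent_field (hyp_pmf l r n) {1..r} valuations"
proof (intro exponent_field.intro exponent_field_axioms.intro measure_pmf.prob_space_axioms)
  fix i j p :: nat assume ij: "i \<in> {1..r}" "j \<in> {1..r}" "i \<noteq> j" and p: "prime p"
  have "p dvd v k" if "valuations v (k, p) \<noteq> 0" for v :: "nat \<Rightarrow> nat" and k
    using that by (metis (mono_tags) case_prod_conv not_dvd_imp_multiplicity_0 valuations_def)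
  then have "\<P>(v in hyp_pmf l r n. valuations v (i, p) \<noteq> 0 \<and> valuations v (j, p) \<noteq> 0)
      \<le> \<P>(v in hyp_pmf l r n. p dvd v i \<and> p dvd v j)"
    by (intro measure_pmf.finite_measure_mono) auto
  also have "\<dots> \<le> 1 / (real p)\<^sup>2"
    using prime_ge_1_nat[OF p] by (intro prob_two_coords_dvd_le deg ij)
  finally show "\<P>(v in hyp_pmf l r n. valuations v (i, p) \<noteq> 0 \<and> valuations v (j, p) \<noteq> 0)
      \<le> 1 / (real p)\<^sup>2" .
qed (use deg in auto)

section \<open>The limiting variables\<close>

locale lcm_limit = prob_space N for N :: "'b measure" +
  fixes l r :: nat and G :: "nat \<Rightarrow> nat \<Rightarrow> 'b \<Rightarrow> nat" and U :: "'b \<Rightarrow> real"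
  assumes r_ge_2: "2 \<le> r" and l_ge_1: "1 \<le> l" and l_le_r: "l \<le> r"
    and geometric: "geometric_family N G"
    and U_law: "has_U_law l r N U"
    and U_indep: "indep_of_family N U G"
begin

definition exponents :: "'b \<Rightarrow> nat \<times> nat \<Rightarrow> nat" where
  "exponents \<omega> = (\<lambda>(k, p). G k p \<omega>)"

abbreviation index_primes :: "(nat \<times> nat) set" where
  "index_primes \<equiv> {1..} \<times> {p. prime p}"

lemma U_measurable [measurable]: "U \<in> borel_measurable N"
  using U_law by (simp add: has_U_law_def)

lemmas AE_U_bounds = AE_has_U_law_bounds[OF l_ge_1 l_le_r prob_space_axioms U_law]

lemma indep_vars_exponents: "indep_vars (\<lambda>_. count_space UNIV) (\<lambda>j \<omega>. exponents \<omega> j) index_primes"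
proof -
  have "(\<lambda>j \<omega>. exponents \<omega> j) = (\<lambda>(k, p). G k p)" by (auto simp: exponents_def fun_eq_iff)
  then show ?thesis using geometric by (simp add: geometric_family_def)
qed

lemma exponents_measurable: "j \<in> index_primes \<Longrightarrow> (\<lambda>\<omega>. exponents \<omega> j) \<in> N \<rightarrow>\<^sub>M count_space UNIV"
  using indep_vars_exponents unfolding indep_vars_def2 by blast

lemma exponents_event: "j \<in> index_primes \<Longrightarrow> {\<omega>\<in>space N. exponents \<omega> j \<in> B} \<in> events"
  using measurable_sets[OF exponents_measurable, of j B]
  by (simp add: vimage_def Int_def conj_commute)

lemma prob_exponent_eq:
  "k \<ge> 1 \<Longrightarrow> prime p \<Longrightarrow> \<P>(\<omega> in N. exponents \<omega> (k, p) = a) = (1 - 1 / real p) * (1 / real p) ^ a"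
  using geometric by (simp add: geometric_family_def exponents_def)

lemma prob_exponents_mem:
  assumes J: "finite J" "J \<subseteq> index_primes"
  shows "\<P>(\<omega> in N. \<forall>j\<in>J. exponents \<omega> j \<in> B j) = (\<Prod>j\<in>J. \<P>(\<omega> in N. exponents \<omega> j \<in> B j))"
proof (cases "J = {}")
  case True
  then show ?thesis by (simp add: prob_space)
next
  case False
  then have "prob (\<Inter>j\<in>J. (\<lambda>\<omega>. exponents \<omega> j) -` B j \<inter> space N)
      = (\<Prod>j\<in>J. prob ((\<lambda>\<omega>. exponents \<omega> j) -` B j \<inter> space N))"
    using J by (intro indep_varsD[OF indep_vars_exponents]) auto
  moreover have "(\<Inter>j\<in>J. (\<lambda>\<omega>. exponents \<omega> j) -` B j \<inter> space N)
      = {\<omega>\<in>space N. \<forall>j\<in>J. exponents \<omega> j \<in> B j}"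
    using False by auto
  ultimately show ?thesis by (simp add: vimage_def Int_def conj_commute)
qed

lemma prob_exponents_eq:
  assumes J: "finite J" "J \<subseteq> index_primes"
  shows "\<P>(\<omega> in N. \<forall>j\<in>J. exponents \<omega> j = a j)
           = (\<Prod>(k, p)\<in>J. (1 - 1 / real p) * (1 / real p) ^ a (k, p))"
  using prob_exponents_mem[OF J, of "\<lambda>j. {a j}"] J(2)
  by (auto simp: prob_exponent_eq intro!: prod.cong)

lemma prob_U_exponents_eq:
  assumes J: "finite J" "J \<subseteq> index_primes"
  shows "\<P>(\<omega> in N. U \<omega> \<le> x \<and> (\<forall>j\<in>J. exponents \<omega> j = a j))
       = \<P>(\<omega> in N. U \<omega> \<le> x) * \<P>(\<omega> in N. \<forall>j\<in>J. exponents \<omega> j = a j)"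
proof -
  let ?P = "Pi\<^sub>M index_primes (\<lambda>_. count_space (UNIV :: nat set))"
  let ?f = "\<lambda>\<omega>. \<lambda>(k, p)\<in>index_primes. G k p \<omega>"
  define B where "B = {g\<in>space ?P. \<forall>j\<in>J. g j = a j}"
  have B: "B \<in> sets ?P"
    unfolding B_def
  proof (intro sets.sets_Collect_finite_All J)
    fix j assume "j \<in> J"
    then have [measurable]: "(\<lambda>g. g j) \<in> ?P \<rightarrow>\<^sub>M count_space UNIV"
      using J measurable_component_singleton[of j index_primes "\<lambda>_. count_space UNIV"] by auto
    show "{g\<in>space ?P. g j = a j} \<in> sets ?P" by measurable
  qed
  have "indep_set (sets (vimage_algebra (space N) U borel)) (sets (vimage_algebra (space N) ?f ?P))"
    using U_indep unfolding indep_of_family_def Let_def .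
  then have "prob ((U -` {..x} \<inter> space N) \<inter> (?f -` B \<inter> space N))
      = prob (U -` {..x} \<inter> space N) * prob (?f -` B \<inter> space N)"
    by (rule indep_setD[OF _ in_vimage_algebra in_vimage_algebra[OF B]]) simp
  moreover have "U -` {..x} \<inter> space N = {\<omega>\<in>space N. U \<omega> \<le> x}" by auto
  moreover have "?f \<omega> \<in> B \<longleftrightarrow> (\<forall>j\<in>J. exponents \<omega> j = a j)" for \<omega>
  proof -
    have "?f \<omega> \<in> space ?P" by (simp add: space_PiM)
    moreover have "?f \<omega> j = exponents \<omega> j" if "j \<in> J" for j
      using that J by (auto simp: exponents_def)
    ultimately show ?thesis by (simp add: B_def)
  qed
  then have "?f -` B \<inter> space N = {\<omega>\<in>space N. \<forall>j\<in>J. exponents \<omega> j = a j}" by auto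
  moreover have "{\<omega>\<in>space N. U \<omega> \<le> x} \<inter> {\<omega>\<in>space N. \<forall>j\<in>J. exponents \<omega> j = a j}
      = {\<omega>\<in>space N. U \<omega> \<le> x \<and> (\<forall>j\<in>J. exponents \<omega> j = a j)}" by auto
  ultimately show ?thesis by (simp only:)
qed

sublocale exponent_field N "{1..r}" exponents
proof (intro exponent_field.intro exponent_field_axioms.intro prob_space_axioms)
  show "(\<lambda>\<omega>. exponents \<omega> (i, p)) \<in> N \<rightarrow>\<^sub>M count_space UNIV" if "i \<in> {1..r}" "prime p" for i p
    using that by (intro exponents_measurable) auto
next
  fix i j p :: nat assume ij: "i \<in> {1..r}" "j \<in> {1..r}" "i \<noteq> j" and p: "prime p"
  have nonzero: "\<P>(\<omega> in N. exponents \<omega> (k, p) \<in> {0<..}) = 1 / real p" if "k \<in> {1..r}" for k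
  proof -
    have "\<P>(\<omega> in N. exponents \<omega> (k, p) \<noteq> 0) = 1 - \<P>(\<omega> in N. exponents \<omega> (k, p) = 0)"
      using exponents_event[of "(k, p)" "{0}"] that p by (intro prob_neg) auto
    then show ?thesis using prob_exponent_eq[of k p 0] that p by simp
  qed
  have "\<P>(\<omega> in N. \<forall>j\<in>{(i, p), (j, p)}. exponents \<omega> j \<in> {0<..})
      = (\<Prod>j\<in>{(i, p), (j, p)}. \<P>(\<omega> in N. exponents \<omega> j \<in> {0<..}))"
    using ij p by (intro prob_exponents_mem) auto
  then show "\<P>(\<omega> in N. exponents \<omega> (i, p) \<noteq> 0 \<and> exponents \<omega> (j, p) \<noteq> 0) \<le> 1 / (real p)\<^sup>2"
    using ij nonzero by (simp add: power2_eq_square)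
qed (use r_ge_2 in auto)

lemma prime_prod_eq: "prime_prod r G = (\<lambda>\<omega>. lcm_prod {1..r} (exponents \<omega>))"
  by (simp add: fun_eq_iff prime_prod_eq_lcm_prod exponents_def)

lemma tendsto_prob_scaled_prod_valuations:
  assumes J: "finite J" "J \<subseteq> {1..r} \<times> {p. prime p}"
  shows "(\<lambda>n. \<P>(v in hyp_pmf l r n. scaled_prod l r n v \<le> x \<and> (\<forall>j\<in>J. valuations v j = a j)))
           \<longlonglongrightarrow> \<P>(\<omega> in N. U \<omega> \<le> x \<and> (\<forall>j\<in>J. exponents \<omega> j = a j))"
proof -
  have J': "J \<subseteq> index_primes" using J by auto
  have "\<forall>\<^sub>F n in sequentially. AE v in hyp_pmf l r n. v i \<noteq> 0" if i: "i \<in> {1..r}" for i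
    using eventually_ge_at_top[of "r choose l"]
  proof eventually_elim
    case (elim n)
    show ?case
      using AE_hyp_pmf[OF l_ge_1 l_le_r elim] by eventually_elim (use hyp_set_ge_1 i in force)
  qed
  then have "(\<lambda>n. \<P>(v in hyp_pmf l r n. (scaled_prod l r n v \<le> x \<and> (\<forall>i\<in>{1..r}. 1 dvd v i))
        \<and> (\<forall>j\<in>J. valuations v j = a j)))
      \<longlonglongrightarrow> \<P>(\<omega> in N. U \<omega> \<le> x) / (\<Prod>i=1..r. real 1)
        * (\<Prod>(k, p)\<in>J. (1 - 1 / real p) * (1 / real p) ^ a (k, p))"
    using tendsto_prob_dvd[OF l_ge_1 l_le_r _
        tendsto_prob_scaled_prod_le[OF l_ge_1 l_le_r prob_space_axioms U_law]] J
    by (intro tendsto_prob_valuations_dvd) auto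
  then show ?thesis
    by (simp add: prob_U_exponents_eq[OF J(1) J'] prob_exponents_eq[OF J(1) J'])
qed

lemma tendsto_prob_valuations:
  assumes J: "finite J" "J \<subseteq> {1..r} \<times> {p. prime p}"
  shows "(\<lambda>n. \<P>(v in hyp_pmf l r n. \<forall>j\<in>J. valuations v j = a j))
           \<longlonglongrightarrow> \<P>(\<omega> in N. \<forall>j\<in>J. exponents \<omega> j = a j)"
proof -
  have "(\<lambda>n. \<P>(v in hyp_pmf l r n. scaled_prod l r n v \<le> 1 \<and> (\<forall>j\<in>J. valuations v j = a j)))
      \<longlonglongrightarrow> \<P>(\<omega> in N. U \<omega> \<le> 1 \<and> (\<forall>j\<in>J. exponents \<omega> j = a j))"
    by (rule tendsto_prob_scaled_prod_valuations[OF J])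
  also have "\<P>(\<omega> in N. U \<omega> \<le> 1 \<and> (\<forall>j\<in>J. exponents \<omega> j = a j))
      = \<P>(\<omega> in N. \<forall>j\<in>J. exponents \<omega> j = a j)"
  proof -
    have "\<P>(\<omega> in N. U \<omega> \<le> 1) = 1"
      using AE_U_bounds by (subst prob_Collect_eq_1) (auto elim: eventually_mono)
    moreover have "J \<subseteq> index_primes" using J by auto
    ultimately show ?thesis using prob_U_exponents_eq[OF J(1)] by simp
  qed
  finally show ?thesis
  proof (rule Lim_transform_eventually)
    show "\<forall>\<^sub>F n in sequentially.
        \<P>(v in hyp_pmf l r n. scaled_prod l r n v \<le> 1 \<and> (\<forall>j\<in>J. valuations v j = a j))
        = \<P>(v in hyp_pmf l r n. \<forall>j\<in>J. valuations v j = a j)"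
      using eventually_ge_at_top[of "r choose l"]
      by eventually_elim
        (intro prob_hyp_pmf_cong l_ge_1 l_le_r, auto intro: scaled_prod_le_1[OF l_ge_1 l_le_r])
  qed
qed

lemma tendsto_prob_scaled_prod_le_fun_valuations:
  assumes J: "finite J" "J \<subseteq> {1..r} \<times> {p. prime p}"
    and t: "\<And>e. t (restrict e J) = t e"
  shows "(\<lambda>n. \<P>(v in hyp_pmf l r n. scaled_prod l r n v \<le> t (valuations v)))
           \<longlonglongrightarrow> \<P>(\<omega> in N. U \<omega> \<le> t (exponents \<omega>))"
proof (rule tendsto_prob_if_fibres)
  let ?f = "\<lambda>v. restrict (valuations v) J" and ?T = "\<lambda>\<omega>. restrict (exponents \<omega>) J"
  have J': "J \<subseteq> index_primes" using J by auto
  show "countable (J \<rightarrow>\<^sub>E (UNIV :: nat set))" using J by (intro countable_PiE) auto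
  show "?T \<in> N \<rightarrow>\<^sub>M count_space (J \<rightarrow>\<^sub>E UNIV)"
    using J by (intro measurable_restrict_count_space exponents_measurable) auto
  have [measurable]: "(\<lambda>\<omega>. t (exponents \<omega>)) \<in> borel_measurable N"
    by (rule measurable_finite_coords[where J = J and f = t])
      (use J t exponents_measurable in auto)
  show "Measurable.pred N (\<lambda>\<omega>. U \<omega> \<le> t (exponents \<omega>))" by measurable
  fix c assume c: "c \<in> J \<rightarrow>\<^sub>E (UNIV :: nat set)"
  have restrict_eq: "restrict e J = c \<longleftrightarrow> (\<forall>j\<in>J. e j = c j)" for e
    using c by (auto simp: fun_eq_iff PiE_iff extensional_def restrict_def)
  have at_c: "s \<le> t e \<and> restrict e J = c \<longleftrightarrow> s \<le> t c \<and> (\<forall>j\<in>J. e j = c j)" for s e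
    using t[of e] by (auto simp: restrict_eq[symmetric])
  show "(\<lambda>n. \<P>(v in hyp_pmf l r n. scaled_prod l r n v \<le> t (valuations v) \<and> ?f v = c))
      \<longlonglongrightarrow> \<P>(\<omega> in N. U \<omega> \<le> t (exponents \<omega>) \<and> ?T \<omega> = c)"
    unfolding at_c by (rule tendsto_prob_scaled_prod_valuations[OF J])
  show "(\<lambda>n. \<P>(v in hyp_pmf l r n. ?f v = c)) \<longlonglongrightarrow> \<P>(\<omega> in N. ?T \<omega> = c)"
    unfolding restrict_eq by (rule tendsto_prob_valuations[OF J])
qed

lemma uniform_limit_prob_lcm_prod_upto:
  fixes \<phi> :: "real \<Rightarrow> real"
  assumes \<phi>: "\<phi> \<in> borel_measurable borel"
  shows "uniform_limit {r choose l..}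
    (\<lambda>m n. \<P>(v in hyp_pmf l r n.
      scaled_prod l r n v \<le> \<phi> (lcm_prod_upto {1..r} (Suc m) (valuations v))))
    (\<lambda>n. \<P>(v in hyp_pmf l r n. scaled_prod l r n v \<le> \<phi> (lcm_prod {1..r} (valuations v))))
    sequentially" (is "uniform_limit _ ?f ?h _")
proof (rule uniform_limitI)
  fix \<epsilon> :: real assume "0 < \<epsilon>"
  moreover have "(\<lambda>m. (real r)\<^sup>2 / real (Suc m)) \<longlonglongrightarrow> 0" by real_asymp
  ultimately have "\<forall>\<^sub>F m in sequentially. (real r)\<^sup>2 / real (Suc m) < \<epsilon>"
    by (simp add: order_tendstoD)
  then show "\<forall>\<^sub>F m in sequentially. \<forall>n\<in>{r choose l..}. dist (?f m n) (?h n) < \<epsilon>"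
  proof eventually_elim
    case (elim m)
    show ?case
    proof
      fix n assume "n \<in> {r choose l..}"
      then interpret H: exponent_field "hyp_pmf l r n" "{1..r}" valuations
        by (intro exponent_field_hyp_pmf l_ge_1 l_le_r) simp
      show "dist (?f m n) (?h n) < \<epsilon>"
        using H.abs_prob_lcm_prod_upto_diff_le[OF _ \<phi>, of "scaled_prod l r n" m] elim
        by (simp add: dist_real_def)
    qed
  qed
qed

lemma tendsto_prob_scaled_prod_le_fun_lcm_prod:
  fixes \<phi> :: "real \<Rightarrow> real"
  assumes \<phi>: "\<phi> \<in> borel_measurable borel"
  shows "(\<lambda>n. \<P>(v in hyp_pmf l r n. scaled_prod l r n v \<le> \<phi> (lcm_prod {1..r} (valuations v))))
           \<longlonglongrightarrow> \<P>(\<omega> in N. U \<omega> \<le> \<phi> (lcm_prod {1..r} (exponents \<omega>)))"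
proof (rule swap_uniform_limit'[OF always_eventually[OF allI] _
      uniform_limit_prob_lcm_prod_upto[OF \<phi>]])
  let ?g = "\<lambda>m. \<P>(\<omega> in N. U \<omega> \<le> \<phi> (lcm_prod_upto {1..r} (Suc m) (exponents \<omega>)))"
  show "(\<lambda>n. \<P>(v in hyp_pmf l r n.
      scaled_prod l r n v \<le> \<phi> (lcm_prod_upto {1..r} (Suc m) (valuations v)))) \<longlonglongrightarrow> ?g m" for m
    using tendsto_prob_scaled_prod_le_fun_valuations[
        where t = "\<lambda>e. \<phi> (lcm_prod_upto {1..r} (Suc m) e)",
        OF finite_index_primes_le[of "{1..r}" "Suc m"]]
    by (auto simp: lcm_prod_upto_restrict)
  have "(\<lambda>m. ?g m - \<P>(\<omega> in N. U \<omega> \<le> \<phi> (lcm_prod {1..r} (exponents \<omega>)))) \<longlonglongrightarrow> 0"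
  proof (rule Lim_null_comparison[OF always_eventually])
    show "\<forall>m. norm (?g m - \<P>(\<omega> in N. U \<omega> \<le> \<phi> (lcm_prod {1..r} (exponents \<omega>))))
        \<le> (real r)\<^sup>2 / real (Suc m)"
      using abs_prob_lcm_prod_upto_diff_le[OF U_measurable \<phi>] by simp
    show "(\<lambda>m. (real r)\<^sup>2 / real (Suc m)) \<longlonglongrightarrow> 0" by real_asymp
  qed
  then show "?g \<longlonglongrightarrow> \<P>(\<omega> in N. U \<omega> \<le> \<phi> (lcm_prod {1..r} (exponents \<omega>)))"
    by (rule LIM_zero_cancel)
qed (auto simp: eventually_ge_at_top)

abbreviation Lcm_ratio :: "(nat \<Rightarrow> nat) \<Rightarrow> real" where
  "Lcm_ratio v \<equiv> real (LCM k\<in>{1..r}. v k) / real (\<Prod>k=1..r. v k)"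

abbreviation scaled_Lcm :: "nat \<Rightarrow> (nat \<Rightarrow> nat) \<Rightarrow> real" where
  "scaled_Lcm n v \<equiv> real (LCM k\<in>{1..r}. v k) / real n powr (real r / real l)"

lemma Lcm_ratio_eq:
  assumes "v \<in> hyp_set l r n"
  shows "Lcm_ratio v = lcm_prod {1..r} (valuations v)"
  using hyp_set_ge_1[OF assms] r_ge_2 by (intro Lcm_div_prod_eq_lcm_prod) fastforce+

lemma scaled_Lcm_eq:
  assumes v: "v \<in> hyp_set l r n"
  shows "scaled_Lcm n v = scaled_prod l r n v * lcm_prod {1..r} (valuations v)"
proof -
  have "real (\<Prod>k=1..r. v k) \<noteq> 0"
    using hyp_set_prod_pos[OF v] by (simp only: of_nat_eq_0_iff)
  then show ?thesis
    unfolding scaled_prod_def Lcm_ratio_eq[OF v, symmetric]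
    by (simp only: times_divide_times_eq) simp
qed

lemma lcm_prod_valuations_bounds:
  assumes v: "v \<in> hyp_set l r n"
  shows "0 < lcm_prod {1..r} (valuations v)" "lcm_prod {1..r} (valuations v) \<le> 1"
proof -
  have "0 < v k \<and> v k \<le> n" if "k \<in> {1..r}" for k
    using hyp_set_ge_1[OF v that] hyp_set_le[OF l_ge_1 l_le_r v that] by simp
  then have "\<not> collides_above {1..r} (valuations v) n" by (rule not_collides_above_valuations)
  then show "0 < lcm_prod {1..r} (valuations v)" "lcm_prod {1..r} (valuations v) \<le> 1"
    using lcm_prod_bounds[OF finite_index index_nonempty] by blast+
qed

lemma prime_prod_measurable [measurable]: "prime_prod r G \<in> borel_measurable N"
  unfolding prime_prod_eq by (rule lcm_prod_measurable)

lemma AE_prime_prod_bounds: "AE \<omega> in N. 0 < prime_prod r G \<omega> \<and> prime_prod r G \<omega> \<le> 1"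
  unfolding prime_prod_eq by (rule AE_lcm_prod_bounds)

lemma AE_prime_prod_unit_interval: "AE \<omega> in N. 0 \<le> prime_prod r G \<omega> \<and> prime_prod r G \<omega> \<le> 1"
  using AE_prime_prod_bounds by eventually_elim simp

lemma U_prime_prod_measurable: "(\<lambda>\<omega>. U \<omega> * prime_prod r G \<omega>) \<in> borel_measurable N"
  by measurable

lemma AE_U_prime_prod_unit_interval:
  "AE \<omega> in N. 0 \<le> U \<omega> * prime_prod r G \<omega> \<and> U \<omega> * prime_prod r G \<omega> \<le> 1"
  using AE_U_bounds AE_prime_prod_bounds by eventually_elim (simp add: mult_le_one)

lemma tendsto_prob_if_threshold:
  assumes [measurable]: "\<phi> \<in> borel_measurable borel" "Measurable.pred N R"
    and P: "\<And>n v. v \<in> hyp_set l r n \<Longrightarrow>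
      P n v \<longleftrightarrow> scaled_prod l r n v \<le> \<phi> (lcm_prod {1..r} (valuations v))"
    and R: "AE \<omega> in N. R \<omega> \<longleftrightarrow> U \<omega> \<le> \<phi> (prime_prod r G \<omega>)"
  shows "(\<lambda>n. \<P>(v in hyp_pmf l r n. P n v)) \<longlonglongrightarrow> \<P>(\<omega> in N. R \<omega>)"
proof -
  have "(\<lambda>n. \<P>(v in hyp_pmf l r n. scaled_prod l r n v \<le> \<phi> (lcm_prod {1..r} (valuations v))))
      \<longlonglongrightarrow> \<P>(\<omega> in N. U \<omega> \<le> \<phi> (prime_prod r G \<omega>))"
    unfolding prime_prod_eq by (rule tendsto_prob_scaled_prod_le_fun_lcm_prod) measurable
  also have "\<P>(\<omega> in N. U \<omega> \<le> \<phi> (prime_prod r G \<omega>)) = \<P>(\<omega> in N. R \<omega>)"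
    by (rule prob_eq_AE) (use R in \<open>auto elim: eventually_mono\<close>)
  finally show ?thesis
  proof (rule Lim_transform_eventually)
    show "\<forall>\<^sub>F n in sequentially.
        \<P>(v in hyp_pmf l r n. scaled_prod l r n v \<le> \<phi> (lcm_prod {1..r} (valuations v)))
        = \<P>(v in hyp_pmf l r n. P n v)"
      using eventually_ge_at_top[of "r choose l"]
      by eventually_elim (intro prob_hyp_pmf_cong l_ge_1 l_le_r, simp_all add: P)
  qed
qed

lemma tendsto_prob_Lcm_ratio_le:
  "(\<lambda>n. \<P>(v in hyp_pmf l r n. Lcm_ratio v \<le> x)) \<longlonglongrightarrow> \<P>(\<omega> in N. prime_prod r G \<omega> \<le> x)"
proof -
  define \<phi> :: "real \<Rightarrow> real" where "\<phi> z = (if z \<le> x then 1 else 0)" for z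
  have threshold: "z \<le> x \<longleftrightarrow> s \<le> \<phi> z" if "0 < s" "s \<le> 1" for s z
    using that by (auto simp: \<phi>_def)
  show ?thesis
  proof (rule tendsto_prob_if_threshold)
    show "\<phi> \<in> borel_measurable borel" unfolding \<phi>_def by measurable
    show "Lcm_ratio v \<le> x \<longleftrightarrow> scaled_prod l r n v \<le> \<phi> (lcm_prod {1..r} (valuations v))"
      if "v \<in> hyp_set l r n" for n v
      unfolding Lcm_ratio_eq[OF that]
      by (intro threshold scaled_prod_pos scaled_prod_le_1 l_ge_1 l_le_r that)
    show "AE \<omega> in N. prime_prod r G \<omega> \<le> x \<longleftrightarrow> U \<omega> \<le> \<phi> (prime_prod r G \<omega>)"
      using AE_U_bounds by eventually_elim (auto intro!: threshold)
  qed measurable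
qed

lemma tendsto_prob_scaled_Lcm_le:
  "(\<lambda>n. \<P>(v in hyp_pmf l r n. scaled_Lcm n v \<le> x)) \<longlonglongrightarrow> \<P>(\<omega> in N. U \<omega> * prime_prod r G \<omega> \<le> x)"
proof (rule tendsto_prob_if_threshold[where \<phi> = "\<lambda>z. x / z"])
  show "scaled_Lcm n v \<le> x \<longleftrightarrow> scaled_prod l r n v \<le> x / lcm_prod {1..r} (valuations v)"
    if "v \<in> hyp_set l r n" for n v
    unfolding scaled_Lcm_eq[OF that] using lcm_prod_valuations_bounds(1)[OF that]
    by (rule pos_le_divide_eq[symmetric])
  show "AE \<omega> in N. U \<omega> * prime_prod r G \<omega> \<le> x \<longleftrightarrow> U \<omega> \<le> x / prime_prod r G \<omega>"
    using AE_prime_prod_bounds by eventually_elim (simp add: pos_le_divide_eq)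
qed measurable

lemma Lcm_ratio_bounds:
  "v \<in> hyp_set l r n \<Longrightarrow> 0 \<le> Lcm_ratio v \<and> Lcm_ratio v \<le> 1"
  unfolding Lcm_ratio_eq using lcm_prod_valuations_bounds[of v n] by simp

lemma scaled_Lcm_bounds:
  "v \<in> hyp_set l r n \<Longrightarrow> 0 \<le> scaled_Lcm n v \<and> scaled_Lcm n v \<le> 1"
  unfolding scaled_Lcm_eq
  using lcm_prod_valuations_bounds[of v n] scaled_prod_pos[OF l_ge_1 l_le_r, of v n]
    scaled_prod_le_1[OF l_ge_1 l_le_r, of v n]
  by (simp add: mult_le_one)

end

section \<open>Convergence in distribution and of moments\<close>

lemma cdf_distr_borel:
  "X \<in> borel_measurable M \<Longrightarrow> cdf (distr M borel X) x = \<P>(\<omega> in M. X \<omega> \<le> x)"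
  unfolding cdf_def by (subst measure_distr) (auto intro!: arg_cong[where f = "measure M"])

lemma conv_in_distr_if_tendsto_cdf:
  assumes X: "\<forall>\<^sub>F n in sequentially. X n \<in> borel_measurable (M n)" and Y: "Y \<in> borel_measurable N"
    and lim: "\<And>x. (\<lambda>n. \<P>(\<omega> in M n. X n \<omega> \<le> x)) \<longlonglongrightarrow> \<P>(\<omega> in N. Y \<omega> \<le> x)"
  shows "conv_in_distr M X N Y"
proof -
  have "(\<lambda>n. cdf (distr (M n) borel (X n)) x) \<longlonglongrightarrow> cdf (distr N borel Y) x" for x
    unfolding cdf_distr_borel[OF Y]
  proof (rule Lim_transform_eventually[OF lim])
    show "\<forall>\<^sub>F n in sequentially. \<P>(\<omega> in M n. X n \<omega> \<le> x) = cdf (distr (M n) borel (X n)) x"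
      using X by eventually_elim (simp add: cdf_distr_borel)
  qed
  then show ?thesis
    using X Y by (simp add: conv_in_distr_def weak_conv_m_def weak_conv_def)
qed

definition clipped_power :: "real \<Rightarrow> real \<Rightarrow> real \<Rightarrow> real" where
  "clipped_power b s t = max 0 (min b t) powr s"

lemma continuous_clipped_power: "0 < s \<Longrightarrow> continuous_on UNIV (clipped_power b s)"
  unfolding clipped_power_def by (intro continuous_on_powr' continuous_intros) auto

lemma norm_clipped_power_le: "0 < s \<Longrightarrow> norm (clipped_power b s t) \<le> \<bar>b\<bar> powr s"
  unfolding clipped_power_def by (auto intro!: powr_mono2)

lemma integral_powr_eq_clipped_power:
  assumes M: "prob_space M" and X [measurable]: "X \<in> borel_measurable M"
    and bounds: "AE \<omega> in M. 0 \<le> X \<omega> \<and> X \<omega> \<le> b" and s: "0 < s"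
  shows "integrable M (\<lambda>\<omega>. X \<omega> powr s)"
    and "(\<integral>\<omega>. X \<omega> powr s \<partial>M) = (\<integral>t. clipped_power b s t \<partial>distr M borel X)"
proof -
  interpret prob_space M by (rule M)
  have [measurable]: "clipped_power b s \<in> borel_measurable borel"
    using continuous_clipped_power[OF s] by (rule borel_measurable_continuous_onI)
  have eq: "AE \<omega> in M. clipped_power b s (X \<omega>) = X \<omega> powr s"
    using bounds by eventually_elim (simp add: clipped_power_def)
  have "integrable M (\<lambda>\<omega>. clipped_power b s (X \<omega>))"
    using norm_clipped_power_le[OF s] by (intro integrable_const_bound[where B = "\<bar>b\<bar> powr s"]) auto
  then show "integrable M (\<lambda>\<omega>. X \<omega> powr s)"
    by (subst integrable_cong_AE[OF _ _ eq, symmetric]) auto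
  have "(\<integral>\<omega>. X \<omega> powr s \<partial>M) = (\<integral>\<omega>. clipped_power b s (X \<omega>) \<partial>M)"
    using eq by (intro integral_cong_AE) auto
  then show "(\<integral>\<omega>. X \<omega> powr s \<partial>M) = (\<integral>t. clipped_power b s t \<partial>distr M borel X)"
    by (simp add: integral_distr)
qed

lemma moments_converge_if_conv_in_distr:
  assumes M: "\<forall>\<^sub>F n in sequentially. prob_space (M n) \<and> (AE \<omega> in M n. 0 \<le> X n \<omega> \<and> X n \<omega> \<le> b)"
    and N: "prob_space N" "AE \<omega> in N. 0 \<le> Y \<omega> \<and> Y \<omega> \<le> b"
    and conv: "conv_in_distr M X N Y"
  shows "moments_converge M X N Y"
  unfolding moments_converge_def
proof (intro allI impI conjI)
  fix s :: real assume s: "0 < s"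
  have Y: "Y \<in> borel_measurable N" using conv by (simp add: conv_in_distr_def)
  show "integrable N (\<lambda>\<omega>. Y \<omega> powr s)" by (rule integral_powr_eq_clipped_power(1)[OF N(1) Y N(2) s])
  have "\<forall>\<^sub>F n in sequentially. X n \<in> borel_measurable (M n) \<and> prob_space (M n) \<and>
      (AE \<omega> in M n. 0 \<le> X n \<omega> \<and> X n \<omega> \<le> b)"
    using M conv by (auto simp: conv_in_distr_def elim: eventually_elim2)
  then obtain n0 where n0: "\<And>n. n0 \<le> n \<Longrightarrow> X n \<in> borel_measurable (M n)"
    "\<And>n. n0 \<le> n \<Longrightarrow> prob_space (M n)" "\<And>n. n0 \<le> n \<Longrightarrow> AE \<omega> in M n. 0 \<le> X n \<omega> \<and> X n \<omega> \<le> b"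
    by (auto simp: eventually_sequentially)
  note moment = integral_powr_eq_clipped_power[OF n0(2) n0(1) n0(3) s]
  show "\<forall>\<^sub>F n in sequentially. integrable (M n) (\<lambda>\<omega>. X n \<omega> powr s)"
    using moment(1) by (auto simp: eventually_sequentially)
  have "(\<lambda>n. \<integral>t. clipped_power b s t \<partial>distr (M (n + n0)) borel (X (n + n0)))
      \<longlonglongrightarrow> (\<integral>t. clipped_power b s t \<partial>distr N borel Y)"
  proof (rule weak_conv_imp_integral_bdd_continuous_conv)
    show "real_distribution (distr (M (n + n0)) borel (X (n + n0)))" for n
      using prob_space.real_distribution_distr[OF n0(2,1)] by simp
    show "real_distribution (distr N borel Y)"
      by (rule prob_space.real_distribution_distr[OF N(1) Y])
    show "weak_conv_m (\<lambda>n. distr (M (n + n0)) borel (X (n + n0))) (distr N borel Y)"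
      using conv LIMSEQ_ignore_initial_segment[where k = n0]
      unfolding conv_in_distr_def weak_conv_m_def weak_conv_def by blast
    show "isCont (clipped_power b s) t" for t
      using continuous_clipped_power[OF s] by (simp add: continuous_on_eq_continuous_at)
  qed (rule norm_clipped_power_le[OF s])
  then have "(\<lambda>n. \<integral>\<omega>. X (n + n0) \<omega> powr s \<partial>M (n + n0)) \<longlonglongrightarrow> (\<integral>\<omega>. Y \<omega> powr s \<partial>N)"
    using moment(2) integral_powr_eq_clipped_power(2)[OF N(1) Y N(2) s] by simp
  then show "(\<lambda>n. \<integral>\<omega>. X n \<omega> powr s \<partial>M n) \<longlonglongrightarrow> (\<integral>\<omega>. Y \<omega> powr s \<partial>N)"
    by (rule LIMSEQ_offset)
qed

lemma measurable_uniform_on_hyp: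
  assumes "uniform_on_hyp l r n M V"
  shows "(\<lambda>\<omega>. \<lambda>k\<in>{1..r}. V k \<omega>) \<in> M \<rightarrow>\<^sub>M count_space UNIV"
proof -
  have "(\<lambda>\<omega>. restrict (\<lambda>k. V k \<omega>) {1..r}) \<in> M \<rightarrow>\<^sub>M count_space ({1..r} \<rightarrow>\<^sub>E UNIV)"
    using assms unfolding uniform_on_hyp_def by (intro measurable_restrict_count_space) auto
  then show ?thesis by (rule measurable_compose) simp
qed

lemma prob_uniform_on_hyp:
  assumes V: "uniform_on_hyp l r n M V"
  shows "\<P>(\<omega> in M. P (\<lambda>k\<in>{1..r}. V k \<omega>)) = \<P>(v in hyp_pmf l r n. P v)"
proof -
  have "\<P>(\<omega> in M. P (\<lambda>k\<in>{1..r}. V k \<omega>))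
      = measure (distr M (count_space UNIV) (\<lambda>\<omega>. \<lambda>k\<in>{1..r}. V k \<omega>)) {v. P v}"
    using measurable_uniform_on_hyp[OF V]
    by (subst measure_distr) (auto intro!: arg_cong[where f = "measure M"])
  then show ?thesis using V by (simp add: uniform_on_hyp_def)
qed

lemma AE_uniform_on_hyp:
  assumes M: "prob_space M" and V: "uniform_on_hyp l r n M V"
    and P: "AE v in hyp_pmf l r n. P v"
  shows "AE \<omega> in M. P (\<lambda>k\<in>{1..r}. V k \<omega>)"
proof -
  interpret prob_space M by (rule M)
  have "\<P>(\<omega> in M. P (\<lambda>k\<in>{1..r}. V k \<omega>)) = 1"
    unfolding prob_uniform_on_hyp[OF V] using P by (subst measure_pmf.prob_Collect_eq_1) auto
  from AE_prob_1[OF this] show ?thesis by eventually_elim simp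
qed

lemma prod_restrict: "(\<Prod>k\<in>I. restrict v I k) = (\<Prod>k\<in>I. v k)"
  by (rule prod.cong) auto

lemma conv_and_moments_of_uniform_on_hyp:
  fixes \<xi> :: "nat \<Rightarrow> (nat \<Rightarrow> nat) \<Rightarrow> real"
  assumes deg: "1 \<le> l" "l \<le> r"
    and M: "\<And>n. r choose l \<le> n \<Longrightarrow> prob_space (M n)"
    and V: "\<And>n. r choose l \<le> n \<Longrightarrow> uniform_on_hyp l r n (M n) (V n)"
    and \<xi>: "\<And>n v. \<xi> n (restrict v {1..r}) = \<xi> n v"
      "\<And>n v. v \<in> hyp_set l r n \<Longrightarrow> 0 \<le> \<xi> n v \<and> \<xi> n v \<le> 1"
    and N: "prob_space N" and Y: "Y \<in> borel_measurable N" "AE \<omega> in N. 0 \<le> Y \<omega> \<and> Y \<omega> \<le> 1"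
    and lim: "\<And>x. (\<lambda>n. \<P>(v in hyp_pmf l r n. \<xi> n v \<le> x)) \<longlonglongrightarrow> \<P>(\<omega> in N. Y \<omega> \<le> x)"
  shows "conv_in_distr M (\<lambda>n \<omega>. \<xi> n (\<lambda>k. V n k \<omega>)) N Y
       \<and> moments_converge M (\<lambda>n \<omega>. \<xi> n (\<lambda>k. V n k \<omega>)) N Y"
proof
  have "(\<lambda>\<omega>. \<xi> n (\<lambda>k\<in>{1..r}. V n k \<omega>)) \<in> borel_measurable (M n)" if "r choose l \<le> n" for n
    by (rule measurable_compose[OF measurable_uniform_on_hyp[OF V[OF that]]]) simp
  then have measurable: "\<forall>\<^sub>F n in sequentially. (\<lambda>\<omega>. \<xi> n (\<lambda>k. V n k \<omega>)) \<in> borel_measurable (M n)"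
    unfolding \<xi>(1) eventually_sequentially by blast
  have "AE v in hyp_pmf l r n. 0 \<le> \<xi> n v \<and> \<xi> n v \<le> 1" if "r choose l \<le> n" for n
    using AE_hyp_pmf[OF deg that] by eventually_elim (rule \<xi>(2))
  then have "AE \<omega> in M n. 0 \<le> \<xi> n (\<lambda>k. V n k \<omega>) \<and> \<xi> n (\<lambda>k. V n k \<omega>) \<le> 1" if "r choose l \<le> n" for n
    using AE_uniform_on_hyp[OF M[OF that] V[OF that], of "\<lambda>v. 0 \<le> \<xi> n v \<and> \<xi> n v \<le> 1"] that
    unfolding \<xi>(1) by blast
  then have bounds: "\<forall>\<^sub>F n in sequentially. prob_space (M n) \<and>
      (AE \<omega> in M n. 0 \<le> \<xi> n (\<lambda>k. V n k \<omega>) \<and> \<xi> n (\<lambda>k. V n k \<omega>) \<le> 1)"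
    using M by (auto simp: eventually_sequentially)
  have "\<P>(v in hyp_pmf l r n. \<xi> n v \<le> x) = \<P>(\<omega> in M n. \<xi> n (\<lambda>k. V n k \<omega>) \<le> x)"
    if "r choose l \<le> n" for n x
    using prob_uniform_on_hyp[OF V[OF that], of "\<lambda>v. \<xi> n v \<le> x"] unfolding \<xi>(1) by (rule sym)
  then have "(\<lambda>n. \<P>(\<omega> in M n. \<xi> n (\<lambda>k. V n k \<omega>) \<le> x)) \<longlonglongrightarrow> \<P>(\<omega> in N. Y \<omega> \<le> x)" for x
    by (intro Lim_transform_eventually[OF lim]) (auto simp: eventually_sequentially)
  then show conv: "conv_in_distr M (\<lambda>n \<omega>. \<xi> n (\<lambda>k. V n k \<omega>)) N Y"
    by (rule conv_in_distr_if_tendsto_cdf[OF measurable Y(1)])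
  show "moments_converge M (\<lambda>n \<omega>. \<xi> n (\<lambda>k. V n k \<omega>)) N Y"
    by (rule moments_converge_if_conv_in_distr[OF bounds N Y(2) conv])
qed

theorem theorem3p7:
  fixes l r :: nat
    and M :: "nat \<Rightarrow> 'a measure" and V :: "nat \<Rightarrow> nat \<Rightarrow> 'a \<Rightarrow> nat"
    and N :: "'b measure" and G :: "nat \<Rightarrow> nat \<Rightarrow> 'b \<Rightarrow> nat" and U :: "'b \<Rightarrow> real"
  assumes "r \<ge> 2" and "1 \<le> l" and "l \<le> r"
    and "\<And>n. n \<ge> r choose l \<Longrightarrow> prob_space (M n)"
    and "\<And>n. n \<ge> r choose l \<Longrightarrow> uniform_on_hyp l r n (M n) (V n)"
    and "prob_space N"
    and "geometric_family N G"
    and "has_U_law l r N U"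
    and "indep_of_family N U G"
  shows "conv_in_distr M
           (\<lambda>n \<omega>. real (LCM k\<in>{1..r}. V n k \<omega>) / real (\<Prod>k=1..r. V n k \<omega>))
           N (prime_prod r G)
       \<and> conv_in_distr M
           (\<lambda>n \<omega>. real (LCM k\<in>{1..r}. V n k \<omega>) / real n powr (real r / real l))
           N (\<lambda>\<omega>. U \<omega> * prime_prod r G \<omega>)
       \<and> moments_converge M
           (\<lambda>n \<omega>. real (LCM k\<in>{1..r}. V n k \<omega>) / real (\<Prod>k=1..r. V n k \<omega>))
           N (prime_prod r G)
       \<and> moments_converge M
           (\<lambda>n \<omega>. real (LCM k\<in>{1..r}. V n k \<omega>) / real n powr (real r / real l))
           N (\<lambda>\<omega>. U \<omega> * prime_prod r G \<omega>)"
proof -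
  interpret lcm_limit N l r G U
    using assms by (intro lcm_limit.intro lcm_limit_axioms.intro)
  have "conv_in_distr M (\<lambda>n \<omega>. Lcm_ratio (\<lambda>k. V n k \<omega>)) N (prime_prod r G)
      \<and> moments_converge M (\<lambda>n \<omega>. Lcm_ratio (\<lambda>k. V n k \<omega>)) N (prime_prod r G)"
    by (rule conv_and_moments_of_uniform_on_hyp[where \<xi> = "\<lambda>n. Lcm_ratio"])
      (rule assms Lcm_ratio_bounds prime_prod_measurable AE_prime_prod_unit_interval
          tendsto_prob_Lcm_ratio_le
        | assumption | simp only: image_restrict_eq prod_restrict)+
  moreover have
    "conv_in_distr M (\<lambda>n \<omega>. scaled_Lcm n (\<lambda>k. V n k \<omega>)) N (\<lambda>\<omega>. U \<omega> * prime_prod r G \<omega>)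
      \<and> moments_converge M (\<lambda>n \<omega>. scaled_Lcm n (\<lambda>k. V n k \<omega>)) N (\<lambda>\<omega>. U \<omega> * prime_prod r G \<omega>)"
    by (rule conv_and_moments_of_uniform_on_hyp[where \<xi> = scaled_Lcm])
      (rule assms scaled_Lcm_bounds U_prime_prod_measurable AE_U_prime_prod_unit_interval
          tendsto_prob_scaled_Lcm_le
        | assumption | simp only: image_restrict_eq)+
  ultimately show ?thesis by blast
qed

end
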